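(* A smooth tropical fan is both principal and div-faithful.
   Context: **Fans.** $N$ is a free $\mathbb Z$-module of finite rank, $N_{\mathbb R}=N\otimes\mathbb R$. A rational fan $\Sigma$ in $N_{\mathbb R}$ is a non-empty finite collection of strongly convex rational polyhedral cones, closed under taking faces, any two of which meet along a common face. $|\Sigma|$ is the support, $\Sigma_k$ the set of $k$-dimensional cones, $\underline0=\{0\}$; $\tau\prec\sigma$ means that $\tau$ is a face of $\sigma$. Put $N_\sigma=N\cap\mathrm{span}(\sigma)$, $N^\sigma=N/N_\sigma$. The star fan $\Sigma^\sigma$ is the fan in $N^\sigma_{\mathbb R}$ formed by the images of the cones of $\Sigma$ containing $\sigma$. If $\tau\prec\sigma$ has codimension one, $e^\tau_\sigma$ is the generator of $N_\sigma/N_\tau$ lying in the image of $\sigma$, and $\mathfrak n_{\sigma/\tau}\in N_\sigma$ is any lift of it. A tropical fan of dimension $d$ is a rational fan of pure dimension $d$ with $\sum_{\sigma\in\Sigma_d,\sigma\supset\tau}e^\tau_\sigma=0$ in $N^\tau$ for every $\tau\in\Sigma_{d-1}$. **Smoothness.** $\mathbf F_p(\sigma)=\sum_{\eta\in\Sigma,\eta\supseteq\sigma}\bigwedge^pN_\eta\subseteq\bigwedge^pN$, $\mathbf F^p(\sigma)=\mathrm{Hom}(\mathbf F_p(\sigma),\mathbb Z)$. Fix generators $\nu_\sigma$ of $\bigwedge^{\dim\sigma}N_\sigma$. $H^{BM}_{p,q}(\Sigma)$ is the $q$-th homology of $C^{BM}_{p,q}(\Sigma)=\bigoplus_{\sigma\in\Sigma_q}\mathbf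 F_p(\sigma)$, with boundary the sum over codimension one faces $\tau\prec\sigma$ of $\mathrm{sign}(\tau,\sigma)$ times the inclusion $\mathbf F_p(\sigma)\subseteq\mathbf F_p(\tau)$, where $\mathfrak n_{\sigma/\tau}\wedge\nu_\tau=\mathrm{sign}(\tau,\sigma)\nu_\sigma$. For a tropical fan of dimension $d$, $\nu_\Sigma=(\nu_\sigma)_{\sigma\in\Sigma_d}$ is a cycle; $\Sigma$ satisfies Poincaré duality if the cap product with $\nu_\Sigma$ is an isomorphism $H^{p,q}(\Sigma)\to H^{BM}_{d-p,d-q}(\Sigma)$ for all $p,q$, i.e. $H^{BM}_{a,b}(\Sigma)=0$ for $b\ne d$ and $\mathbf F^p(\underline0)\to H^{BM}_{d-p,d}(\Sigma)$, $\alpha\mapsto(\iota_\alpha(\nu_\sigma))_\sigma$ (contraction), is an isomorphism for all $p$. $\Sigma$ is smooth if $\Sigma^\sigma$ satisfies Poincaré duality for every $\sigma\in\Sigma$. **Divisors.** A divisor on a tropical fan $\Sigma$ of dimension $d$ is a function $w\colon\Sigma_{d-1}\to\mathbb Z$ with $\sum_{\tau\in\Sigma_{d-1},\tau\supset\eta}w(\tau)e^\eta_\tau=0$ in $N^\eta$ for every $\eta\in\Sigma_{d-2}$. A conewise integral linear function on $\Sigma$ is a continuous $f\colon|\Sigma|\to\mathbb R$ whose restriction to each cone $\sigma$ is given by an integral linear form $f_\sigma$ on $N_\sigma$. Its divisor $\mathrm{div}(f)$ is $\tau\mapsto\mathrm{ord}_\tau(f)=-\sum_{\sigma\in\Sigma_d,\sigma\supset\tau}f_\sigma(\mathfrak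 n_{\sigma/\tau})+f_\tau\bigl(\sum_{\sigma\in\Sigma_d,\sigma\supset\tau}\mathfrak n_{\sigma/\tau}\bigr)$. A divisor is principal if it is of the form $\mathrm{div}(f)$. A linear function on $\Sigma$ is the restriction to $|\Sigma|$ of a linear function on $N_{\mathbb R}$. $\Sigma$ is principal if for every $\eta\in\Sigma$ every divisor on $\Sigma^\eta$ is principal. $\Sigma$ is div-faithful if for every $\eta\in\Sigma$ and every conewise integral linear function $f$ on $\Sigma^\eta$ with $\mathrm{div}(f)=0$, $f$ is a linear function on $\Sigma^\eta$. *)

theory Defs
  imports
    "HOL-Analysis.Analysis"
    "HOL-Library.Function_Algebras"
    "HOL-Computational_Algebra.Group_Closure"
    "HOL-Algebra.Product_Groups"
begin

section \<open>Lattices and their quotients\<close>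

text \<open>
  A free \<open>\<int>\<close>-module of finite rank is given by a subgroup \<open>N\<close> of a Euclidean space that has a
  \<open>\<int>\<close>-basis which is linearly independent over \<open>\<real>\<close>; then \<open>N \<otimes> \<real>\<close> is \<open>span N\<close>. The rank of \<open>N\<close> may be
  smaller than the dimension of the ambient space, in particular it may be \<open>0\<close>.
\<close>

definition lattice_basis :: "'v::euclidean_space set \<Rightarrow> 'v list \<Rightarrow> bool" where
  "lattice_basis N vs \<longleftrightarrow> distinct vs \<and> independent (set vs) \<and> group_closure (set vs) = N"

definition zlattice :: "'v::euclidean_space set \<Rightarrow> bool" where
  "zlattice N \<longleftrightarrow> (\<exists>vs. lattice_basis N vs)"

definition sublattice :: "'v::euclidean_space set \<Rightarrow> 'v set \<Rightarrow> 'v set" where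
  "sublattice N \<sigma> = N \<inter> span \<sigma>"

text \<open>
  The quotient of the ambient space by a subspace \<open>W\<close> is realised on the orthogonal complement of
  \<open>W\<close>: the quotient map is the orthogonal projection along \<open>W\<close>, whose kernel is \<open>W\<close>. Its
  restriction to \<open>N\<close> has kernel \<open>N \<inter> W\<close>, so that the image of \<open>N\<close> is \<open>N / (N \<inter> W)\<close>.
\<close>

definition quot_map :: "'v::euclidean_space set \<Rightarrow> 'v \<Rightarrow> 'v" where
  "quot_map W x = (THE y. y \<in> orthogonal_comp W \<and> x - y \<in> W)"

definition quot_lattice :: "'v::euclidean_space set \<Rightarrow> 'v set \<Rightarrow> 'v set" where
  "quot_lattice N \<sigma> = quot_map (span \<sigma>) ` N"


section \<open>Fans\<close>

definition rational_cone :: "'v::euclidean_space set \<Rightarrow> 'v set \<Rightarrow> bool" where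
  "rational_cone N \<sigma> \<longleftrightarrow> (\<exists>S. finite S \<and> S \<subseteq> N \<and> \<sigma> = convex_cone hull S)"

definition strongly_convex :: "'v::euclidean_space set \<Rightarrow> bool" where
  "strongly_convex \<sigma> \<longleftrightarrow> (\<forall>x. x \<in> \<sigma> \<and> - x \<in> \<sigma> \<longrightarrow> x = 0)"

text \<open>The library's \<^const>\<open>face_of\<close> admits the empty set as a face, which is not a face of a cone.\<close>

definition rational_fan :: "'v::euclidean_space set \<Rightarrow> 'v set set \<Rightarrow> bool" where
  "rational_fan N \<Sigma> \<longleftrightarrow>
     finite \<Sigma> \<and> \<Sigma> \<noteq> {} \<and>
     (\<forall>\<sigma>\<in>\<Sigma>. rational_cone N \<sigma> \<and> strongly_convex \<sigma>) \<and>
     (\<forall>\<sigma>\<in>\<Sigma>. \<forall>\<tau>. \<tau> face_of \<sigma> \<and> \<tau> \<noteq> {} \<longrightarrow> \<tau> \<in> \<Sigma>) \<and>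
     (\<forall>\<sigma>\<in>\<Sigma>. \<forall>\<tau>\<in>\<Sigma>. \<sigma> \<inter> \<tau> face_of \<sigma> \<and> \<sigma> \<inter> \<tau> face_of \<tau>)"

text \<open>The dimension \<open>k\<close> is an integer so that there are no cones of dimension \<open>-1\<close> or \<open>-2\<close>.\<close>

definition cones :: "'v::euclidean_space set set \<Rightarrow> int \<Rightarrow> 'v set set" where
  "cones \<Sigma> k = {\<sigma>\<in>\<Sigma>. int (dim \<sigma>) = k}"

definition star_fan :: "'v::euclidean_space set set \<Rightarrow> 'v set \<Rightarrow> 'v set set" where
  "star_fan \<Sigma> \<sigma> = {quot_map (span \<sigma>) ` \<eta> | \<eta>. \<eta> \<in> \<Sigma> \<and> \<sigma> \<subseteq> \<eta>}"

definition pure_dim :: "nat \<Rightarrow> 'v::euclidean_space set set \<Rightarrow> bool" where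
  "pure_dim d \<Sigma> \<longleftrightarrow> (\<forall>\<sigma>\<in>\<Sigma>. (\<forall>\<eta>\<in>\<Sigma>. \<sigma> \<subseteq> \<eta> \<longrightarrow> \<eta> = \<sigma>) \<longrightarrow> dim \<sigma> = d)"

text \<open>For a codimension one face \<open>\<tau>\<close> of \<open>\<sigma>\<close>: the generator of \<open>N\<^sub>\<sigma> / N\<^sub>\<tau>\<close> lying in the image of \<open>\<sigma>\<close>, as
  an element of the quotient of \<open>N\<close> by \<open>N\<^sub>\<tau>\<close>, and a lift of it to \<open>N\<^sub>\<sigma>\<close>.\<close>

definition ray_gen :: "'v::euclidean_space set \<Rightarrow> 'v set \<Rightarrow> 'v set \<Rightarrow> 'v" where
  "ray_gen N \<tau> \<sigma> = (THE e. e \<in> quot_map (span \<tau>) ` \<sigma> \<and>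
      group_closure {e} = quot_map (span \<tau>) ` sublattice N \<sigma>)"

definition ray_lift :: "'v::euclidean_space set \<Rightarrow> 'v set \<Rightarrow> 'v set \<Rightarrow> 'v" where
  "ray_lift N \<tau> \<sigma> = (SOME n. n \<in> sublattice N \<sigma> \<and> quot_map (span \<tau>) n = ray_gen N \<tau> \<sigma>)"

definition tropical_fan :: "'v::euclidean_space set \<Rightarrow> nat \<Rightarrow> 'v set set \<Rightarrow> bool" where
  "tropical_fan N d \<Sigma> \<longleftrightarrow> rational_fan N \<Sigma> \<and> pure_dim d \<Sigma> \<and>
     (\<forall>\<tau>\<in>cones \<Sigma> (int d - 1). (\<Sum>\<sigma> | \<sigma> \<in> cones \<Sigma> (int d) \<and> \<tau> \<subseteq> \<sigma>. ray_gen N \<tau> \<sigma>) = 0)"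


section \<open>Exterior powers\<close>

text \<open>
  The exterior algebra of the ambient space is embedded into the multilinear forms:
  \<open>v\<^sub>1 \<and> \<dots> \<and> v\<^sub>p\<close> is the alternating form \<open>(u\<^sub>1, \<dots>, u\<^sub>p) \<mapsto> det (u\<^sub>i \<bullet> v\<^sub>j)\<close>, extended by \<open>0\<close> to lists \<open>u\<close> of
  length different from \<open>p\<close>. Left exterior multiplication by a vector \<open>v\<close> is the expansion of the
  determinant along the column of \<open>v\<close>.
\<close>

type_synonym 'v mvec = "'v list \<Rightarrow> real"

definition ext_mult :: "'v::euclidean_space \<Rightarrow> 'v mvec \<Rightarrow> 'v mvec" where
  "ext_mult v \<omega> = (\<lambda>us. \<Sum>i<length us. (-1) ^ i * (us ! i \<bullet> v) * \<omega> (take i us @ drop (Suc i) us))"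

definition wedge :: "'v::euclidean_space list \<Rightarrow> 'v mvec" where
  "wedge vs = foldr ext_mult vs (\<lambda>us. if us = [] then 1 else 0)"

definition ext_power :: "nat \<Rightarrow> 'v::euclidean_space set \<Rightarrow> 'v mvec set" where
  "ext_power p L = group_closure {wedge vs | vs. length vs = p \<and> set vs \<subseteq> L}"

definition int_scale :: "int \<Rightarrow> 'v mvec \<Rightarrow> 'v mvec" where
  "int_scale k \<omega> = (\<lambda>us. of_int k * \<omega> us)"

text \<open>
  The generator \<open>\<nu>\<^sub>\<sigma>\<close> of the top exterior power of \<open>N\<^sub>\<sigma>\<close> is fixed by choosing a basis of \<open>N\<^sub>\<sigma>\<close>.
\<close>

definition orient_basis :: "'v::euclidean_space set \<Rightarrow> 'v set \<Rightarrow> 'v list" where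
  "orient_basis N \<sigma> = (SOME vs. lattice_basis (sublattice N \<sigma>) vs)"

definition orient :: "'v::euclidean_space set \<Rightarrow> 'v set \<Rightarrow> 'v mvec" where
  "orient N \<sigma> = wedge (orient_basis N \<sigma>)"

definition face_sign :: "'v::euclidean_space set \<Rightarrow> 'v set \<Rightarrow> 'v set \<Rightarrow> int" where
  "face_sign N \<tau> \<sigma> = (THE s. ext_mult (ray_lift N \<tau> \<sigma>) (orient N \<tau>) = int_scale s (orient N \<sigma>))"

text \<open>
  Contraction of \<open>v\<^sub>1 \<and> \<dots> \<and> v\<^sub>n\<close> by a \<open>p\<close>-form \<open>\<alpha>\<close>: the sum of \<open>\<epsilon>\<^sub>I \<cdot> \<alpha>(v\<^sub>I) \<cdot> v\<^sub>J\<close> over the \<open>p\<close>-element sets \<open>I\<close> of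
  indices with complement \<open>J\<close>, where \<open>\<epsilon>\<^sub>I\<close> is the sign with \<open>v\<^sub>1 \<and> \<dots> \<and> v\<^sub>n = \<epsilon>\<^sub>I \<cdot> v\<^sub>I \<and> v\<^sub>J\<close>.
\<close>

definition shuffle_sign :: "nat \<Rightarrow> nat set \<Rightarrow> int" where
  "shuffle_sign n I = (-1) ^ card {(i, j). i \<in> I \<and> j \<in> {..<n} - I \<and> j < i}"

definition contraction :: "nat \<Rightarrow> ('v::euclidean_space mvec \<Rightarrow> int) \<Rightarrow> 'v list \<Rightarrow> 'v mvec" where
  "contraction p \<alpha> vs =
     (\<Sum>I | I \<subseteq> {..<length vs} \<and> card I = p.
        int_scale (shuffle_sign (length vs) I * \<alpha> (wedge (nths vs I))) (wedge (nths vs (- I))))"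


section \<open>Tropical homology and smoothness\<close>

definition F_lower :: "'v::euclidean_space set \<Rightarrow> 'v set set \<Rightarrow> nat \<Rightarrow> 'v set \<Rightarrow> 'v mvec set" where
  "F_lower N \<Sigma> p \<sigma> = group_closure (\<Union>\<eta>\<in>{\<eta>\<in>\<Sigma>. \<sigma> \<subseteq> \<eta>}. ext_power p (sublattice N \<eta>))"

definition additive_group :: "'a::ab_group_add set \<Rightarrow> 'a monoid" where
  "additive_group A = \<lparr>carrier = A, monoid.mult = (+), one = 0\<rparr>"

definition dual_group :: "('a, 'b) monoid_scheme \<Rightarrow> ('a \<Rightarrow> int) monoid" where
  "dual_group G = \<lparr>carrier = hom G integer_group \<inter> extensional (carrier G),
     monoid.mult = (\<lambda>f g. \<lambda>x\<in>carrier G. f x + g x), one = (\<lambda>x\<in>carrier G. 0)\<rparr>"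

definition F_upper :: "'v::euclidean_space set \<Rightarrow> 'v set set \<Rightarrow> nat \<Rightarrow> 'v set \<Rightarrow> ('v mvec \<Rightarrow> int) monoid" where
  "F_upper N \<Sigma> p \<sigma> = dual_group (additive_group (F_lower N \<Sigma> p \<sigma>))"

text \<open>Fans are finite, so that the direct sum of the groups \<open>F\<^sub>p(\<sigma>)\<close> is their product.\<close>

definition BM_chains ::
  "'v::euclidean_space set \<Rightarrow> 'v set set \<Rightarrow> nat \<Rightarrow> int \<Rightarrow> ('v set \<Rightarrow> 'v mvec) monoid" where
  "BM_chains N \<Sigma> p q = product_group (cones \<Sigma> q) (\<lambda>\<sigma>. additive_group (F_lower N \<Sigma> p \<sigma>))"

definition BM_boundary ::
  "'v::euclidean_space set \<Rightarrow> 'v set set \<Rightarrow> int \<Rightarrow> ('v set \<Rightarrow> 'v mvec) \<Rightarrow> 'v set \<Rightarrow> 'v mvec" where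
  "BM_boundary N \<Sigma> q c =
     (\<lambda>\<tau>\<in>cones \<Sigma> (q - 1). \<Sum>\<sigma> | \<sigma> \<in> cones \<Sigma> q \<and> \<tau> face_of \<sigma>. int_scale (face_sign N \<tau> \<sigma>) (c \<sigma>))"

definition BM_cycles ::
  "'v::euclidean_space set \<Rightarrow> 'v set set \<Rightarrow> nat \<Rightarrow> int \<Rightarrow> ('v set \<Rightarrow> 'v mvec) monoid" where
  "BM_cycles N \<Sigma> p q = (BM_chains N \<Sigma> p q)
     \<lparr>carrier := kernel (BM_chains N \<Sigma> p q) (BM_chains N \<Sigma> p (q - 1)) (BM_boundary N \<Sigma> q)\<rparr>"

definition BM_boundaries ::
  "'v::euclidean_space set \<Rightarrow> 'v set set \<Rightarrow> nat \<Rightarrow> int \<Rightarrow> ('v set \<Rightarrow> 'v mvec) set" where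
  "BM_boundaries N \<Sigma> p q = BM_boundary N \<Sigma> (q + 1) ` carrier (BM_chains N \<Sigma> p (q + 1))"

definition BM_homology ::
  "'v::euclidean_space set \<Rightarrow> 'v set set \<Rightarrow> nat \<Rightarrow> int \<Rightarrow> ('v set \<Rightarrow> 'v mvec) set monoid" where
  "BM_homology N \<Sigma> p q = BM_cycles N \<Sigma> p q Mod BM_boundaries N \<Sigma> p q"

text \<open>The homology class of the cycle \<open>(\<iota>\<^sub>\<alpha>(\<nu>\<^sub>\<sigma>))\<^sub>\<sigma>\<close>.\<close>

definition cap_fundamental ::
  "'v::euclidean_space set \<Rightarrow> nat \<Rightarrow> 'v set set \<Rightarrow> nat \<Rightarrow> ('v mvec \<Rightarrow> int) \<Rightarrow> ('v set \<Rightarrow> 'v mvec) set" where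
  "cap_fundamental N d \<Sigma> p \<alpha> =
     BM_boundaries N \<Sigma> (d - p) (int d) #>\<^bsub>BM_cycles N \<Sigma> (d - p) (int d)\<^esub>
       (\<lambda>\<sigma>\<in>cones \<Sigma> (int d). contraction p \<alpha> (orient_basis N \<sigma>))"

text \<open>For \<open>p > d\<close> the group \<open>F\<^sup>p(0)\<close> and the homology in degree \<open>d - p < 0\<close> both vanish.\<close>

definition poincare_duality :: "'v::euclidean_space set \<Rightarrow> nat \<Rightarrow> 'v set set \<Rightarrow> bool" where
  "poincare_duality N d \<Sigma> \<longleftrightarrow>
     (\<forall>a b. b \<noteq> int d \<longrightarrow> trivial_group (BM_homology N \<Sigma> a b)) \<and>
     (\<forall>p\<le>d. cap_fundamental N d \<Sigma> p \<in> iso (F_upper N \<Sigma> p {0}) (BM_homology N \<Sigma> (d - p) (int d)))"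

definition smooth_fan :: "'v::euclidean_space set \<Rightarrow> nat \<Rightarrow> 'v set set \<Rightarrow> bool" where
  "smooth_fan N d \<Sigma> \<longleftrightarrow>
     (\<forall>\<sigma>\<in>\<Sigma>. poincare_duality (quot_lattice N \<sigma>) (d - dim \<sigma>) (star_fan \<Sigma> \<sigma>))"


section \<open>Divisors\<close>

text \<open>Only the values of \<open>w\<close> on the cones of codimension one are relevant.\<close>

definition divisor :: "'v::euclidean_space set \<Rightarrow> nat \<Rightarrow> 'v set set \<Rightarrow> ('v set \<Rightarrow> int) \<Rightarrow> bool" where
  "divisor N d \<Sigma> w \<longleftrightarrow> (\<forall>\<eta>\<in>cones \<Sigma> (int d - 2).
     (\<Sum>\<tau> | \<tau> \<in> cones \<Sigma> (int d - 1) \<and> \<eta> \<subseteq> \<tau>. of_int (w \<tau>) *\<^sub>R ray_gen N \<eta> \<tau>) = 0)"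

text \<open>
  An integral linear form on \<open>N\<^sub>\<sigma>\<close> is represented by a linear form on the ambient space; only its
  restriction to \<open>span \<sigma>\<close> matters, and this restriction is determined by \<open>f\<close>.
\<close>

definition represents_on ::
  "'v::euclidean_space set \<Rightarrow> 'v set \<Rightarrow> ('v \<Rightarrow> real) \<Rightarrow> ('v \<Rightarrow> real) \<Rightarrow> bool" where
  "represents_on N \<sigma> f g \<longleftrightarrow> linear g \<and> g ` sublattice N \<sigma> \<subseteq> \<int> \<and> (\<forall>x\<in>\<sigma>. f x = g x)"

definition cone_form :: "'v::euclidean_space set \<Rightarrow> ('v \<Rightarrow> real) \<Rightarrow> 'v set \<Rightarrow> 'v \<Rightarrow> real" where
  "cone_form N f \<sigma> = (SOME g. represents_on N \<sigma> f g)"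

definition conewise_integral_linear ::
  "'v::euclidean_space set \<Rightarrow> 'v set set \<Rightarrow> ('v \<Rightarrow> real) \<Rightarrow> bool" where
  "conewise_integral_linear N \<Sigma> f \<longleftrightarrow>
     continuous_on (\<Union>\<Sigma>) f \<and> (\<forall>\<sigma>\<in>\<Sigma>. \<exists>g. represents_on N \<sigma> f g)"

definition ord_along ::
  "'v::euclidean_space set \<Rightarrow> nat \<Rightarrow> 'v set set \<Rightarrow> ('v \<Rightarrow> real) \<Rightarrow> 'v set \<Rightarrow> real" where
  "ord_along N d \<Sigma> f \<tau> =
     - (\<Sum>\<sigma> | \<sigma> \<in> cones \<Sigma> (int d) \<and> \<tau> \<subseteq> \<sigma>. cone_form N f \<sigma> (ray_lift N \<tau> \<sigma>))
     + cone_form N f \<tau> (\<Sum>\<sigma> | \<sigma> \<in> cones \<Sigma> (int d) \<and> \<tau> \<subseteq> \<sigma>. ray_lift N \<tau> \<sigma>)"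

definition is_div ::
  "'v::euclidean_space set \<Rightarrow> nat \<Rightarrow> 'v set set \<Rightarrow> ('v \<Rightarrow> real) \<Rightarrow> ('v set \<Rightarrow> int) \<Rightarrow> bool" where
  "is_div N d \<Sigma> f w \<longleftrightarrow> (\<forall>\<tau>\<in>cones \<Sigma> (int d - 1). of_int (w \<tau>) = ord_along N d \<Sigma> f \<tau>)"

definition principal_divisor ::
  "'v::euclidean_space set \<Rightarrow> nat \<Rightarrow> 'v set set \<Rightarrow> ('v set \<Rightarrow> int) \<Rightarrow> bool" where
  "principal_divisor N d \<Sigma> w \<longleftrightarrow> (\<exists>f. conewise_integral_linear N \<Sigma> f \<and> is_div N d \<Sigma> f w)"

definition linear_on_fan :: "'v::euclidean_space set set \<Rightarrow> ('v \<Rightarrow> real) \<Rightarrow> bool" where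
  "linear_on_fan \<Sigma> f \<longleftrightarrow> (\<exists>g. linear g \<and> (\<forall>x\<in>\<Union>\<Sigma>. f x = g x))"

definition principal_fan :: "'v::euclidean_space set \<Rightarrow> nat \<Rightarrow> 'v set set \<Rightarrow> bool" where
  "principal_fan N d \<Sigma> \<longleftrightarrow> (\<forall>\<eta>\<in>\<Sigma>. \<forall>w.
     divisor (quot_lattice N \<eta>) (d - dim \<eta>) (star_fan \<Sigma> \<eta>) w \<longrightarrow>
     principal_divisor (quot_lattice N \<eta>) (d - dim \<eta>) (star_fan \<Sigma> \<eta>) w)"

definition div_faithful_fan :: "'v::euclidean_space set \<Rightarrow> nat \<Rightarrow> 'v set set \<Rightarrow> bool" where
  "div_faithful_fan N d \<Sigma> \<longleftrightarrow> (\<forall>\<eta>\<in>\<Sigma>. \<forall>f.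
     conewise_integral_linear (quot_lattice N \<eta>) (star_fan \<Sigma> \<eta>) f \<and>
     is_div (quot_lattice N \<eta>) (d - dim \<eta>) (star_fan \<Sigma> \<eta>) f (\<lambda>_. 0) \<longrightarrow>
     linear_on_fan (star_fan \<Sigma> \<eta>) f)"

end

theory Submission
  imports Defs
begin

text \<open>
  By Poincare duality in degree \<open>p = 0\<close>, every balanced weight on the top-dimensional cones of a star is
  constant. Contraction of \<open>\<nu>\<^sub>\<sigma>\<close> identifies the dual of \<open>N\<^sub>\<sigma>\<close> with \<open>\<Lambda>\<^sup>d\<^sup>-\<^sup>1 N\<^sub>\<sigma>\<close>, so that a chain in
  \<open>C\<^sub>d\<^sub>-\<^sub>1\<^sub>,\<^sub>d\<close> is a family of integral linear forms \<open>u\<^sub>\<sigma>\<close>. If these agree on the cones \<open>\<tau>\<close> of codimension one,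
  then its boundary at \<open>\<tau>\<close> is \<open>- ord\<^sub>\<tau>(u) \<nu>\<^sub>\<tau>\<close>, by the Leibniz rule for the contraction and the balancing
  condition.

  A divisor \<open>w\<close> gives the cycle \<open>(- w(\<tau>) \<nu>\<^sub>\<tau>)\<close> of degree \<open>(d - 1, d - 1)\<close>, which is the boundary of such a
  family; the constancy of balanced weights on stars forces the \<open>u\<^sub>\<sigma>\<close> to agree on all intersections, so that
  they form a conewise linear function with divisor \<open>w\<close>. Conversely, if \<open>div(f) = 0\<close> then the forms of \<open>f\<close>
  are a cycle, which by duality for \<open>p = 1\<close> is the contraction of the fundamental class by one linear form.
\<close>

section \<open>Generated subgroups\<close>

text \<open>A star of a star is again a star of \<open>\<Sigma>\<close>, so the stars of a smooth
  fan are smooth and both properties only have to be shown for the fan itself. A chain of degree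
  \<open>d\<close> does not relate its forms on different cones. What ties them together is that its
  boundary at \<open>\<tau>\<close> is a multiple of \<open>\<nu>\<^sub>\<tau>\<close>, with no part
  pointing out of \<open>span \<tau>\<close>. The gluing therefore takes two steps. For lattice
  vectors \<open>v\<close> in \<open>span \<tau>\<close> the values
  \<open>u\<^sub>\<sigma>(v)\<close> form an integer weight on the one-dimensional star of
  \<open>\<tau>\<close>, to which duality applies; this settles the faces of codimension one. For a
  point of an arbitrary intersection of maximal cones the values need not be integers, and the
  weight is replaced by the indicator of equality. Forms are represented by vectors \<open>u\<close>
  acting as \<open>u \<bullet> x\<close>, so that contraction is an evaluation and the Leibniz rule
  amounts to splitting off the first summand of \<open>ext_mult\<close>.\<close>

lemma group_closure_subset:
  assumes "S \<subseteq> H" "0 \<in> H" "\<And>x y. x \<in> H \<Longrightarrow> y \<in> H \<Longrightarrow> x - y \<in> H"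
  shows "group_closure S \<subseteq> H"
proof
  fix x assume "x \<in> group_closure S"
  then show "x \<in> H" by induction (use assms in auto)
qed

lemma group_closure_scale:
  fixes S :: "'v::euclidean_space set"
  assumes "x \<in> group_closure S"
  shows "of_int k *\<^sub>R x \<in> group_closure S"
proof -
  have "of_nat n *\<^sub>R x \<in> group_closure S" for n
    by (induction n) (auto simp: algebra_simps assms intro: group_closure_add)
  then have *: "of_int (int n) *\<^sub>R x \<in> group_closure S" for n by simp
  show ?thesis
  proof (cases "k \<ge> 0")
    case True then show ?thesis using *[of "nat k"] by simp
  next
    case False then show ?thesis using *[of "nat (-k)"] group_closure_minus_iff[of "of_int k *\<^sub>R x" S]
      by simp
  qed
qed

lemma group_closure_insert:
  fixes S :: "'v::euclidean_space set"
  shows "group_closure (insert v S) = {of_int k *\<^sub>R v + y | k y. y \<in> group_closure S}" (is "?l = ?r")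
proof
  show "?l \<subseteq> ?r"
  proof (rule group_closure_subset)
    show "insert v S \<subseteq> ?r"
    proof
      fix x assume "x \<in> insert v S"
      then show "x \<in> ?r"
      proof
        assume "x = v"
        then have "x = of_int 1 *\<^sub>R v + 0" by simp
        then show ?thesis using zero_in_group_closure by blast
      next
        assume "x \<in> S" then show ?thesis
          by (auto intro!: exI[of _ 0] exI[of _ x] group_closure.base)
      qed
    qed
    show "0 \<in> ?r" by (auto intro!: exI[of _ 0])
    fix x y assume "x \<in> ?r" "y \<in> ?r"
    then obtain k a l b where *: "x = of_int k *\<^sub>R v + a" "y = of_int l *\<^sub>R v + b"
      "a \<in> group_closure S" "b \<in> group_closure S" by blast
    then have "x - y = of_int (k - l) *\<^sub>R v + (a - b)" by (simp add: algebra_simps)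
    then show "x - y \<in> ?r" using * group_closure.diff by blast
  qed
  have "group_closure S \<subseteq> ?l"
    by (rule group_closure_subset) (auto intro: group_closure.intros)
  moreover have "of_int k *\<^sub>R v \<in> ?l" for k
    by (rule group_closure_scale) (simp add: group_closure.base)
  ultimately show "?r \<subseteq> ?l"
    by (auto intro!: group_closure_add)
qed

section \<open>The exterior algebra\<close>

text \<open>As simplification rules these would eta-expand \<open>\<omega> + \<omega>'\<close> and \<open>0\<close> in equations between forms.\<close>

declare zero_fun_apply [simp del] plus_fun_apply [simp del] minus_apply [simp del] uminus_apply [simp del]

lemmas fun_ops_apply = zero_fun_apply plus_fun_apply minus_apply uminus_apply

text \<open>In the embedding of the exterior algebra into the multilinear forms, contraction by the linear form
  \<open>x \<mapsto> u \<bullet> x\<close> is evaluation at \<open>u\<close> in the first argument.\<close>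

definition interior_mult :: "'v::euclidean_space \<Rightarrow> 'v mvec \<Rightarrow> 'v mvec" where
  "interior_mult u \<omega> = (\<lambda>us. \<omega> (u # us))"

definition real_scale :: "real \<Rightarrow> 'v mvec \<Rightarrow> 'v mvec" where
  "real_scale c \<omega> = (\<lambda>us. c * \<omega> us)"

lemma int_scale_real_scale: "int_scale k \<omega> = real_scale (of_int k) \<omega>"
  by (simp add: int_scale_def real_scale_def)

lemma real_scale_simps [simp]:
  "real_scale 0 \<omega> = 0" "real_scale 1 \<omega> = \<omega>" "real_scale c 0 = 0"
  "real_scale c (real_scale d \<omega>) = real_scale (c * d) \<omega>"
  by (auto simp: real_scale_def fun_eq_iff fun_ops_apply)

lemma real_scale_linear:
  "real_scale c (\<omega> + \<omega>') = real_scale c \<omega> + real_scale c \<omega>'"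
  "real_scale c (\<omega> - \<omega>') = real_scale c \<omega> - real_scale c \<omega>'"
  "real_scale c (- \<omega>) = - real_scale c \<omega>"
  "real_scale (c + d) \<omega> = real_scale c \<omega> + real_scale d \<omega>"
  "real_scale (c - d) \<omega> = real_scale c \<omega> - real_scale d \<omega>"
  "real_scale (- c) \<omega> = - real_scale c \<omega>"
  by (auto simp: real_scale_def fun_eq_iff fun_ops_apply algebra_simps)

lemma real_scale_sum: "real_scale (\<Sum>i\<in>A. h i) \<omega> = (\<Sum>i\<in>A. real_scale (h i) \<omega>)"
  by (induction A rule: infinite_finite_induct) (auto simp: real_scale_linear)

lemma real_scale_eq_0_iff: "real_scale c \<omega> = 0 \<longleftrightarrow> c = 0 \<or> \<omega> = 0"
  by (auto simp: real_scale_def fun_eq_iff fun_ops_apply)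

lemma ext_mult_linear:
  "ext_mult v (\<omega> + \<omega>') = ext_mult v \<omega> + ext_mult v \<omega>'"
  "ext_mult v (\<omega> - \<omega>') = ext_mult v \<omega> - ext_mult v \<omega>'"
  "ext_mult v (- \<omega>) = - ext_mult v \<omega>"
  "ext_mult v (real_scale c \<omega>) = real_scale c (ext_mult v \<omega>)"
  "ext_mult (v + w) \<omega> = ext_mult v \<omega> + ext_mult w \<omega>"
  "ext_mult (c *\<^sub>R v) \<omega> = real_scale c (ext_mult v \<omega>)"
  by (auto simp: ext_mult_def real_scale_def fun_eq_iff fun_ops_apply algebra_simps sum.distrib sum_subtractf
      sum_distrib_left sum_negf)

lemma ext_mult_zero [simp]: "ext_mult v 0 = 0" "ext_mult 0 \<omega> = 0"
  by (auto simp: ext_mult_def fun_eq_iff fun_ops_apply)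

lemma ext_mult_sum:
  "ext_mult v (\<Sum>i\<in>A. f i) = (\<Sum>i\<in>A. ext_mult v (f i))"
  "ext_mult (\<Sum>i\<in>A. g i) \<omega> = (\<Sum>i\<in>A. ext_mult (g i) \<omega>)"
  by (induction A rule: infinite_finite_induct) (auto simp: ext_mult_linear)

lemma interior_mult_linear:
  "interior_mult u (\<omega> + \<omega>') = interior_mult u \<omega> + interior_mult u \<omega>'"
  "interior_mult u (\<omega> - \<omega>') = interior_mult u \<omega> - interior_mult u \<omega>'"
  "interior_mult u (real_scale c \<omega>) = real_scale c (interior_mult u \<omega>)"
  "interior_mult u 0 = 0"
  by (auto simp: interior_mult_def real_scale_def fun_eq_iff fun_ops_apply)

text \<open>This is the Leibniz rule. In the sum defining \<open>ext_mult\<close> at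
  \<open>u # us\<close> the term of index 0 gives the scalar part; all other indices drop by one,
  which reverses their signs.\<close>

lemma interior_mult_ext_mult:
  "interior_mult u (ext_mult v \<omega>) = real_scale (u \<bullet> v) \<omega> - ext_mult v (interior_mult u \<omega>)"
proof
  fix us
  have "ext_mult v \<omega> (u # us) = (u \<bullet> v) * \<omega> us 
     + (\<Sum>i<length us. (-1) ^ Suc i * (us ! i \<bullet> v) * \<omega> (u # take i us @ drop (Suc i) us))"
    unfolding ext_mult_def by (simp add: sum.lessThan_Suc_shift del: sum.lessThan_Suc)
  also have "\<dots> = (u \<bullet> v) * \<omega> us - ext_mult v (interior_mult u \<omega>) us"
    by (simp add: ext_mult_def interior_mult_def sum_negf)
  finally show "interior_mult u (ext_mult v \<omega>) us = (real_scale (u \<bullet> v) \<omega> - ext_mult v (interior_mult u \<omega>)) us"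
    by (simp add: interior_mult_def real_scale_def fun_ops_apply)
qed

text \<open>Two applications of the Leibniz rule at \<open>u # us\<close> leave two terms that are
  antisymmetric in \<open>v\<close> and \<open>w\<close>, and the claim for
  \<open>interior_mult u \<omega>\<close> at the shorter list. This avoids a double sum over pairs
  of omitted indices.\<close>

lemma ext_mult_anticommute: "ext_mult v (ext_mult w \<omega>) = - ext_mult w (ext_mult v \<omega>)"
proof
  fix us
  show "ext_mult v (ext_mult w \<omega>) us = (- ext_mult w (ext_mult v \<omega>)) us"
  proof (induction us arbitrary: \<omega>)
    case Nil
    show ?case by (simp add: ext_mult_def fun_ops_apply)
  next
    case (Cons u us)
    have *: "ext_mult v (ext_mult w \<omega>) (u # us) = (u \<bullet> v) * ext_mult w \<omega> us - (u \<bullet> w) * ext_mult v \<omega> us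
      + ext_mult v (ext_mult w (interior_mult u \<omega>)) us" for v w
    proof -
      have "ext_mult v (ext_mult w \<omega>) (u # us) = interior_mult u (ext_mult v (ext_mult w \<omega>)) us"
        by (simp add: interior_mult_def)
      then show ?thesis
        by (simp add: interior_mult_ext_mult ext_mult_linear fun_ops_apply)
          (simp add: real_scale_def)
    qed
    show ?case using Cons[of "interior_mult u \<omega>"] by (simp add: * fun_ops_apply)
  qed
qed

lemma ext_mult_self: "ext_mult v (ext_mult v \<omega>) = 0"
  using ext_mult_anticommute[of v v \<omega>] by (simp add: fun_eq_iff fun_ops_apply)

lemma wedge_simps [simp]: "wedge (v # vs) = ext_mult v (wedge vs)"
  "interior_mult u (wedge []) = 0"
  by (auto simp: wedge_def interior_mult_def zero_fun_def)

lemma wedge_Nil_nonzero: "wedge [] \<noteq> 0"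
  by (auto simp: wedge_def fun_eq_iff fun_ops_apply)

text \<open>An \<open>mvec\<close> is an arbitrary function on lists and need not be linear in its
  first argument, so the dependence of a contraction on \<open>u\<close> has to be derived for
  wedges, by the Leibniz rule along the list.\<close>

lemma interior_mult_wedge_cong:
  assumes "\<And>v. v \<in> set vs \<Longrightarrow> u \<bullet> v = u' \<bullet> v"
  shows "interior_mult u (wedge vs) = interior_mult u' (wedge vs)"
  using assms by (induction vs) (auto simp: interior_mult_ext_mult)

lemma interior_mult_uminus_wedge:
  "interior_mult (- u) (wedge vs) = - interior_mult u (wedge vs)"
  by (induction vs) (auto simp: interior_mult_ext_mult real_scale_linear ext_mult_linear)

lemma interior_mult_zero_wedge:
  assumes "\<And>v. v \<in> set vs \<Longrightarrow> u \<bullet> v = 0"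
  shows "interior_mult u (wedge vs) = 0"
  using assms by (induction vs) (auto simp: interior_mult_ext_mult)

text \<open>By linearity \<open>x\<close> may be taken to be a factor of the wedge;
  anticommutativity then moves it next to its copy.\<close>

lemma ext_mult_wedge_span:
  assumes "x \<in> span (set vs)"
  shows "ext_mult x (wedge vs) = 0"
  using assms
proof (induction rule: span_induct)
  case base
  show ?case by (auto simp: subspace_def ext_mult_linear)
next
  case (step x)
  then show ?case
  proof (induction vs)
    case (Cons v vs)
    show ?case
    proof (cases "x = v")
      case False
      then have "ext_mult x (wedge vs) = 0" using Cons by auto
      then show ?thesis by (simp add: ext_mult_anticommute[of x v])
    qed (simp add: ext_mult_self)
  qed auto
qed

text \<open>For a real-valued linear \<open>g\<close> the vector \<open>adjoint g 1\<close>
  represents \<open>g\<close> by the inner product. This is how a form given on a basis becomes an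
  argument of \<open>interior_mult\<close>.\<close>

lemma exists_prescribed_inner:
  fixes B :: "'v::euclidean_space set"
  assumes "independent B"
  shows "\<exists>u. \<forall>v\<in>B. u \<bullet> v = h v"
proof -
  obtain g where g: "linear g" "\<forall>v\<in>B. g v = h v"
    using linear_independent_extend[OF assms, of h] by blast
  have "adjoint g 1 \<bullet> v = g v" for v
    using adjoint_works[OF g(1), of v 1] by (simp add: inner_commute)
  then show ?thesis using g(2) by metis
qed

text \<open>Contracting by the dual coordinate of the first vector removes that vector, so vanishing
  would pass down to \<open>wedge []\<close>.\<close>

lemma wedge_nonzero:
  assumes "distinct vs" "independent (set vs)"
  shows "wedge vs \<noteq> 0"
  using assms
proof (induction vs)
  case Nil
  then show ?case by (simp add: wedge_Nil_nonzero)
next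
  case (Cons v vs)
  obtain u where u: "\<And>w. w \<in> set (v # vs) \<Longrightarrow> u \<bullet> w = (if w = v then 1 else 0)"
    using exists_prescribed_inner[OF Cons.prems(2), of "\<lambda>w. if w = v then 1 else 0"] by blast
  have "interior_mult u (wedge vs) = 0"
    by (rule interior_mult_zero_wedge) (use u Cons.prems(1) in auto)
  then have "interior_mult u (wedge (v # vs)) = wedge vs"
    using u by (simp add: interior_mult_ext_mult)
  moreover have "wedge vs \<noteq> 0" 
    using Cons by (auto simp: independent_insert)
  ultimately show ?case by (metis interior_mult_linear(4))
qed

lemma ext_mult_wedge_eq_0_iff:
  assumes "distinct vs" "independent (set vs)"
  shows "ext_mult x (wedge vs) = 0 \<longleftrightarrow> x \<in> span (set vs)"
proof
  assume "ext_mult x (wedge vs) = 0"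
  show "x \<in> span (set vs)"
  proof (rule ccontr)
    assume *: "x \<notin> span (set vs)"
    then have "wedge (x # vs) \<noteq> 0"
      by (intro wedge_nonzero) (use assms in \<open>auto simp: independent_insert intro: span_base\<close>)
    then show False using \<open>ext_mult x (wedge vs) = 0\<close> by simp
  qed
qed (rule ext_mult_wedge_span)

text \<open>Contract the equation \<open>ext_mult x (wedge vs) = 0\<close> by \<open>u\<close>. The
  result recovers the value of a form from its contraction.\<close>

lemma ext_mult_interior_mult_wedge:
  assumes "x \<in> span (set vs)"
  shows "ext_mult x (interior_mult u (wedge vs)) = real_scale (u \<bullet> x) (wedge vs)"
proof -
  have "0 = interior_mult u (ext_mult x (wedge vs))"
    by (simp add: ext_mult_wedge_span[OF assms] interior_mult_linear)
  then show ?thesis by (simp add: interior_mult_ext_mult)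
qed

lemma interior_mult_wedge_inject:
  assumes "distinct vs" "independent (set vs)" "interior_mult u (wedge vs) = interior_mult u' (wedge vs)"
    and "x \<in> span (set vs)"
  shows "u \<bullet> x = u' \<bullet> x"
proof -
  have "real_scale (u \<bullet> x) (wedge vs) = real_scale (u' \<bullet> x) (wedge vs)"
    using assms(3) ext_mult_interior_mult_wedge[OF assms(4)] by metis
  then have "real_scale (u \<bullet> x - u' \<bullet> x) (wedge vs) = 0"
    by (simp add: real_scale_linear)
  then show ?thesis using wedge_nonzero[OF assms(1,2)] by (simp add: real_scale_eq_0_iff)
qed

section \<open>Integral exterior powers of a lattice with a basis\<close>

text \<open>The \<open>p\<close>-th exterior power of the group generated by a list, by splitting off the first vector \<open>v\<close> as
  \<open>\<Lambda>\<^sup>p \<oplus> v \<and> \<Lambda>\<^sup>p\<^sup>-\<^sup>1\<close>; this replaces the multilinear expansion over sets of indices.\<close>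

fun lattice_ext :: "'v::euclidean_space list \<Rightarrow> nat \<Rightarrow> 'v mvec set" where
  "lattice_ext [] p = (if p = 0 then range (\<lambda>k. int_scale k (wedge [])) else {0})"
| "lattice_ext (v # vs) 0 = lattice_ext vs 0"
| "lattice_ext (v # vs) (Suc p) =
     {\<alpha> + ext_mult v \<beta> | \<alpha> \<beta>. \<alpha> \<in> lattice_ext vs (Suc p) \<and> \<beta> \<in> lattice_ext vs p}"

lemma lattice_ext_ConsI:
  "\<alpha> \<in> lattice_ext vs (Suc p) \<Longrightarrow> \<beta> \<in> lattice_ext vs p \<Longrightarrow> \<alpha> + ext_mult v \<beta> \<in> lattice_ext (v # vs) (Suc p)"
  by auto

lemma zero_in_lattice_ext: "0 \<in> lattice_ext vs p"
proof (induction vs p rule: lattice_ext.induct)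
  case (1 p)
  show ?case by (auto simp: int_scale_real_scale intro!: image_eqI[of _ _ 0])
next
  case (3 v vs p)
  then show ?case by (auto intro!: exI[of _ 0])
qed auto

lemma lattice_ext_diff: "\<omega> \<in> lattice_ext vs p \<Longrightarrow> \<omega>' \<in> lattice_ext vs p \<Longrightarrow> \<omega> - \<omega>' \<in> lattice_ext vs p"
proof (induction vs p arbitrary: \<omega> \<omega>' rule: lattice_ext.induct)
  case (1 p)
  have "int_scale k \<omega> - int_scale l \<omega> = int_scale (k - l) \<omega>" for k l and \<omega> :: "'v mvec"
    by (simp add: int_scale_real_scale real_scale_linear)
  then show ?case using 1 by (auto split: if_splits)
next
  case (3 v vs p)
  from 3(3,4) obtain a b a' b' where *: "\<omega> = a + ext_mult v b" "\<omega>' = a' + ext_mult v b'"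
    "a \<in> lattice_ext vs (Suc p)" "b \<in> lattice_ext vs p" "a' \<in> lattice_ext vs (Suc p)" "b' \<in> lattice_ext vs p"
    by auto
  then have "\<omega> - \<omega>' = (a - a') + ext_mult v (b - b')" by (simp add: ext_mult_linear)
  then show ?case using 3(1,2) * lattice_ext_ConsI by metis
qed auto

lemma lattice_ext_int_scale: "\<omega> \<in> lattice_ext vs p \<Longrightarrow> int_scale k \<omega> \<in> lattice_ext vs p"
proof (induction vs p arbitrary: \<omega> rule: lattice_ext.induct)
  case (1 p)
  have "int_scale k (int_scale l \<omega>) = int_scale (k * l) \<omega>" for l and \<omega> :: "'v mvec"
    by (simp add: int_scale_real_scale)
  moreover have "int_scale k 0 = 0" by (simp add: int_scale_real_scale)
  ultimately show ?case using 1 by (auto split: if_splits)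
next
  case (3 v vs p)
  from 3(3) obtain a b where *: "\<omega> = a + ext_mult v b" 
    "a \<in> lattice_ext vs (Suc p)" "b \<in> lattice_ext vs p" by auto
  then have "int_scale k \<omega> = int_scale k a + ext_mult v (int_scale k b)" 
    by (simp add: ext_mult_linear int_scale_real_scale real_scale_linear)
  then show ?case using 3(1,2) * lattice_ext_ConsI by metis
qed auto

lemma ext_mult_in_lattice_ext:
  "x \<in> group_closure (set vs) \<Longrightarrow> \<omega> \<in> lattice_ext vs p \<Longrightarrow> ext_mult x \<omega> \<in> lattice_ext vs (Suc p)"
proof (induction vs arbitrary: x \<omega> p)
  case Nil
  then show ?case by auto
next
  case (Cons v vs)
  then obtain k y where x: "x = of_int k *\<^sub>R v + y" "y \<in> group_closure (set vs)"
    by (auto simp: group_closure_insert)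
  show ?case
  proof (cases p)
    case 0
    then have w: "\<omega> \<in> lattice_ext vs 0" using Cons by simp
    have "ext_mult x \<omega> = ext_mult y \<omega> + ext_mult v (int_scale k \<omega>)"
      by (simp add: x ext_mult_linear int_scale_real_scale)
    moreover have "ext_mult y \<omega> \<in> lattice_ext vs (Suc 0)" using Cons.IH x w by blast
    ultimately show ?thesis using 0 lattice_ext_int_scale[OF w] lattice_ext_ConsI by metis
  next
    case (Suc q)
    then obtain a b where *: "\<omega> = a + ext_mult v b" "a \<in> lattice_ext vs (Suc q)" "b \<in> lattice_ext vs q" 
      using Cons by auto
    \<comment> \<open>Expand \<open>(k v + y) \<and> (a + v \<and> b)\<close>: the term with two
      factors \<open>v\<close> vanishes, and \<open>y\<close> passes \<open>v\<close> with a
      sign.\<close>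
    have "ext_mult x \<omega> = ext_mult y a + ext_mult v (int_scale k a - ext_mult y b)"
      by (simp add: x * ext_mult_linear int_scale_real_scale real_scale_linear ext_mult_self
          ext_mult_anticommute[of y v])
    moreover have "ext_mult y a \<in> lattice_ext vs (Suc (Suc q))" "ext_mult y b \<in> lattice_ext vs (Suc q)"
      using Cons.IH x * by blast+
    ultimately show ?thesis using Suc lattice_ext_int_scale[OF *(2)] lattice_ext_diff lattice_ext_ConsI by metis
  qed
qed

lemma wedge_in_lattice_ext:
  "set ws \<subseteq> group_closure (set vs) \<Longrightarrow> wedge ws \<in> lattice_ext vs (length ws)"
proof (induction ws)
  case Nil
  have "wedge [] \<in> lattice_ext vs 0"
    by (induction vs) (auto simp: int_scale_real_scale intro!: image_eqI[of _ _ 1])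
  then show ?case by simp
next
  case (Cons w ws)
  then show ?case by (auto intro: ext_mult_in_lattice_ext)
qed

lemma ext_power_subset_lattice_ext: "ext_power p (group_closure (set vs)) \<subseteq> lattice_ext vs p"
  unfolding ext_power_def
  by (rule group_closure_subset) (auto simp: zero_in_lattice_ext lattice_ext_diff wedge_in_lattice_ext)

lemma lattice_ext_above_rank: "length vs < p \<Longrightarrow> lattice_ext vs p = {0}"
  by (induction vs p rule: lattice_ext.induct) auto

lemma lattice_ext_top: "lattice_ext vs (length vs) = range (\<lambda>k. int_scale k (wedge vs))"
proof (induction vs)
  case (Cons v vs)
  have "lattice_ext (v # vs) (length (v # vs)) = ext_mult v ` range (\<lambda>k. int_scale k (wedge vs))"
    by (auto simp: lattice_ext_above_rank Cons[symmetric])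
  also have "\<dots> = range (\<lambda>k. int_scale k (wedge (v # vs)))"
    by (simp add: image_image int_scale_real_scale ext_mult_linear)
  finally show ?case .
qed auto

text \<open>Split \<open>\<omega> = a + v \<and> b\<close>. Here \<open>a\<close> is a multiple of
  the top wedge of the remaining vectors, and \<open>b\<close> is a contraction of that wedge by
  induction; the two data together prescribe a form on the whole basis.\<close>

lemma lattice_ext_corank_1:
  assumes "distinct vs" "independent (set vs)" "length vs = Suc n" "\<omega> \<in> lattice_ext vs n"
  shows "\<exists>u. (\<forall>v\<in>set vs. u \<bullet> v \<in> \<int>) \<and> \<omega> = interior_mult u (wedge vs)"
  using assms
proof (induction n arbitrary: vs \<omega>)
  case 0
  then obtain v where v: "vs = [v]" by (metis length_0_conv length_Suc_conv)
  then obtain k where k: "\<omega> = int_scale k (wedge [])" using 0 by auto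
  obtain u where "u \<bullet> v = of_int k"
    using exists_prescribed_inner[OF 0(2), of "\<lambda>_. of_int k"] v by auto
  then show ?case using v k
    by (auto simp: interior_mult_ext_mult int_scale_real_scale intro!: exI[of _ u])
next
  case (Suc n)
  then obtain v ws where v: "vs = v # ws" "length ws = Suc n" by (auto simp: length_Suc_conv)
  obtain a b where ab: "\<omega> = a + ext_mult v b" "a \<in> lattice_ext ws (Suc n)" "b \<in> lattice_ext ws n"
    using Suc.prems v by auto
  have ws: "distinct ws" "independent (set ws)" "v \<notin> set ws"
    using Suc.prems v by (auto simp: independent_insert)
  obtain u where u: "\<And>w. w\<in>set ws \<Longrightarrow> u \<bullet> w \<in> \<int>" "b = interior_mult u (wedge ws)"
    using Suc.IH[OF ws(1,2) v(2) ab(3)] by auto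
  obtain k where k: "a = int_scale k (wedge ws)" using lattice_ext_top[of ws] ab v by auto
  \<comment> \<open>The minus sign cancels the one in the Leibniz rule, whose two terms then become
    \<open>a\<close> and \<open>v \<and> b\<close>.\<close>
  obtain u' where u': "\<And>w. w \<in> set vs \<Longrightarrow> u' \<bullet> w = (if w = v then of_int k else - u \<bullet> w)"
    using exists_prescribed_inner[OF Suc.prems(2), of "\<lambda>w. if w = v then of_int k else - u \<bullet> w"] by auto
  have "interior_mult u' (wedge ws) = interior_mult (- u) (wedge ws)"
    by (rule interior_mult_wedge_cong) (use u' v ws in auto)
  then have "\<omega> = interior_mult u' (wedge vs)"
    using u' v by (simp add: ab k u interior_mult_ext_mult interior_mult_uminus_wedge ext_mult_linear int_scale_real_scale)
  moreover have "u' \<bullet> w \<in> \<int>" if "w \<in> set vs" for w using u'[OF that] u v that by auto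
  ultimately show ?case by blast
qed

lemma int_scale_in_group_closure:
  assumes "\<omega> \<in> group_closure S"
  shows "int_scale k \<omega> \<in> group_closure S"
proof -
  have *: "int_scale (int n) \<omega> \<in> group_closure S" for n
    by (induction n) (auto simp: int_scale_real_scale real_scale_linear assms intro: group_closure_add)
  show ?thesis
  proof (cases "k \<ge> 0")
    case True then show ?thesis using *[of "nat k"] by simp
  next
    case False then show ?thesis using *[of "nat (-k)"] group_closure_minus_iff[of "int_scale k \<omega>" S]
      by (simp add: int_scale_real_scale real_scale_linear)
  qed
qed

lemma ext_mult_in_ext_power:
  assumes "v \<in> L" "\<omega> \<in> ext_power p L"
  shows "ext_mult v \<omega> \<in> ext_power (Suc p) L"
  using assms(2) unfolding ext_power_def
proof (induction)
  case (base s)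
  then show ?case
  proof
    assume "s \<in> {wedge vs |vs. length vs = p \<and> set vs \<subseteq> L}"
    then obtain vs where "s = wedge vs" "length vs = p" "set vs \<subseteq> L" by auto
    then show ?thesis using assms(1)
      by (intro group_closure.base insertI2) (auto intro!: exI[of _ "v # vs"])
  qed auto
next
  case (diff s t)
  then show ?case by (auto simp: ext_mult_linear intro: group_closure.diff)
qed

lemma wedge_in_ext_power: "set vs \<subseteq> L \<Longrightarrow> wedge vs \<in> ext_power (length vs) L"
  unfolding ext_power_def by (intro group_closure.base) auto

text \<open>Ensures that the forms of a conewise integral function define an integral chain;
  \<open>lattice_ext_corank_1\<close> goes the other way.\<close>

lemma interior_mult_wedge_in_ext_power:
  assumes "set vs \<subseteq> L" "\<And>v. v \<in> set vs \<Longrightarrow> u \<bullet> v \<in> \<int>"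
  shows "interior_mult u (wedge vs) \<in> ext_power (length vs - 1) L"
  using assms
proof (induction vs)
  case Nil
  then show ?case by (simp add: ext_power_def)
next
  case (Cons v vs)
  obtain k where k: "u \<bullet> v = of_int k" using Cons.prems(2)[of v] by (auto elim: Ints_cases)
  have "int_scale k (wedge vs) \<in> ext_power (length vs) L"
    using wedge_in_ext_power[of vs L] Cons unfolding ext_power_def
    by (intro int_scale_in_group_closure) auto
  \<comment> \<open>For empty \<open>vs\<close> the truncated \<open>length vs - 1\<close> does not
    drop, so this case is treated apart; there the contraction is 0.\<close>
  moreover have "ext_mult v (interior_mult u (wedge vs)) \<in> ext_power (length vs) L"
  proof (cases vs)
    case (Cons w ws)
    then show ?thesis using Cons.IH Cons.prems ext_mult_in_ext_power[of v L "interior_mult u (wedge vs)"] by auto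
  qed (simp add: ext_power_def)
  ultimately show ?case
    by (auto simp: interior_mult_ext_mult k int_scale_real_scale ext_power_def intro: group_closure.diff)
qed

section \<open>Contraction by forms of degree zero and one\<close>

lemma nths_singleton: "i < length vs \<Longrightarrow> nths vs {i} = [vs ! i]"
proof (induction vs arbitrary: i)
  case (Cons v vs)
  have "{j. Suc j \<in> {i}} = (if i = 0 then {} else {i - 1})" by auto
  then show ?case using Cons by (cases i) (auto simp: nths_Cons)
qed auto

lemma nths_Compl_singleton: "nths vs (- {i}) = take i vs @ drop (Suc i) vs"
proof (induction vs arbitrary: i)
  case (Cons v vs)
  have "{j. Suc j \<in> - {i}} = (if i = 0 then UNIV else - {i - 1})" by auto
  then show ?case using Cons by (cases i) (auto simp: nths_Cons nths_all)
qed auto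

text \<open>The index sets are singletons, and the shuffle sign of \<open>{i}\<close> counts the
  \<open>i\<close> indices below it.\<close>

lemma contraction_1_eq_sum:
  "contraction 1 \<alpha> vs =
    (\<Sum>i<length vs. int_scale ((-1) ^ i * \<alpha> (wedge [vs ! i])) (wedge (take i vs @ drop (Suc i) vs)))"
proof -
  have "{I. I \<subseteq> {..<length vs} \<and> card I = 1} = (\<lambda>i. {i}) ` {..<length vs}"
    by (auto simp: card_1_singleton_iff)
  moreover have "shuffle_sign (length vs) {i} = (-1) ^ i" if "i < length vs" for i
  proof -
    have "{(i', j). i' \<in> {i} \<and> j \<in> {..<length vs} - {i} \<and> j < i'} = Pair i ` {..<i}"
      using that by auto
    then show ?thesis by (simp add: shuffle_sign_def card_image inj_on_def)
  qed
  ultimately show ?thesis unfolding contraction_def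
    by (simp add: sum.reindex inj_on_def nths_singleton nths_Compl_singleton del: wedge_simps)
qed

lemma interior_mult_wedge_eq_sum:
  "interior_mult u (wedge vs) =
    (\<Sum>i<length vs. real_scale ((-1) ^ i * (u \<bullet> vs ! i)) (wedge (take i vs @ drop (Suc i) vs)))"
proof (induction vs)
  case (Cons v vs)
  show ?case
    by (simp add: sum.lessThan_Suc_shift interior_mult_ext_mult Cons ext_mult_sum ext_mult_linear
        real_scale_linear sum_negf del: sum.lessThan_Suc)
qed auto

text \<open>Both sides expand by omitting one vector at a time, with the same signs. This links the
  shuffle formula of the cap product to the Leibniz rule.\<close>

lemma contraction_1:
  assumes "\<And>v. v \<in> set vs \<Longrightarrow> of_int (\<alpha> (wedge [v])) = u \<bullet> v"
  shows "contraction 1 \<alpha> vs = interior_mult u (wedge vs)"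
  unfolding contraction_1_eq_sum interior_mult_wedge_eq_sum
  by (rule sum.cong) (use assms in \<open>auto simp: int_scale_real_scale\<close>)

lemma contraction_0: "contraction 0 \<alpha> vs = int_scale (\<alpha> (wedge [])) (wedge vs)"
proof -
  have "{I. I \<subseteq> {..<length vs} \<and> card I = 0} = {{}}"
    using finite_subset[of _ "{..<length vs}"] by auto
  moreover have "nths vs UNIV = vs" by (simp add: nths_all)
  ultimately show ?thesis unfolding contraction_def by (simp add: shuffle_sign_def)
qed

section \<open>Quotient maps\<close>

lemma quot_map_unique:
  fixes W :: "'v::euclidean_space set"
  assumes W: "subspace W"
  shows "\<exists>!y. y \<in> orthogonal_comp W \<and> x - y \<in> W"
proof -
  have "x \<in> W + orthogonal_comp W" by (simp add: subspace_sum_orthogonal_comp[OF W])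
  then obtain a b where ab: "x = a + b" "a \<in> W" "b \<in> orthogonal_comp W" by (auto elim: set_plus_elim)
  show ?thesis
  proof (rule ex1I[of _ b])
    show "b \<in> orthogonal_comp W \<and> x - b \<in> W" using ab by auto
    fix y assume y: "y \<in> orthogonal_comp W \<and> x - y \<in> W"
    have "y - b \<in> orthogonal_comp W" using y ab subspace_diff[OF subspace_orthogonal_comp] by blast
    moreover have "y - b \<in> W" using subspace_diff[OF W, of a "x - y"] y ab by (simp add: algebra_simps)
    ultimately have "y - b \<in> W \<inter> orthogonal_comp W" by (rule IntI[rotated])
    then show "y = b" by (simp only: orthogonal_Int_0[OF W]) simp
  qed
qed

lemma quot_map:
  assumes "subspace W"
  shows "quot_map W x \<in> orthogonal_comp W" "x - quot_map W x \<in> W"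
  using theI'[OF quot_map_unique[OF assms, of x]] by (auto simp: quot_map_def)

lemma quot_map_eqI:
  assumes "subspace W" "y \<in> orthogonal_comp W" "x - y \<in> W"
  shows "quot_map W x = y"
  using quot_map_unique[OF assms(1), of x] quot_map[OF assms(1), of x] assms(2,3) by blast

lemma linear_quot_map:
  assumes W: "subspace W"
  shows "linear (quot_map W)"
proof (rule linearI)
  fix x y c
  have "x + y - (quot_map W x + quot_map W y) = (x - quot_map W x) + (y - quot_map W y)" by simp
  moreover have "\<dots> \<in> W" by (intro subspace_add[OF W] quot_map(2)[OF W])
  ultimately show "quot_map W (x + y) = quot_map W x + quot_map W y"
    by (intro quot_map_eqI[OF W] subspace_add[OF subspace_orthogonal_comp] quot_map(1)[OF W]) (simp only:)
  have "c *\<^sub>R x - c *\<^sub>R quot_map W x = c *\<^sub>R (x - quot_map W x)" by (simp add: algebra_simps)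
  moreover have "\<dots> \<in> W" by (intro subspace_scale[OF W] quot_map(2)[OF W])
  ultimately show "quot_map W (c *\<^sub>R x) = c *\<^sub>R quot_map W x"
    by (intro quot_map_eqI[OF W] subspace_scale[OF subspace_orthogonal_comp] quot_map(1)[OF W]) (simp only:)
qed

lemma quot_map_eq_0_iff:
  assumes W: "subspace W"
  shows "quot_map W x = 0 \<longleftrightarrow> x \<in> W"
proof
  assume "quot_map W x = 0" then show "x \<in> W" using quot_map(2)[OF W, of x] by simp
next
  assume "x \<in> W" then show "quot_map W x = 0"
    by (intro quot_map_eqI[OF W]) (auto simp: subspace_0 subspace_orthogonal_comp)
qed

lemma quot_map_eq_iff:
  assumes W: "subspace W"
  shows "quot_map W x = quot_map W y \<longleftrightarrow> x - y \<in> W"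
  using quot_map_eq_0_iff[OF W, of "x - y"] by (simp add: linear_diff[OF linear_quot_map[OF W]])

lemma quot_map_0 [simp]: "quot_map {0} x = x"
  by (rule quot_map_eqI) auto

text \<open>Since quotients are realised on orthogonal complements, a quotient taken in two steps is literally
  equal to the quotient taken at once; so are the star fans of a star fan.\<close>

lemma quot_map_trans:
  assumes U: "subspace U" and W: "subspace W" and "U \<subseteq> W"
  shows "quot_map (quot_map U ` W) (quot_map U x) = quot_map W x"
proof (rule quot_map_eqI)
  let ?y = "quot_map W x"
  have lin: "linear (quot_map U)" by (rule linear_quot_map[OF U])
  show "subspace (quot_map U ` W)" by (rule linear_subspace_image[OF lin W])
  have "quot_map U w \<in> W" if "w \<in> W" for w
    using subspace_diff[OF W that, of "w - quot_map U w"] quot_map(2)[OF U, of w] \<open>U \<subseteq> W\<close> by auto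
  then have "quot_map U ` W \<subseteq> W" by auto
  then show "?y \<in> orthogonal_comp (quot_map U ` W)"
    using quot_map(1)[OF W] orthogonal_comp_anti_mono by blast
  have "?y \<in> orthogonal_comp U"
    using quot_map(1)[OF W] orthogonal_comp_anti_mono[OF \<open>U \<subseteq> W\<close>] by blast
  then have "quot_map U ?y = ?y" by (intro quot_map_eqI[OF U]) (auto simp: subspace_0[OF U])
  then have "quot_map U x - ?y = quot_map U (x - ?y)" by (simp add: linear_diff[OF lin])
  then show "quot_map U x - ?y \<in> quot_map U ` W" using quot_map(2)[OF W] by auto
qed

text \<open>The image is the orthogonal complement of \<open>U\<close> inside
  \<open>W\<close>.\<close>

lemma dim_quot_map_image:
  assumes U: "subspace U" and W: "subspace W" and "U \<subseteq> W"
  shows "dim (quot_map U ` W) + dim U = dim W"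
proof -
  have "y \<in> quot_map U ` W \<longleftrightarrow> y \<in> W \<and> (\<forall>x\<in>U. orthogonal x y)" for y
  proof
    assume "y \<in> quot_map U ` W"
    then obtain w where w: "w \<in> W" "y = quot_map U w" by blast
    have "w - quot_map U w \<in> W" using quot_map(2)[OF U, of w] \<open>U \<subseteq> W\<close> by (rule rev_subsetD)
    then have "w - (w - quot_map U w) \<in> W" by (rule subspace_diff[OF W w(1)])
    then show "y \<in> W \<and> (\<forall>x\<in>U. orthogonal x y)"
      using quot_map(1)[OF U, of w] w(2) by (simp add: orthogonal_comp_def)
  next
    assume y: "y \<in> W \<and> (\<forall>x\<in>U. orthogonal x y)"
    then have "quot_map U y = y"
      by (intro quot_map_eqI[OF U]) (simp_all add: orthogonal_comp_def subspace_0[OF U])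
    then show "y \<in> quot_map U ` W" using y by (metis image_eqI)
  qed
  then have "quot_map U ` W = {y \<in> W. \<forall>x\<in>U. orthogonal x y}" by blast
  then show ?thesis using dim_subspace_orthogonal_to_vectors[OF U W \<open>U \<subseteq> W\<close>] by simp
qed

section \<open>Lattices\<close>

lemma group_closure_mono: "S \<subseteq> T \<Longrightarrow> group_closure S \<subseteq> group_closure T"
  by (rule group_closure_subset) (auto intro: group_closure.intros)

lemma group_closure_idem: "group_closure (group_closure S) = group_closure S"
  by (intro equalityI group_closure_subset) (auto intro: group_closure.intros)

lemma group_closure_eqI:
  "0 \<in> H \<Longrightarrow> (\<And>x y. x \<in> H \<Longrightarrow> y \<in> H \<Longrightarrow> x - y \<in> H) \<Longrightarrow> group_closure H = H"
  by (intro equalityI group_closure_subset) (auto intro: group_closure.intros)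

lemma group_closure_subset_span: "group_closure S \<subseteq> span S"
  by (rule group_closure_subset) (auto intro: span_base span_diff span_zero)

lemma span_group_closure: "span (group_closure S) = span S"
proof
  show "span (group_closure S) \<subseteq> span S"
    using span_mono[OF group_closure_subset_span] by (simp add: span_span)
  show "span S \<subseteq> span (group_closure S)"
    by (intro span_mono) (auto intro: group_closure.base)
qed

lemma group_closure_linear_image:
  assumes "linear f"
  shows "group_closure (f ` S) = f ` group_closure S"
proof
  show "group_closure (f ` S) \<subseteq> f ` group_closure S"
  proof (rule group_closure_subset)
    show "f ` S \<subseteq> f ` group_closure S" by (auto intro: group_closure.base)
    show "0 \<in> f ` group_closure S" using linear_0[OF assms] by (metis image_eqI zero_in_group_closure)
    fix x y assume "x \<in> f ` group_closure S" "y \<in> f ` group_closure S"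
    then obtain a b where "x = f a" "y = f b" "a \<in> group_closure S" "b \<in> group_closure S" by auto
    then show "x - y \<in> f ` group_closure S"
      by (intro image_eqI[of _ _ "a - b"]) (auto simp: linear_diff[OF assms] intro: group_closure.diff)
  qed
  have "f x \<in> group_closure (f ` S)" if "x \<in> group_closure S" for x
    using that by induction
      (auto simp: linear_0[OF assms] linear_diff[OF assms] intro: group_closure.base group_closure.diff)
  then show "f ` group_closure S \<subseteq> group_closure (f ` S)" by auto
qed

lemma lattice_basisD:
  assumes "lattice_basis N vs"
  shows "distinct vs" "independent (set vs)" "group_closure (set vs) = N" "set vs \<subseteq> N"
    "span (set vs) = span N" "length vs = dim N"
proof -
  show *: "distinct vs" "independent (set vs)" "group_closure (set vs) = N"
    using assms by (auto simp: lattice_basis_def)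
  show "set vs \<subseteq> N" using * by (auto intro: group_closure.base)
  show s: "span (set vs) = span N" using * span_group_closure by metis
  show "length vs = dim N" using dim_eq_card[OF s *(2)] distinct_card[OF *(1)] by simp
qed

lemma zlattice_group_closure: "zlattice N \<Longrightarrow> group_closure N = N"
  by (metis zlattice_def lattice_basisD(3) group_closure_idem)

lemma span_cancel_int_scale:
  assumes "of_int k *\<^sub>R v \<in> span S" "k \<noteq> 0"
  shows "v \<in> span S"
  using span_scale[OF assms(1), of "1 / of_int k"] assms(2) by simp

text \<open>Induction on a basis of the ambient lattice. The coefficients \<open>K\<close> of the
  first vector \<open>v\<close> that occur in \<open>H\<close> form an ideal of the integers. An
  element \<open>h\<close> of \<open>H\<close> whose coefficient generates this ideal, together with
  a basis of the part of \<open>H\<close> without \<open>v\<close>, is a basis of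
  \<open>H\<close>.\<close>

lemma zlattice_subgroup:
  assumes "zlattice N" "H \<subseteq> N" "group_closure H = H"
  shows "zlattice H"
proof -
  have "zlattice H" if "distinct vs" "independent (set vs)" "H \<subseteq> group_closure (set vs)" "group_closure H = H"
    for vs and H :: "'a set"
    using that
  proof (induction vs arbitrary: H)
    case Nil
    then have "H = {0}" using zero_in_group_closure[of H] by auto
    then show ?case by (auto simp: zlattice_def lattice_basis_def independent_empty intro!: exI[of _ "[]"])
  next
    case (Cons v vs)
    have H: "0 \<in> H" "\<And>x y. x \<in> H \<Longrightarrow> y \<in> H \<Longrightarrow> x - y \<in> H" "\<And>x y. x \<in> H \<Longrightarrow> y \<in> H \<Longrightarrow> x + y \<in> H"
      "\<And>x k. x \<in> H \<Longrightarrow> of_int k *\<^sub>R x \<in> H"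
      using Cons.prems(4) zero_in_group_closure[of H] group_closure.diff[of _ H] group_closure_add[of _ H]
        group_closure_scale[of _ H] by auto
    define G where "G = group_closure (set vs)"
    define K where "K = {k::int. \<exists>y\<in>G. of_int k *\<^sub>R v + y \<in> H}"
    have G: "0 \<in> G" "\<And>x y. x \<in> G \<Longrightarrow> y \<in> G \<Longrightarrow> x - y \<in> G" "\<And>x k. x \<in> G \<Longrightarrow> of_int k *\<^sub>R x \<in> G"
      "group_closure G = G"
      by (auto simp: G_def group_closure_idem intro: group_closure.diff group_closure_scale)
    have "group_closure K = K"
    proof (rule group_closure_eqI)
      show "0 \<in> K" using G(1) H(1) by (auto simp: K_def intro!: bexI[of _ 0])
      fix k l assume "k \<in> K" "l \<in> K"
      then obtain y z where yz: "y \<in> G" "z \<in> G" "of_int k *\<^sub>R v + y \<in> H" "of_int l *\<^sub>R v + z \<in> H"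
        by (auto simp: K_def)
      have "of_int (k - l) *\<^sub>R v + (y - z) \<in> H" using H(2)[OF yz(3,4)] by (simp add: algebra_simps)
      then show "k - l \<in> K" using G(2)[OF yz(1,2)] by (auto simp: K_def)
    qed
    then have K: "K = range (times (Gcd K))" using group_closure_eq by metis
    have iv: "independent (set vs)" "v \<notin> span (set vs)" using Cons.prems(1,2) by (auto simp: independent_insert)
    have "group_closure (H \<inter> G) = H \<inter> G" by (rule group_closure_eqI) (use H G in auto)
    then have "zlattice (H \<inter> G)" using Cons.prems(1) iv by (intro Cons.IH) (auto simp: G_def)
    then obtain bs where bs: "lattice_basis (H \<inter> G) bs" by (auto simp: zlattice_def)
    have dec: "\<exists>k\<in>K. \<exists>y\<in>G. x = of_int k *\<^sub>R v + y" if "x \<in> H" for x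
    proof -
      have "x \<in> group_closure (insert v (set vs))" using that Cons.prems(3) by auto
      then obtain k y where "x = of_int k *\<^sub>R v + y" "y \<in> G" unfolding group_closure_insert G_def by blast
      then show ?thesis using that by (auto simp: K_def)
    qed
    show ?case
    proof (cases "Gcd K = 0")
      case True
      then have "K = {0}" using K by auto
      then have "H \<subseteq> G" using dec by force
      then show ?thesis using \<open>zlattice (H \<inter> G)\<close> by (simp add: Int_absorb2)
    next
      case False
      have "Gcd K \<in> K" using K by (metis mult.right_neutral rangeI)
      then obtain y0 where y0: "y0 \<in> G" "of_int (Gcd K) *\<^sub>R v + y0 \<in> H" by (auto simp: K_def)
      define h where "h = of_int (Gcd K) *\<^sub>R v + y0"
      \<comment> \<open>Independence is meant over the reals: if \<open>h\<close> were in the span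
        of \<open>bs\<close>, hence of \<open>vs\<close>, then so would be the nonzero multiple
        \<open>Gcd K\<close> of \<open>v\<close>.\<close>
      have "h \<notin> span (set bs)"
      proof
        assume "h \<in> span (set bs)"
        moreover have "span (set bs) \<subseteq> span (set vs)"
          using lattice_basisD(4)[OF bs] group_closure_subset_span[of "set vs"] by (intro span_minimal) (auto simp: G_def)
        ultimately have "h \<in> span (set vs)" by auto
        moreover have "y0 \<in> span (set vs)" using y0 group_closure_subset_span[of "set vs"] by (auto simp: G_def)
        ultimately have "h - y0 \<in> span (set vs)" by (rule span_diff)
        then have "of_int (Gcd K) *\<^sub>R v \<in> span (set vs)" by (simp add: h_def)
        then show False using False iv(2) span_cancel_int_scale by blast
      qed
      moreover from this have "h \<notin> set bs" using span_base by blast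
      ultimately have "distinct (h # bs)" "independent (set (h # bs))"
        using lattice_basisD(1,2)[OF bs] by (simp_all add: independent_insert)
      moreover have "group_closure (set (h # bs)) = H"
      proof
        show "group_closure (set (h # bs)) \<subseteq> H"
          using lattice_basisD(4)[OF bs] y0 H by (intro group_closure_subset) (auto simp: h_def)
        show "H \<subseteq> group_closure (set (h # bs))"
        proof
          fix x assume x: "x \<in> H"
          then obtain k y where ky: "k \<in> K" "y \<in> G" "x = of_int k *\<^sub>R v + y" using dec by blast
          then obtain l where l: "k = Gcd K * l" using K by auto
          have eq: "x - of_int l *\<^sub>R h = y - of_int l *\<^sub>R y0" using ky l by (simp add: h_def algebra_simps)
          have "x - of_int l *\<^sub>R h \<in> H" using x y0 H by (auto simp: h_def)
          moreover have "x - of_int l *\<^sub>R h \<in> G" unfolding eq using ky y0 G by auto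
          ultimately have "x - of_int l *\<^sub>R h \<in> group_closure (set bs)" using lattice_basisD(3)[OF bs] by auto
          then show "x \<in> group_closure (set (h # bs))"
            by (auto simp: group_closure_insert intro!: exI[of _ l] exI[of _ "x - of_int l *\<^sub>R h"])
        qed
      qed
      ultimately have "lattice_basis H (h # bs)" by (simp add: lattice_basis_def)
      then show ?thesis unfolding zlattice_def by blast
    qed
  qed
  then show ?thesis using assms by (metis zlattice_def lattice_basis_def)
qed

text \<open>Provides the basis vector that is eliminated when dividing by \<open>b\<close>.\<close>

lemma group_closure_nonzero_coefficient:
  fixes B :: "'v::euclidean_space set"
  assumes "finite B" "b \<in> group_closure B" "b \<noteq> 0"
  shows "\<exists>v\<in>B. \<exists>k y. k \<noteq> 0 \<and> y \<in> group_closure (B - {v}) \<and> b = of_int k *\<^sub>R v + y"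
  using assms
proof (induction B arbitrary: b)
  case (insert w F)
  then obtain k y where ky: "b = of_int k *\<^sub>R w + y" "y \<in> group_closure F"
    by (auto simp: group_closure_insert)
  show ?case
  proof (cases "k = 0")
    case False
    then show ?thesis using insert ky by auto
  next
    case True
    then obtain v l z where "v \<in> F" "l \<noteq> 0" "z \<in> group_closure (F - {v})" "b = of_int l *\<^sub>R v + z"
      using insert ky by (metis add_0 of_int_0 scaleR_zero_left)
    moreover have "group_closure (F - {v}) \<subseteq> group_closure (insert w F - {v})"
      by (rule group_closure_mono) auto
    ultimately show ?thesis by blast
  qed
qed auto

lemma zlattice_quot_map_singleton:
  assumes N: "zlattice N" and b: "b \<in> N"
  shows "zlattice (quot_map (span {b}) ` N)"
proof (cases "b = 0")
  case True
  then show ?thesis using N by simp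
next
  case False
  define \<pi> where "\<pi> = quot_map (span {b})"
  have lin: "linear \<pi>" by (simp add: \<pi>_def linear_quot_map)
  have \<pi>b: "\<pi> b = 0" by (simp add: \<pi>_def quot_map_eq_0_iff span_base)
  obtain vs where vs: "lattice_basis N vs" using N by (auto simp: zlattice_def)
  obtain v k y0 where v: "v \<in> set vs" "k \<noteq> 0" "y0 \<in> group_closure (set vs - {v})" "b = of_int k *\<^sub>R v + y0"
    using group_closure_nonzero_coefficient[of "set vs" b] lattice_basisD[OF vs] b False by auto
  define ws where "ws = remove1 v vs"
  have ws: "set ws = set vs - {v}" "distinct ws" "set vs = insert v (set ws)" "v \<notin> set ws"
    using lattice_basisD(1)[OF vs] v(1) by (auto simp: ws_def)
  have iw: "independent (set ws)" "v \<notin> span (set ws)"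
    using lattice_basisD(2)[OF vs, unfolded ws(3)] ws(4) by (simp_all add: independent_insert)
  define \<psi> where "\<psi> x = (1 / of_int k) *\<^sub>R \<pi> x" for x
  have lin': "linear \<psi>" unfolding \<psi>_def by (rule linear_compose_scale_right[OF lin])
  \<comment> \<open>The kernel of \<open>\<psi>\<close> is the line of \<open>b\<close>, and
    \<open>b\<close> is outside the span of \<open>ws\<close> because its coefficient
    \<open>k\<close> at \<open>v\<close> is nonzero.\<close>
  have inj0: "x = 0" if x: "x \<in> span (set ws)" "\<psi> x = 0" for x
  proof -
    from x have "x \<in> span {b}" using v(2) by (simp add: \<psi>_def \<pi>_def quot_map_eq_0_iff)
    then obtain c where c: "x = c *\<^sub>R b" by (auto simp: span_singleton)
    show "x = 0"
    proof (rule ccontr)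
      assume "x \<noteq> 0"
      then have "b \<in> span (set ws)" using x c span_scale[OF x(1), of "1/c"] by auto
      moreover have "y0 \<in> span (set ws)" using v(3) ws(1) group_closure_subset_span[of "set ws"] by auto
      ultimately have "b - y0 \<in> span (set ws)" by (rule span_diff)
      then have "of_int k *\<^sub>R v \<in> span (set ws)" by (simp add: v(4))
      then show False using v(2) iw(2) span_cancel_int_scale by blast
    qed
  qed
  have inj: "inj_on \<psi> (span (set ws))"
  proof (rule inj_onI)
    fix x y assume "x \<in> span (set ws)" "y \<in> span (set ws)" "\<psi> x = \<psi> y"
    then show "x = y" using inj0[of "x - y"] by (simp add: span_diff linear_diff[OF lin'])
  qed
  have "lattice_basis (group_closure (\<psi> ` set ws)) (map \<psi> ws)"
    using ws(2) linear_independent_injective_image[OF lin' iw(1) inj] inj_on_subset[OF inj span_superset]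
    by (auto simp: lattice_basis_def distinct_map)
  then have M: "zlattice (group_closure (\<psi> ` set ws))" by (auto simp: zlattice_def)
  have "\<pi> ` N \<subseteq> group_closure (\<psi> ` set ws)"
  proof
    fix z assume "z \<in> \<pi> ` N"
    then obtain x where x: "x \<in> N" "z = \<pi> x" by auto
    then have "x \<in> group_closure (insert v (set ws))" using lattice_basisD(3)[OF vs] ws by metis
    then obtain l y where ly: "x = of_int l *\<^sub>R v + y" "y \<in> group_closure (set ws)"
      by (auto simp: group_closure_insert)
    have "of_int k *\<^sub>R \<pi> v + \<pi> y0 = 0" using \<pi>b v(4) by (simp add: linear_add[OF lin] linear_scale[OF lin])
    then have "of_int k *\<^sub>R \<pi> v = - \<pi> y0" by (simp add: eq_neg_iff_add_eq_0)
    then have "(1 / of_int k) *\<^sub>R (of_int k *\<^sub>R \<pi> v) = (1 / of_int k) *\<^sub>R (- \<pi> y0)" by simp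
    then have "\<pi> v = - (1 / of_int k) *\<^sub>R \<pi> y0" using v(2) by simp
    then have "z = \<psi> (of_int k *\<^sub>R y - of_int l *\<^sub>R y0)"
      using x ly v(2) by (simp add: \<psi>_def linear_add[OF lin] linear_diff[OF lin] linear_scale[OF lin] algebra_simps)
    moreover have "of_int k *\<^sub>R y - of_int l *\<^sub>R y0 \<in> group_closure (set ws)"
      using ly(2) v(3) ws(1) by (intro group_closure.diff group_closure_scale) auto
    ultimately show "z \<in> group_closure (\<psi> ` set ws)" by (simp add: group_closure_linear_image[OF lin'])
  qed
  moreover have "group_closure (\<pi> ` N) = \<pi> ` N"
    by (simp add: group_closure_linear_image[OF lin] zlattice_group_closure[OF N])
  ultimately show ?thesis using zlattice_subgroup[OF M] by (simp add: \<pi>_def)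
qed

text \<open>Projects along one vector of \<open>S\<close> at a time. It matters that these are
  lattice vectors: the projection of a lattice along an irrational line can fail to be
  discrete.\<close>

lemma zlattice_quot_map:
  assumes "finite S" "zlattice N" "S \<subseteq> N"
  shows "zlattice (quot_map (span S) ` N)"
  using assms
proof (induction S)
  case (insert b S)
  let ?p = "quot_map (span S)"
  have lin: "linear ?p" by (simp add: linear_quot_map)
  have p0: "?p s = 0" if "s \<in> S" for s using that by (simp add: quot_map_eq_0_iff span_base)
  then have "span (insert (?p b) (?p ` S)) = span {?p b}"
    by (intro equalityI span_minimal span_mono) (auto intro: span_base simp: p0 span_zero)
  then have *: "?p ` span (insert b S) = span {?p b}" by (simp add: linear_span_image[OF lin, symmetric])
  have "quot_map (span (insert b S)) x = quot_map (span {?p b}) (?p x)" for x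
    using quot_map_trans[of "span S" "span (insert b S)" x] by (simp add: span_mono * subset_insertI)
  then have "quot_map (span (insert b S)) ` N = quot_map (span {?p b}) ` (?p ` N)" by (auto simp: image_image)
  then show ?case using zlattice_quot_map_singleton[of "?p ` N" "?p b"] insert by simp
qed simp

section \<open>Cones and faces\<close>

lemma rational_cone_generators:
  assumes "rational_cone N \<sigma>"
  obtains S where "finite S" "S \<subseteq> N" "\<sigma> = convex_cone hull S" "S \<subseteq> \<sigma>" "span S = span \<sigma>"
proof -
  obtain S where S: "finite S" "S \<subseteq> N" "\<sigma> = convex_cone hull S"
    using assms by (auto simp: rational_cone_def)
  have sub: "S \<subseteq> \<sigma>" unfolding S(3) by (rule hull_subset)
  have "convex_cone (span S)" by (auto simp: convex_cone_iff span_zero span_add span_scale)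
  then have "\<sigma> \<subseteq> span S" unfolding S(3) by (intro hull_minimal span_superset)
  then have "span \<sigma> \<subseteq> span S" by (intro span_minimal) auto
  with span_mono[OF sub] have "span S = span \<sigma>" by (rule equalityI)
  then show thesis using that S sub by blast
qed

lemma rational_coneD:
  assumes "rational_cone N \<sigma>"
  shows "convex_cone \<sigma>" "convex \<sigma>" "closed \<sigma>" "0 \<in> \<sigma>" "span (sublattice N \<sigma>) = span \<sigma>"
proof -
  obtain S where S: "finite S" "S \<subseteq> N" "\<sigma> = convex_cone hull S" "S \<subseteq> \<sigma>" "span S = span \<sigma>"
    using assms by (rule rational_cone_generators)
  show "convex_cone \<sigma>" "convex \<sigma>" "closed \<sigma>" "0 \<in> \<sigma>"
    using S(1,3) by (auto simp: convex_cone_convex_cone_hull convex_convex_cone_hull closed_convex_cone_hull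
        convex_cone_hull_contains_0)
  have "S \<subseteq> sublattice N \<sigma>" using S(2,4) by (auto simp: sublattice_def span_base)
  then have "span S \<subseteq> span (sublattice N \<sigma>)" by (rule span_mono)
  moreover have "span (sublattice N \<sigma>) \<subseteq> span \<sigma>" by (rule span_minimal) (auto simp: sublattice_def)
  ultimately show "span (sublattice N \<sigma>) = span \<sigma>" using S(5) by blast
qed

lemma zlattice_quot_lattice:
  assumes "zlattice N" "rational_cone N \<sigma>"
  shows "zlattice (quot_lattice N \<sigma>)"
proof -
  obtain S where "finite S" "S \<subseteq> N" "span S = span \<sigma>"
    using assms(2) by (rule rational_cone_generators)
  then show ?thesis using zlattice_quot_map[of S N] assms(1) by (simp add: quot_lattice_def)
qed

lemma face_of_cone:
  fixes \<sigma> :: "'v::euclidean_space set"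
  assumes "convex_cone \<sigma>" "\<tau> face_of \<sigma>" "\<tau> \<noteq> {}"
  shows "0 \<in> \<tau>" "\<tau> = span \<tau> \<inter> \<sigma>" "convex_cone \<tau>"
proof -
  have \<sigma>: "0 \<in> \<sigma>" "\<And>x y. x \<in> \<sigma> \<Longrightarrow> y \<in> \<sigma> \<Longrightarrow> x + y \<in> \<sigma>" "\<And>x c. x \<in> \<sigma> \<Longrightarrow> 0 \<le> c \<Longrightarrow> c *\<^sub>R x \<in> \<sigma>"
    using assms(1) by (auto simp: convex_cone_iff)
  obtain x where x: "x \<in> \<tau>" using assms(3) by blast
  show 0: "0 \<in> \<tau>"
  proof (cases "x = 0")
    case False
    \<comment> \<open>A nonzero point of the face is the midpoint of 0 and its double, which both
      lie in the cone.\<close>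
    have "x = (1 - 1/2) *\<^sub>R 0 + (1/2) *\<^sub>R (2 *\<^sub>R x)" by simp
    then have "x \<in> open_segment 0 (2 *\<^sub>R x)" using False unfolding in_segment
      by (intro conjI exI[of _ "1/2"]) auto
    moreover have "x \<in> \<sigma>" using x assms(2) face_of_imp_subset by blast
    ultimately show ?thesis using face_ofD[OF assms(2), of x 0 "2 *\<^sub>R x"] x \<sigma>(1) \<sigma>(3)[of x 2] by simp
  qed (use x in simp)
  have "affine hull \<tau> = span \<tau>" using 0 by (intro affine_hull_span_0) (simp add: hull_inc)
  then show eq: "\<tau> = span \<tau> \<inter> \<sigma>"
    using face_of_imp_eq_affine_Int[of \<sigma> \<tau>] assms by (simp add: convex_cone_def)
  show "convex_cone \<tau>"
    by (subst eq) (auto simp: convex_cone_iff span_zero span_add span_scale \<sigma>)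
qed

text \<open>The midpoint of \<open>x\<close> and \<open>y\<close> is half of \<open>x + y\<close>,
  hence in the face. The case \<open>x = y\<close> is separate because the open segment is then
  empty.\<close>

lemma face_of_cone_add:
  fixes \<sigma> :: "'v::euclidean_space set"
  assumes "convex_cone \<sigma>" "\<tau> face_of \<sigma>" "x \<in> \<sigma>" "y \<in> \<sigma>" "x + y \<in> \<tau>"
  shows "x \<in> \<tau>"
proof (cases "x = y")
  case True
  have "(1/2) *\<^sub>R (x + y) \<in> \<tau>"
    using face_of_cone(3)[OF assms(1,2)] assms(5) by (intro convex_cone_scaleR) auto
  then show ?thesis using True by (simp add: scaleR_2[symmetric])
next
  case False
  have "(1/2) *\<^sub>R (x + y) \<in> \<tau>"
    using face_of_cone(3)[OF assms(1,2)] assms(5) by (intro convex_cone_scaleR) auto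
  moreover have "(1/2) *\<^sub>R (x + y) \<in> open_segment x y"
    using False unfolding in_segment by (intro conjI exI[of _ "1/2"]) (auto simp: algebra_simps)
  ultimately show ?thesis using assms(2-4) unfolding face_of_def by blast
qed

text \<open>Opposite images force \<open>x + y\<close> into
  \<open>span \<tau> \<inter> \<sigma> = \<tau>\<close>, and then \<open>x\<close> into the face
  \<open>\<tau>\<close>. This yields the uniqueness of ray generators and the strong convexity of
  the cones in a star.\<close>

lemma quot_map_cone_pointed:
  fixes \<sigma> :: "'v::euclidean_space set"
  assumes "convex_cone \<sigma>" "\<tau> face_of \<sigma>" "\<tau> \<noteq> {}" "x \<in> \<sigma>" "y \<in> \<sigma>"
    and "quot_map (span \<tau>) x = - quot_map (span \<tau>) y"
  shows "quot_map (span \<tau>) x = 0"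
proof -
  have "quot_map (span \<tau>) (x + y) = 0"
    using assms(6) by (simp add: linear_add[OF linear_quot_map])
  then have "x + y \<in> span \<tau>" by (simp add: quot_map_eq_0_iff)
  moreover have "x + y \<in> \<sigma>" using assms by (simp add: convex_cone_add)
  ultimately have "x + y \<in> \<tau>" using face_of_cone(2)[OF assms(1-3)] by blast
  then have "x \<in> \<tau>" using face_of_cone_add assms by blast
  then show ?thesis by (simp add: quot_map_eq_0_iff span_base)
qed

section \<open>Orientations\<close>

lemma zlattice_sublattice:
  assumes "zlattice N" shows "zlattice (sublattice N \<sigma>)"
proof (rule zlattice_subgroup[OF assms])
  have "0 \<in> N" "\<And>x y. x \<in> N \<Longrightarrow> y \<in> N \<Longrightarrow> x - y \<in> N"
    using zlattice_group_closure[OF assms] zero_in_group_closure group_closure.diff by metis+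
  then show "group_closure (sublattice N \<sigma>) = sublattice N \<sigma>"
    by (intro group_closure_eqI) (auto simp: sublattice_def span_zero span_diff)
qed (auto simp: sublattice_def)

lemma orient_basis:
  assumes "zlattice N" "rational_cone N \<sigma>"
  shows "lattice_basis (sublattice N \<sigma>) (orient_basis N \<sigma>)"
    and "span (set (orient_basis N \<sigma>)) = span \<sigma>" "length (orient_basis N \<sigma>) = dim \<sigma>"
    and "orient N \<sigma> \<noteq> 0"
proof -
  show *: "lattice_basis (sublattice N \<sigma>) (orient_basis N \<sigma>)"
    using zlattice_sublattice[OF assms(1)] unfolding orient_basis_def zlattice_def by (rule someI_ex)
  show s: "span (set (orient_basis N \<sigma>)) = span \<sigma>"
    using lattice_basisD(5)[OF *] rational_coneD(5)[OF assms(2)] by simp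
  show "length (orient_basis N \<sigma>) = dim \<sigma>"
    using lattice_basisD(6)[OF *] rational_coneD(5)[OF assms(2)] by (metis dim_span)
  show "orient N \<sigma> \<noteq> 0"
    unfolding orient_def using wedge_nonzero lattice_basisD(1,2)[OF *] by blast
qed

text \<open>Each of the two wedges lies in the cyclic group generated by the other, so the factor is
  a unit of the integers.\<close>

lemma wedge_lattice_basis_eq:
  assumes "lattice_basis L vs" "lattice_basis L ws"
  shows "\<exists>s. s * s = 1 \<and> wedge ws = int_scale s (wedge vs)"
proof -
  have *: "\<exists>k. wedge ws = int_scale k (wedge vs)" if "lattice_basis L vs" "lattice_basis L ws" for vs ws
  proof -
    have "length ws = length vs" using that lattice_basisD(6) by metis
    then show ?thesis
      using wedge_in_lattice_ext[of ws vs] lattice_ext_top[of vs] lattice_basisD(3)[OF that(1)]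
        lattice_basisD(4)[OF that(2)] by auto
  qed
  obtain k l where kl: "wedge ws = int_scale k (wedge vs)" "wedge vs = int_scale l (wedge ws)"
    using *[OF assms] *[OF assms(2,1)] by blast
  then have "real_scale (of_int (k * l) - 1) (wedge ws) = 0"
    by (simp add: real_scale_linear int_scale_real_scale)
  moreover have "wedge ws \<noteq> 0" using assms(2) by (simp add: lattice_basis_def wedge_nonzero)
  ultimately have "k * l = 1" by (simp add: real_scale_eq_0_iff del: of_int_mult)
  then have "k * k = 1" by (auto simp: zmult_eq_1_iff)
  then show ?thesis using kl(1) by blast
qed

section \<open>Ray generators and signs for a face of codimension one\<close>

locale codim_1_face =
  fixes N :: "'v::euclidean_space set" and \<tau> \<sigma> :: "'v set"
  assumes N: "zlattice N" and rat: "rational_cone N \<sigma>" "rational_cone N \<tau>"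
    and face: "\<tau> face_of \<sigma>" and dim: "dim \<sigma> = Suc (dim \<tau>)"
begin

abbreviation (input) \<pi> where "\<pi> \<equiv> quot_map (span \<tau>)"

lemma lin: "linear \<pi>" by (simp add: linear_quot_map)

lemma span_subset: "span \<tau> \<subseteq> span \<sigma>"
  using face face_of_imp_subset by (intro span_mono) blast

lemma nonempty: "\<tau> \<noteq> {}" using rational_coneD(4)[OF rat(2)] by blast

lemma quot_sublattice:
  obtains e where "e \<noteq> 0" "group_closure {e} = \<pi> ` sublattice N \<sigma>"
proof -
  have "zlattice (\<pi> ` N)" using zlattice_quot_lattice[OF N rat(2)] by (simp add: quot_lattice_def)
  moreover have "\<pi> ` sublattice N \<sigma> \<subseteq> \<pi> ` N" by (rule image_mono) (auto simp: sublattice_def)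
  moreover have "group_closure (\<pi> ` sublattice N \<sigma>) = \<pi> ` sublattice N \<sigma>"
    using zlattice_group_closure[OF zlattice_sublattice[OF N]] group_closure_linear_image[OF lin] by metis
  ultimately have "zlattice (\<pi> ` sublattice N \<sigma>)"
    by (rule zlattice_subgroup)
  then obtain es where es: "lattice_basis (\<pi> ` sublattice N \<sigma>) es" by (auto simp: zlattice_def)
  have "dim (\<pi> ` sublattice N \<sigma>) = dim (\<pi> ` span \<sigma>)"
    using rational_coneD(5)[OF rat(1)] linear_span_image[OF lin] by (metis dim_span)
  also have "\<dots> = 1"
    using dim_quot_map_image[OF subspace_span subspace_span span_subset] dim by simp
  finally have "length es = 1" using lattice_basisD(6)[OF es] by simp
  then obtain e where e: "es = [e]" by (auto simp: length_Suc_conv)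
  have "e \<noteq> 0" using lattice_basisD(2)[OF es] e dependent_zero by fastforce
  then show ?thesis using that lattice_basisD(3)[OF es] e by simp
qed

text \<open>Some lattice generator of \<open>\<sigma>\<close> has nonzero image \<open>k e0\<close>,
  and the sign of \<open>k\<close> decides which of the two generators of the quotient lies in the
  image of \<open>\<sigma>\<close>. Pointedness of that image excludes the other one, so the
  description in \<open>ray_gen\<close> is unique.\<close>

lemma ray_gen: "ray_gen N \<tau> \<sigma> \<in> \<pi> ` \<sigma>" "group_closure {ray_gen N \<tau> \<sigma>} = \<pi> ` sublattice N \<sigma>"
  "ray_gen N \<tau> \<sigma> \<noteq> 0"
proof -
  obtain e0 where e0: "e0 \<noteq> 0" "group_closure {e0} = \<pi> ` sublattice N \<sigma>" by (rule quot_sublattice)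
  have single: "group_closure {e} = {of_int k *\<^sub>R e | k. True}" for e :: 'v
    using group_closure_insert[of e "{}"] by auto
  obtain S where S: "S \<subseteq> N" "S \<subseteq> \<sigma>" "span S = span \<sigma>"
    using rat(1) by (rule rational_cone_generators)
  have "\<exists>x\<in>S. \<pi> x \<noteq> 0"
  proof (rule ccontr)
    assume "\<not> ?thesis"
    then have "S \<subseteq> span \<tau>" by (auto simp: quot_map_eq_0_iff)
    then have "span \<sigma> \<subseteq> span \<tau>" unfolding S(3)[symmetric] by (intro span_minimal) auto
    then have "dim \<sigma> \<le> dim \<tau>" by (rule dim_subset[of "span \<sigma>" "span \<tau>", unfolded dim_span])
    then show False using dim by simp
  qed
  then obtain x where x: "x \<in> S" "\<pi> x \<noteq> 0" by blast
  have "x \<in> sublattice N \<sigma>" using x(1) S(1,2) by (auto simp: sublattice_def span_base)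
  then obtain k where k: "\<pi> x = of_int k *\<^sub>R e0" using e0(2) single by blast
  have "k \<noteq> 0" using k x by auto
  define e where "e = of_int (sgn k) *\<^sub>R e0"
  have "e = \<pi> ((1 / of_int \<bar>k\<bar>) *\<^sub>R x)"
    using k \<open>k \<noteq> 0\<close> by (simp add: e_def linear_scale[OF lin] sgn_if)
  moreover have "(1 / of_int \<bar>k\<bar>) *\<^sub>R x \<in> \<sigma>"
    using x(1) S(2) rational_coneD(1)[OF rat(1)] by (intro convex_cone_scaleR) auto
  ultimately have e\<sigma>: "e \<in> \<pi> ` \<sigma>" by blast
  have gen_sgn: "group_closure {of_int s *\<^sub>R e0} = group_closure {e0}" if "s = 1 \<or> s = -1" for s :: int
  proof -
    have "(\<exists>k. x = of_int k *\<^sub>R (of_int s *\<^sub>R e0)) \<longleftrightarrow> (\<exists>k::int. x = of_int k *\<^sub>R e0)" for x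
      using that by (metis minus_minus mult.right_neutral mult_minus1_right of_int_mult scaleR_scaleR)
    then show ?thesis unfolding single by blast
  qed
  have eg: "group_closure {e} = \<pi> ` sublattice N \<sigma>"
    using gen_sgn[of "sgn k"] e0(2) \<open>k \<noteq> 0\<close> by (simp add: e_def sgn_if split: if_splits)
  have uniq: "e' = e" if e': "e' \<in> \<pi> ` \<sigma>" "group_closure {e'} = \<pi> ` sublattice N \<sigma>" for e'
  proof -
    have "e \<noteq> 0" using e0(1) \<open>k \<noteq> 0\<close> by (simp add: e_def sgn_if)
    have "e' \<in> group_closure {e'}" "e \<in> group_closure {e}" by (auto intro: group_closure.base)
    moreover have "group_closure {e'} = group_closure {e}" using eg e'(2) by metis
    ultimately have "e' \<in> group_closure {e}" "e \<in> group_closure {e'}" by blast+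
    then obtain a b where ab: "e' = of_int a *\<^sub>R e" "e = of_int b *\<^sub>R e'" unfolding single by blast
    then have "e = of_int b *\<^sub>R (of_int a *\<^sub>R e)" by metis
    then have "of_int (b * a) *\<^sub>R e = 1 *\<^sub>R e" by (metis of_int_mult scaleR_one scaleR_scaleR)
    then have "real_of_int (b * a) = 1" using \<open>e \<noteq> 0\<close> scaleR_right_imp_eq by blast
    then have "b * a = 1" by linarith
    then have "a = 1 \<or> a = -1" by (auto simp: zmult_eq_1_iff)
    moreover have "a \<noteq> -1"
    proof
      assume "a = -1"
      then have "e' = - e" using ab by simp
      moreover obtain y z where "y \<in> \<sigma>" "z \<in> \<sigma>" "e' = \<pi> y" "e = \<pi> z" using e' e\<sigma> by blast
      ultimately have "e' = 0"
        using quot_map_cone_pointed[OF rational_coneD(1)[OF rat(1)] face nonempty, of y z] by simp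
      then show False using \<open>e' = - e\<close> \<open>e \<noteq> 0\<close> by simp
    qed
    ultimately show ?thesis using ab by simp
  qed
  have "ray_gen N \<tau> \<sigma> = e" unfolding ray_gen_def
    by (rule the_equality) (use e\<sigma> eg uniq in blast)+
  then show "ray_gen N \<tau> \<sigma> \<in> \<pi> ` \<sigma>" "group_closure {ray_gen N \<tau> \<sigma>} = \<pi> ` sublattice N \<sigma>"
    "ray_gen N \<tau> \<sigma> \<noteq> 0"
    using e\<sigma> eg e0(1) \<open>k \<noteq> 0\<close> by (simp_all add: e_def sgn_if)
qed

lemma ray_lift: "ray_lift N \<tau> \<sigma> \<in> sublattice N \<sigma>" "\<pi> (ray_lift N \<tau> \<sigma>) = ray_gen N \<tau> \<sigma>"
proof -
  have "ray_gen N \<tau> \<sigma> \<in> \<pi> ` sublattice N \<sigma>"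
    unfolding ray_gen(2)[symmetric] by (simp add: group_closure.base)
  then have "\<exists>n. n \<in> sublattice N \<sigma> \<and> \<pi> n = ray_gen N \<tau> \<sigma>" by auto
  then have "ray_lift N \<tau> \<sigma> \<in> sublattice N \<sigma> \<and> \<pi> (ray_lift N \<tau> \<sigma>) = ray_gen N \<tau> \<sigma>"
    unfolding ray_lift_def by (rule someI_ex)
  then show "ray_lift N \<tau> \<sigma> \<in> sublattice N \<sigma>" "\<pi> (ray_lift N \<tau> \<sigma>) = ray_gen N \<tau> \<sigma>" by auto
qed

text \<open>The image of the lift generates the quotient, so subtracting a multiple of the lift
  moves any vector of \<open>N\<^sub>\<sigma>\<close> into \<open>N\<^sub>\<tau>\<close>. This is
  why \<open>face_sign\<close> is a unit.\<close>

lemma lattice_basis_ray_lift: "lattice_basis (sublattice N \<sigma>) (ray_lift N \<tau> \<sigma> # orient_basis N \<tau>)"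
proof -
  let ?n = "ray_lift N \<tau> \<sigma>" and ?B = "orient_basis N \<tau>"
  note B = orient_basis[OF N rat(2)]
  have n: "?n \<notin> span (set ?B)"
    using ray_lift(2) ray_gen(3) by (auto simp: B(2) quot_map_eq_0_iff[OF subspace_span, symmetric])
  then have "?n \<notin> set ?B" using span_base by blast
  have grp: "\<And>x y. x \<in> sublattice N \<sigma> \<Longrightarrow> y \<in> sublattice N \<sigma> \<Longrightarrow> x - y \<in> sublattice N \<sigma>"
    "0 \<in> sublattice N \<sigma>" "\<And>x k. x \<in> sublattice N \<sigma> \<Longrightarrow> of_int k *\<^sub>R x \<in> sublattice N \<sigma>"
    using zlattice_group_closure[OF zlattice_sublattice[OF N, of \<sigma>]]
      group_closure.diff[of _ "sublattice N \<sigma>"] zero_in_group_closure[of "sublattice N \<sigma>"]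
      group_closure_scale[of _ "sublattice N \<sigma>"] by auto
  have "set ?B \<subseteq> sublattice N \<sigma>"
    using lattice_basisD(4)[OF B(1)] span_subset by (auto simp: sublattice_def)
  then have "group_closure (set (?n # ?B)) \<subseteq> sublattice N \<sigma>"
    by (intro group_closure_subset) (use grp ray_lift(1) in auto)
  moreover have "sublattice N \<sigma> \<subseteq> group_closure (set (?n # ?B))"
  proof
    fix x assume x: "x \<in> sublattice N \<sigma>"
    then have "\<pi> x \<in> group_closure {ray_gen N \<tau> \<sigma>}" unfolding ray_gen(2) by blast
    then obtain k where k: "\<pi> x = of_int k *\<^sub>R ray_gen N \<tau> \<sigma>"
      using group_closure_insert[of "ray_gen N \<tau> \<sigma>" "{}"] by auto
    then have "\<pi> (x - of_int k *\<^sub>R ?n) = 0"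
      by (simp add: linear_diff[OF lin] linear_scale[OF lin] ray_lift(2))
    then have "x - of_int k *\<^sub>R ?n \<in> span \<tau>" by (simp add: quot_map_eq_0_iff)
    moreover have "x - of_int k *\<^sub>R ?n \<in> N" using grp(1)[OF x grp(3)[OF ray_lift(1)]] by (simp add: sublattice_def)
    ultimately have "x - of_int k *\<^sub>R ?n \<in> group_closure (set ?B)"
      using lattice_basisD(3)[OF B(1)] by (simp add: sublattice_def)
    then show "x \<in> group_closure (set (?n # ?B))"
      by (auto simp: group_closure_insert intro!: exI[of _ k] exI[of _ "x - of_int k *\<^sub>R ?n"])
  qed
  ultimately show ?thesis
    using lattice_basisD(1,2)[OF B(1)] n \<open>?n \<notin> set ?B\<close> by (simp add: lattice_basis_def independent_insert)
qed

lemma face_sign: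
  "ext_mult (ray_lift N \<tau> \<sigma>) (orient N \<tau>) = int_scale (face_sign N \<tau> \<sigma>) (orient N \<sigma>)"
  "face_sign N \<tau> \<sigma> * face_sign N \<tau> \<sigma> = 1"
proof -
  obtain s where s: "s * s = 1" "ext_mult (ray_lift N \<tau> \<sigma>) (orient N \<tau>) = int_scale s (orient N \<sigma>)"
    using wedge_lattice_basis_eq[OF orient_basis(1)[OF N rat(1)] lattice_basis_ray_lift]
    by (auto simp: orient_def)
  have "face_sign N \<tau> \<sigma> = s" unfolding face_sign_def
  proof (rule the_equality, rule s(2))
    fix t assume "ext_mult (ray_lift N \<tau> \<sigma>) (orient N \<tau>) = int_scale t (orient N \<sigma>)"
    then have "real_scale (of_int t - of_int s) (orient N \<sigma>) = 0"
      using s(2) by (simp add: int_scale_real_scale real_scale_linear)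
    then show "t = s" using orient_basis(4)[OF N rat(1)] by (simp add: real_scale_eq_0_iff)
  qed
  then show "ext_mult (ray_lift N \<tau> \<sigma>) (orient N \<tau>) = int_scale (face_sign N \<tau> \<sigma>) (orient N \<sigma>)"
    "face_sign N \<tau> \<sigma> * face_sign N \<tau> \<sigma> = 1" using s by simp_all
qed

end

section \<open>Star fans\<close>

locale fan =
  fixes N :: "'v::euclidean_space set" and \<Sigma> :: "'v set set"
  assumes N: "zlattice N" and fan: "rational_fan N \<Sigma>"
begin

lemma finite_fan: "finite \<Sigma>" using fan by (simp add: rational_fan_def)

lemma rational: "\<sigma> \<in> \<Sigma> \<Longrightarrow> rational_cone N \<sigma>" using fan by (simp add: rational_fan_def)

lemma cone: 
  assumes "\<sigma> \<in> \<Sigma>" 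
  shows "convex_cone \<sigma>" "convex \<sigma>" "closed \<sigma>" "0 \<in> \<sigma>" "\<sigma> \<noteq> {}"
  using rational_coneD[OF rational[OF assms]] by auto

lemma face_mem: "\<sigma> \<in> \<Sigma> \<Longrightarrow> \<tau> face_of \<sigma> \<Longrightarrow> \<tau> \<noteq> {} \<Longrightarrow> \<tau> \<in> \<Sigma>"
  using fan by (simp add: rational_fan_def)

lemma Int_face: "\<sigma> \<in> \<Sigma> \<Longrightarrow> \<tau> \<in> \<Sigma> \<Longrightarrow> \<sigma> \<inter> \<tau> face_of \<sigma>"
  using fan by (simp add: rational_fan_def)

text \<open>Within a fan inclusion is the face relation, since intersections are faces; sums over
  \<open>\<tau> \<subseteq> \<sigma>\<close> and over faces therefore agree.\<close>

lemma subset_face: "\<sigma> \<in> \<Sigma> \<Longrightarrow> \<tau> \<in> \<Sigma> \<Longrightarrow> \<tau> \<subseteq> \<sigma> \<Longrightarrow> \<tau> face_of \<sigma>"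
  using Int_face[of \<sigma> \<tau>] by (simp add: Int_absorb1)

lemma Int_mem: "\<sigma> \<in> \<Sigma> \<Longrightarrow> \<tau> \<in> \<Sigma> \<Longrightarrow> \<sigma> \<inter> \<tau> \<in> \<Sigma>"
  using face_mem[OF _ Int_face] cone(4) by blast

lemma subset_eq_span_Int:
  assumes "\<sigma> \<in> \<Sigma>" "\<tau> \<in> \<Sigma>" "\<tau> \<subseteq> \<sigma>" shows "\<tau> = span \<tau> \<inter> \<sigma>"
  using face_of_cone(2)[OF cone(1) subset_face] assms cone(5) by blast

lemma dim_eq_imp_eq:
  assumes "\<sigma> \<in> \<Sigma>" "\<tau> \<in> \<Sigma>" "\<tau> \<subseteq> \<sigma>" "dim \<tau> = dim \<sigma>" shows "\<tau> = \<sigma>"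
proof -
  have "span \<tau> = span \<sigma>" by (rule dim_eq_span) (use assms in auto)
  then have "\<sigma> \<subseteq> span \<tau>" using span_superset by blast
  then show ?thesis using subset_eq_span_Int[OF assms(1-3)] by blast
qed

lemma span_cone:
  assumes "\<eta> \<in> \<Sigma>" "x \<in> span \<eta>"
  shows "\<exists>a\<in>\<eta>. \<exists>b\<in>\<eta>. x = a - b"
  using assms(2)
proof (induction rule: span_induct)
  case base
  have *: "convex_cone \<eta>" using cone assms by blast
  show ?case unfolding mem_Collect_eq
  proof (rule subspaceI; unfold mem_Collect_eq)
    show "\<exists>a\<in>\<eta>. \<exists>b\<in>\<eta>. 0 = a - b" using cone(4)[OF assms(1)] by force
    fix x y assume "\<exists>a\<in>\<eta>. \<exists>b\<in>\<eta>. x = a - b" "\<exists>a\<in>\<eta>. \<exists>b\<in>\<eta>. y = a - b"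
    then obtain a b a' b' where "a \<in> \<eta>" "b \<in> \<eta>" "a' \<in> \<eta>" "b' \<in> \<eta>" "x = a - b" "y = a' - b'" by blast
    then show "\<exists>a\<in>\<eta>. \<exists>b\<in>\<eta>. x + y = a - b"
      by (intro bexI[of _ "a + a'"] bexI[of _ "b + b'"]) (auto intro: convex_cone_add[OF *])
  next
    fix c :: real and x assume "\<exists>a\<in>\<eta>. \<exists>b\<in>\<eta>. x = a - b"
    then obtain a b where x: "a \<in> \<eta>" "b \<in> \<eta>" "x = a - b" by blast
    show "\<exists>a\<in>\<eta>. \<exists>b\<in>\<eta>. c *\<^sub>R x = a - b"
    proof (cases "c \<ge> 0")
      case True
      then have "c *\<^sub>R a \<in> \<eta>" "c *\<^sub>R b \<in> \<eta>" using convex_cone_scaleR[OF *] x by auto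
      moreover have "c *\<^sub>R x = c *\<^sub>R a - c *\<^sub>R b" unfolding x(3) by (rule scaleR_diff_right)
      ultimately show ?thesis by blast
    next
      case False
      then have "0 \<le> - c" by simp
      then have "(- c) *\<^sub>R a \<in> \<eta>" "(- c) *\<^sub>R b \<in> \<eta>" using convex_cone_scaleR[OF *] x(1,2) by blast+
      moreover have "c *\<^sub>R x = (- c) *\<^sub>R b - (- c) *\<^sub>R a" unfolding x(3) by (simp add: algebra_simps)
      ultimately show ?thesis by blast
    qed
  qed
next
  case (step x)
  then show ?case using cone(4)[OF assms(1)] by force
qed

end

section \<open>The star of a cone as a fan\<close>

locale star = fan N \<Sigma> for N :: "'a::euclidean_space set" and \<Sigma> +
  fixes \<eta> :: "'a set"
  assumes \<eta>: "\<eta> \<in> \<Sigma>"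
begin

definition p where "p = quot_map (span \<eta>)"

lemma linear_p: "linear p" by (simp add: p_def linear_quot_map)

lemma p_eq_0_iff: "p x = 0 \<longleftrightarrow> x \<in> span \<eta>" by (simp add: p_def quot_map_eq_0_iff)

text \<open>The difference of \<open>x\<close> and \<open>y\<close> is \<open>a - b\<close> with
  \<open>a\<close> and \<open>b\<close> in \<open>\<eta>\<close>, and adding elements of
  \<open>\<eta>\<close> does not leave a cone containing \<open>\<eta>\<close>; so
  \<open>x + b = y + a\<close> is a common point.\<close>

lemma p_eqD:
  assumes "\<zeta> \<in> \<Sigma>" "\<theta> \<in> \<Sigma>" "\<eta> \<subseteq> \<zeta>" "\<eta> \<subseteq> \<theta>" "x \<in> \<zeta>" "y \<in> \<theta>" "p x = p y"
  shows "\<exists>b\<in>\<eta>. x + b \<in> \<zeta> \<inter> \<theta>"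
proof -
  have "x - y \<in> span \<eta>" using assms(7) by (simp add: p_def quot_map_eq_iff)
  then obtain a b where ab: "a \<in> \<eta>" "b \<in> \<eta>" "x - y = a - b" using span_cone[OF \<eta>] by blast
  have "x + b \<in> \<zeta>" using assms ab convex_cone_add[OF cone(1)] by blast
  moreover have "x + b = y + a" using ab(3) by (simp add: algebra_simps)
  moreover have "y + a \<in> \<theta>" using assms ab convex_cone_add[OF cone(1)] by blast
  ultimately have "x + b \<in> \<zeta> \<inter> \<theta>" by (metis IntI)
  then show ?thesis using ab(2) by blast
qed

text \<open>A translate \<open>x + b\<close> lies in the face
  \<open>\<zeta> \<inter> \<theta>\<close> of \<open>\<zeta>\<close>, and the face property returns
  \<open>x\<close>. Inclusions, equalities and intersections of cones in the star reduce to
  this.\<close>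

lemma mem_of_p_mem:
  assumes "\<zeta> \<in> \<Sigma>" "\<theta> \<in> \<Sigma>" "\<eta> \<subseteq> \<zeta>" "\<eta> \<subseteq> \<theta>" "x \<in> \<zeta>" "p x \<in> p ` \<theta>"
  shows "x \<in> \<theta>"
proof -
  obtain b where b: "b \<in> \<eta>" "x + b \<in> \<zeta> \<inter> \<theta>" using p_eqD[OF assms(1-5)] assms(6) by blast
  then have "x \<in> \<zeta> \<inter> \<theta>"
    using face_of_cone_add[OF cone(1) Int_face, of \<zeta> \<theta> x b] assms by blast
  then show ?thesis by blast
qed

lemma p_image_subset_iff:
  assumes "\<zeta> \<in> \<Sigma>" "\<theta> \<in> \<Sigma>" "\<eta> \<subseteq> \<zeta>" "\<eta> \<subseteq> \<theta>"
  shows "p ` \<zeta> \<subseteq> p ` \<theta> \<longleftrightarrow> \<zeta> \<subseteq> \<theta>"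
  using mem_of_p_mem[OF assms] by blast

lemma p_image_inj:
  assumes "\<zeta> \<in> \<Sigma>" "\<theta> \<in> \<Sigma>" "\<eta> \<subseteq> \<zeta>" "\<eta> \<subseteq> \<theta>"
  shows "p ` \<zeta> = p ` \<theta> \<longleftrightarrow> \<zeta> = \<theta>"
  using p_image_subset_iff[of \<zeta> \<theta>] p_image_subset_iff[of \<theta> \<zeta>] assms by blast

lemma p_image_Int:
  assumes "\<zeta> \<in> \<Sigma>" "\<theta> \<in> \<Sigma>" "\<eta> \<subseteq> \<zeta>" "\<eta> \<subseteq> \<theta>"
  shows "p ` \<zeta> \<inter> p ` \<theta> = p ` (\<zeta> \<inter> \<theta>)"
  using mem_of_p_mem[OF assms] by blast

lemma star_fan_eq: "star_fan \<Sigma> \<eta> = (`) p ` {\<zeta> \<in> \<Sigma>. \<eta> \<subseteq> \<zeta>}"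
  by (auto simp: star_fan_def p_def)

lemma mem_star_fanI: "\<zeta> \<in> \<Sigma> \<Longrightarrow> \<eta> \<subseteq> \<zeta> \<Longrightarrow> p ` \<zeta> \<in> star_fan \<Sigma> \<eta>"
  by (simp add: star_fan_eq)

lemma dim_p_image:
  assumes "\<eta> \<subseteq> \<zeta>"
  shows "dim (p ` \<zeta>) + dim \<eta> = dim \<zeta>"
proof -
  have "dim (p ` span \<zeta>) + dim (span \<eta>) = dim (span \<zeta>)"
    unfolding p_def by (rule dim_quot_map_image) (use assms span_mono in auto)
  then show ?thesis using linear_span_image[OF linear_p, of \<zeta>] by (metis dim_span)
qed

lemma face_image:
  assumes "\<zeta> \<in> \<Sigma>" "\<theta> \<in> \<Sigma>" "\<eta> \<subseteq> \<theta>" "\<theta> \<subseteq> \<zeta>"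
  shows "p ` \<theta> face_of p ` \<zeta>"
  unfolding face_of_def
proof (intro conjI ballI impI; (elim imageE)?)
  show "p ` \<theta> \<subseteq> p ` \<zeta>" using assms by blast
  show "convex (p ` \<theta>)" by (rule convex_linear_image[OF linear_p cone(2)[OF assms(2)]])
  have face: "\<theta> face_of \<zeta>" using subset_face assms by blast
  have *: "p x \<in> p ` \<theta>" "p y \<in> p ` \<theta>"
    if xyz: "x \<in> \<zeta>" "y \<in> \<zeta>" "z \<in> \<theta>" "p z \<in> open_segment (p x) (p y)" for x y z
  proof -
    from xyz(4) obtain t where t: "0 < t" "t < 1" "p z = (1 - t) *\<^sub>R p x + t *\<^sub>R p y" "p x \<noteq> p y"
      by (auto simp: in_segment)
    \<comment> \<open>The point \<open>z\<close> itself need not lie between \<open>x\<close> and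
      \<open>y\<close>; \<open>w\<close> does, has the same image, and hence also lies in
      \<open>\<theta>\<close>.\<close>
    define w where "w = (1 - t) *\<^sub>R x + t *\<^sub>R y"
    have "w \<in> \<zeta>" unfolding w_def using cone(2)[OF assms(1)] xyz t by (simp add: convexD)
    moreover have "p w = p z" using t by (simp add: w_def linear_add[OF linear_p] linear_scale[OF linear_p])
    ultimately have "w \<in> \<theta>" using mem_of_p_mem[of \<zeta> \<theta> w] assms xyz(3) by auto
    moreover have "w \<in> open_segment x y"
      using t unfolding w_def in_segment by (intro conjI exI[of _ t]) auto
    ultimately have "x \<in> \<theta> \<and> y \<in> \<theta>" using face_ofD[OF face] xyz by blast
    then show "p x \<in> p ` \<theta>" "p y \<in> p ` \<theta>" by auto
  qed
  fix a b c x y z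
  assume "c \<in> open_segment a b" "a = p x" "b = p y" "c = p z" "x \<in> \<zeta>" "y \<in> \<zeta>" "z \<in> \<theta>"
  then show "a \<in> p ` \<theta>" "b \<in> p ` \<theta>" using * by auto
qed

lemma face_of_image:
  assumes "\<zeta> \<in> \<Sigma>" "\<eta> \<subseteq> \<zeta>" "F face_of p ` \<zeta>" "F \<noteq> {}"
  shows "F \<in> star_fan \<Sigma> \<eta>"
proof -
  \<comment> \<open>The preimage of \<open>F\<close> in \<open>\<zeta>\<close> is the candidate cone
    of \<open>\<Sigma>\<close>; it contains \<open>\<eta>\<close> because \<open>F\<close> contains
    0.\<close>
  define \<theta> where "\<theta> = {x \<in> \<zeta>. p x \<in> F}"
  have cc: "convex_cone (p ` \<zeta>)" using cone(1)[OF assms(1)] linear_p by (simp add: convex_cone_linear_image)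
  have "0 \<in> F" using face_of_cone(1)[OF cc assms(3,4)] .
  moreover have "p x = 0" if "x \<in> \<eta>" for x using that by (simp add: p_eq_0_iff span_base)
  ultimately have sub: "\<eta> \<subseteq> \<theta>" using assms(2) by (auto simp: \<theta>_def)
  have "\<theta> face_of \<zeta>" unfolding face_of_def
  proof (intro conjI ballI impI)
    show "\<theta> \<subseteq> \<zeta>" by (auto simp: \<theta>_def)
    have "\<theta> = \<zeta> \<inter> p -` F" by (auto simp: \<theta>_def)
    then show "convex \<theta>" using cone(2)[OF assms(1)] assms(3)
      by (simp add: convex_Int convex_linear_vimage linear_p face_of_imp_convex)
    fix a b x assume *: "a \<in> \<zeta>" "b \<in> \<zeta>" "x \<in> \<theta>" "x \<in> open_segment a b"
    then obtain t where t: "0 < t" "t < 1" "x = (1 - t) *\<^sub>R a + t *\<^sub>R b" by (auto simp: in_segment)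
    have px: "p x = (1 - t) *\<^sub>R p a + t *\<^sub>R p b"
      using t by (simp add: linear_add[OF linear_p] linear_scale[OF linear_p])
    \<comment> \<open>The segment may collapse under \<open>p\<close>; the face property of
      \<open>F\<close> applies only if its endpoints stay distinct.\<close>
    have "p a \<in> F \<and> p b \<in> F"
    proof (cases "p a = p b")
      case True
      then have "p x = p a" using px by (simp add: algebra_simps)
      then show ?thesis using * True by (auto simp: \<theta>_def)
    next
      case False
      then have "p x \<in> open_segment (p a) (p b)"
        using t px unfolding in_segment by (intro conjI exI[of _ t]) auto
      then show ?thesis using face_ofD[OF assms(3), of "p x" "p a" "p b"] * by (auto simp: \<theta>_def)
    qed
    then show "a \<in> \<theta>" "b \<in> \<theta>" using * by (auto simp: \<theta>_def)
  qed
  then have "\<theta> \<in> \<Sigma>" using face_mem[OF assms(1)] sub cone(5)[OF \<eta>] by blast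
  moreover have "F = p ` \<theta>" using face_of_imp_subset[OF assms(3)] by (auto simp: \<theta>_def)
  ultimately show ?thesis using sub mem_star_fanI by blast
qed

lemma quot_lattice_eq: "quot_lattice N \<eta> = p ` N" by (simp add: quot_lattice_def p_def)

lemma rational_fan_star: "rational_fan (quot_lattice N \<eta>) (star_fan \<Sigma> \<eta>)"
  unfolding rational_fan_def
proof (intro conjI ballI allI impI)
  show "finite (star_fan \<Sigma> \<eta>)" using finite_fan by (simp add: star_fan_eq)
  show "star_fan \<Sigma> \<eta> \<noteq> {}" using mem_star_fanI[OF \<eta>] by blast
  fix \<sigma> assume "\<sigma> \<in> star_fan \<Sigma> \<eta>"
  then obtain \<zeta> where \<zeta>: "\<zeta> \<in> \<Sigma>" "\<eta> \<subseteq> \<zeta>" "\<sigma> = p ` \<zeta>" by (auto simp: star_fan_eq)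
  obtain S where S: "finite S" "S \<subseteq> N" "\<zeta> = convex_cone hull S"
    using rational[OF \<zeta>(1)] by (auto simp: rational_cone_def)
  show "rational_cone (quot_lattice N \<eta>) \<sigma>"
    unfolding rational_cone_def quot_lattice_eq
    by (rule exI[of _ "p ` S"]) (use S \<zeta>(3) convex_cone_hull_linear_image[OF linear_p] in auto)
  show "strongly_convex \<sigma>" unfolding strongly_convex_def
  proof (intro allI impI)
    fix x assume "x \<in> \<sigma> \<and> - x \<in> \<sigma>"
    then obtain y z where yz: "y \<in> \<zeta>" "z \<in> \<zeta>" "x = p y" "- x = p z" using \<zeta>(3) by blast
    then have "p y = - p z" by (metis minus_minus)
    then show "x = 0"
      using quot_map_cone_pointed[OF cone(1)[OF \<zeta>(1)] subset_face[OF \<zeta>(1) \<eta> \<zeta>(2)] cone(5)[OF \<eta>] yz(1,2)] yz(3)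
      by (simp add: p_def)
  qed
  show "\<tau> \<in> star_fan \<Sigma> \<eta>" if "\<tau> face_of \<sigma> \<and> \<tau> \<noteq> {}" for \<tau>
    using face_of_image[OF \<zeta>(1,2)] that \<zeta>(3) by blast
  fix \<tau> assume "\<tau> \<in> star_fan \<Sigma> \<eta>"
  then obtain \<theta> where \<theta>: "\<theta> \<in> \<Sigma>" "\<eta> \<subseteq> \<theta>" "\<tau> = p ` \<theta>" by (auto simp: star_fan_eq)
  have eq: "\<sigma> \<inter> \<tau> = p ` (\<zeta> \<inter> \<theta>)" using p_image_Int \<zeta> \<theta> by simp
  show "\<sigma> \<inter> \<tau> face_of \<sigma>" "\<sigma> \<inter> \<tau> face_of \<tau>"
    unfolding eq unfolding \<zeta>(3) \<theta>(3)
    by (rule face_image; use \<zeta>(1,2) \<theta>(1,2) Int_mem in blast)+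
qed

lemma fan_star: "fan (quot_lattice N \<eta>) (star_fan \<Sigma> \<eta>)"
  by (simp add: fan_def zlattice_quot_lattice[OF N rational[OF \<eta>]] rational_fan_star)

lemma quot_map_p:
  assumes "\<eta> \<subseteq> \<zeta>"
  shows "quot_map (span (p ` \<zeta>)) (p x) = quot_map (span \<zeta>) x"
  unfolding linear_span_image[OF linear_p] unfolding p_def
  by (rule quot_map_trans) (simp_all add: span_mono assms)

lemma quot_lattice_star:
  assumes "\<eta> \<subseteq> \<zeta>"
  shows "quot_lattice (quot_lattice N \<eta>) (p ` \<zeta>) = quot_lattice N \<zeta>"
  unfolding quot_lattice_def[of "quot_lattice N \<eta>"] quot_lattice_def[of N \<zeta>] unfolding quot_lattice_eq
  by (simp add: image_image quot_map_p[OF assms])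

lemma star_fan_star:
  assumes "\<zeta> \<in> \<Sigma>" "\<eta> \<subseteq> \<zeta>"
  shows "star_fan (star_fan \<Sigma> \<eta>) (p ` \<zeta>) = star_fan \<Sigma> \<zeta>"
proof -
  have "star_fan (star_fan \<Sigma> \<eta>) (p ` \<zeta>) = {quot_map (span (p ` \<zeta>)) ` p ` \<theta> | \<theta>. \<theta> \<in> \<Sigma> \<and> \<eta> \<subseteq> \<theta> \<and> p ` \<zeta> \<subseteq> p ` \<theta>}"
    unfolding star_fan_def[of "star_fan \<Sigma> \<eta>"] unfolding star_fan_eq by blast
  also have "\<dots> = {quot_map (span \<zeta>) ` \<theta> | \<theta>. \<theta> \<in> \<Sigma> \<and> \<eta> \<subseteq> \<theta> \<and> \<zeta> \<subseteq> \<theta>}"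
    unfolding image_image quot_map_p[OF assms(2)] using p_image_subset_iff assms by blast
  also have "\<dots> = star_fan \<Sigma> \<zeta>" using assms unfolding star_fan_def by blast
  finally show ?thesis .
qed

lemma sublattice_star:
  assumes "\<eta> \<subseteq> \<zeta>"
  shows "sublattice (quot_lattice N \<eta>) (p ` \<zeta>) = p ` sublattice N \<zeta>"
proof -
  have "x \<in> span \<zeta>" if "p x \<in> span (p ` \<zeta>)" for x
  proof -
    have "p x \<in> p ` span \<zeta>" using that by (simp add: linear_span_image[OF linear_p])
    then obtain y where y: "y \<in> span \<zeta>" "p x = p y" by blast
    then have "x - y \<in> span \<eta>" by (simp add: p_def quot_map_eq_iff)
    then have "x - y \<in> span \<zeta>" using span_mono[OF assms] by blast
    then have "(x - y) + y \<in> span \<zeta>" using y(1) by (rule span_add)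
    then show ?thesis by simp
  qed
  moreover have "p x \<in> span (p ` \<zeta>)" if "x \<in> span \<zeta>" for x
    using that by (simp add: linear_span_image[OF linear_p])
  ultimately show ?thesis unfolding sublattice_def quot_lattice_eq by blast
qed

lemma ray_gen_star:
  assumes "\<eta> \<subseteq> \<tau>" "\<tau> \<subseteq> \<sigma>"
  shows "ray_gen (quot_lattice N \<eta>) (p ` \<tau>) (p ` \<sigma>) = ray_gen N \<tau> \<sigma>"
proof -
  have "\<eta> \<subseteq> \<sigma>" using assms by blast
  then show ?thesis
    by (simp add: ray_gen_def sublattice_star image_image quot_map_p[OF assms(1)])
qed

lemma cones_star: "cones (star_fan \<Sigma> \<eta>) k = (`) p ` {\<zeta> \<in> cones \<Sigma> (k + int (dim \<eta>)). \<eta> \<subseteq> \<zeta>}"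
proof -
  have "int (dim (p ` \<zeta>)) = k \<longleftrightarrow> int (dim \<zeta>) = k + int (dim \<eta>)" if "\<eta> \<subseteq> \<zeta>" for \<zeta>
    using dim_p_image[OF that] by linarith
  then show ?thesis by (auto simp: cones_def star_fan_eq)
qed

lemma sum_cones_star:
  fixes f :: "'a set \<Rightarrow> 'b::comm_monoid_add"
  assumes "\<tau> \<in> \<Sigma>" "\<eta> \<subseteq> \<tau>"
  shows "(\<Sum>\<sigma> | \<sigma> \<in> cones (star_fan \<Sigma> \<eta>) k \<and> p ` \<tau> \<subseteq> \<sigma>. f \<sigma>) =
    (\<Sum>\<sigma> | \<sigma> \<in> cones \<Sigma> (k + int (dim \<eta>)) \<and> \<tau> \<subseteq> \<sigma>. f (p ` \<sigma>))"
proof -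
  have "{\<sigma>. \<sigma> \<in> cones (star_fan \<Sigma> \<eta>) k \<and> p ` \<tau> \<subseteq> \<sigma>} =
     (`) p ` {\<sigma>. \<sigma> \<in> cones \<Sigma> (k + int (dim \<eta>)) \<and> \<tau> \<subseteq> \<sigma>}"
    unfolding cones_star using p_image_subset_iff[OF assms(1)] assms(2) unfolding cones_def by blast
  moreover have "inj_on ((`) p) {\<sigma>. \<sigma> \<in> cones \<Sigma> (k + int (dim \<eta>)) \<and> \<tau> \<subseteq> \<sigma>}"
    using p_image_inj assms(2) unfolding inj_on_def cones_def by blast
  ultimately show ?thesis by (simp add: sum.reindex)
qed

end

section \<open>Tropical fans and their stars\<close>

locale tropical = fan N \<Sigma> for N :: "'a::euclidean_space set" and \<Sigma> +
  fixes d :: nat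
  assumes trop: "tropical_fan N d \<Sigma>"
begin

lemma exists_top_cone:
  assumes "\<sigma> \<in> \<Sigma>"
  shows "\<exists>\<zeta>\<in>\<Sigma>. \<sigma> \<subseteq> \<zeta> \<and> dim \<zeta> = d"
proof -
  obtain \<zeta> where \<zeta>: "\<zeta> \<in> \<Sigma>" "\<sigma> \<subseteq> \<zeta>" "\<And>\<theta>. \<theta> \<in> \<Sigma> \<Longrightarrow> \<zeta> \<subseteq> \<theta> \<Longrightarrow> \<theta> = \<zeta>"
    using finite_has_maximal2[OF finite_fan assms] by metis
  then show ?thesis using trop unfolding tropical_fan_def pure_dim_def by blast
qed

lemma dim_le: "\<sigma> \<in> \<Sigma> \<Longrightarrow> dim \<sigma> \<le> d"
  using exists_top_cone dim_subset by metis

lemma top_cone_maximal: "\<sigma> \<in> \<Sigma> \<Longrightarrow> dim \<sigma> = d \<Longrightarrow> \<zeta> \<in> \<Sigma> \<Longrightarrow> \<sigma> \<subseteq> \<zeta> \<Longrightarrow> \<zeta> = \<sigma>"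
  using dim_eq_imp_eq[of \<zeta> \<sigma>] dim_le[of \<zeta>] dim_subset[of \<sigma> \<zeta>] by force

lemma balanced:
  "\<tau> \<in> cones \<Sigma> (int d - 1) \<Longrightarrow> (\<Sum>\<sigma> | \<sigma> \<in> cones \<Sigma> (int d) \<and> \<tau> \<subseteq> \<sigma>. ray_gen N \<tau> \<sigma>) = 0"
  using trop by (simp add: tropical_fan_def)

end

locale tropical_star = tropical N \<Sigma> d + star N \<Sigma> \<eta>
  for N :: "'a::euclidean_space set" and \<Sigma> d \<eta>
begin

lemma int_dim_diff: "int (d - dim \<eta>) = int d - int (dim \<eta>)"
  using dim_le[OF \<eta>] by simp

lemma tropical_fan_star: "tropical_fan (quot_lattice N \<eta>) (d - dim \<eta>) (star_fan \<Sigma> \<eta>)"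
  unfolding tropical_fan_def pure_dim_def
proof (intro conjI ballI impI rational_fan_star)
  fix \<sigma> assume "\<sigma> \<in> star_fan \<Sigma> \<eta>" and max: "\<forall>\<theta>\<in>star_fan \<Sigma> \<eta>. \<sigma> \<subseteq> \<theta> \<longrightarrow> \<theta> = \<sigma>"
  then obtain \<zeta> where \<zeta>: "\<zeta> \<in> \<Sigma>" "\<eta> \<subseteq> \<zeta>" "\<sigma> = p ` \<zeta>" by (auto simp: star_fan_eq)
  obtain \<theta> where \<theta>: "\<theta> \<in> \<Sigma>" "\<zeta> \<subseteq> \<theta>" "dim \<theta> = d" using exists_top_cone[OF \<zeta>(1)] by blast
  then have "\<sigma> = p ` \<theta>" using max \<zeta> mem_star_fanI[of \<theta>] by (metis image_mono order_trans)
  then show "dim \<sigma> = d - dim \<eta>" using dim_p_image[of \<theta>] \<zeta>(2) \<theta> by fastforce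
next
  fix \<tau> assume "\<tau> \<in> cones (star_fan \<Sigma> \<eta>) (int (d - dim \<eta>) - 1)"
  then obtain \<theta> where \<theta>: "\<theta> \<in> cones \<Sigma> (int d - 1)" "\<eta> \<subseteq> \<theta>" "\<tau> = p ` \<theta>"
    by (auto simp: cones_star int_dim_diff)
  have "\<theta> \<in> \<Sigma>" using \<theta>(1) by (simp add: cones_def)
  have "(\<Sum>\<sigma> | \<sigma> \<in> cones (star_fan \<Sigma> \<eta>) (int (d - dim \<eta>)) \<and> \<tau> \<subseteq> \<sigma>. ray_gen (quot_lattice N \<eta>) \<tau> \<sigma>)
     = (\<Sum>\<sigma> | \<sigma> \<in> cones \<Sigma> (int d) \<and> \<theta> \<subseteq> \<sigma>. ray_gen N \<theta> \<sigma>)"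
    unfolding \<theta>(3) sum_cones_star[OF \<open>\<theta> \<in> \<Sigma>\<close> \<theta>(2)]
    by (rule sum.cong) (auto simp: int_dim_diff ray_gen_star[OF \<theta>(2)])
  then show "(\<Sum>\<sigma> | \<sigma> \<in> cones (star_fan \<Sigma> \<eta>) (int (d - dim \<eta>)) \<and> \<tau> \<subseteq> \<sigma>. ray_gen (quot_lattice N \<eta>) \<tau> \<sigma>) = 0"
    using balanced[OF \<theta>(1)] by simp
qed

lemma smooth_fan_star:
  assumes "smooth_fan N d \<Sigma>"
  shows "smooth_fan (quot_lattice N \<eta>) (d - dim \<eta>) (star_fan \<Sigma> \<eta>)"
  unfolding smooth_fan_def
proof
  fix \<sigma> assume "\<sigma> \<in> star_fan \<Sigma> \<eta>"
  then obtain \<zeta> where \<zeta>: "\<zeta> \<in> \<Sigma>" "\<eta> \<subseteq> \<zeta>" "\<sigma> = p ` \<zeta>" by (auto simp: star_fan_eq)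
  have "d - dim \<eta> - dim \<sigma> = d - dim \<zeta>" using dim_p_image[OF \<zeta>(2)] \<zeta>(3) by simp
  then show "poincare_duality (quot_lattice (quot_lattice N \<eta>) \<sigma>) (d - dim \<eta> - dim \<sigma>) (star_fan (star_fan \<Sigma> \<eta>) \<sigma>)"
    using assms \<zeta> unfolding smooth_fan_def by (simp add: quot_lattice_star star_fan_star)
qed

lemma tropical_star: "tropical (quot_lattice N \<eta>) (star_fan \<Sigma> \<eta>) (d - dim \<eta>)"
  by (simp add: tropical_def tropical_axioms_def fan_star tropical_fan_star)

end

section \<open>Tropical homology\<close>

lemma carrier_BM_chains: "carrier (BM_chains N \<Sigma> a q) = (\<Pi>\<^sub>E \<sigma>\<in>cones \<Sigma> q. F_lower N \<Sigma> a \<sigma>)"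
  by (simp add: BM_chains_def additive_group_def)

lemma mem_BM_cycles_iff:
  "c \<in> carrier (BM_cycles N \<Sigma> a q) \<longleftrightarrow>
    c \<in> carrier (BM_chains N \<Sigma> a q) \<and> (\<forall>\<tau>\<in>cones \<Sigma> (q - 1). BM_boundary N \<Sigma> q c \<tau> = 0)"
  by (auto simp: BM_cycles_def kernel_def BM_chains_def additive_group_def BM_boundary_def fun_eq_iff)

lemma mult_BM_cycles: "x \<otimes>\<^bsub>BM_cycles N \<Sigma> a q\<^esub> y = (\<lambda>\<sigma>\<in>cones \<Sigma> q. x \<sigma> + y \<sigma>)"
  by (simp add: BM_cycles_def BM_chains_def additive_group_def)

lemma zero_mult_BM_cycles:
  assumes "c \<in> carrier (BM_cycles N \<Sigma> a q)"
  shows "(\<lambda>\<sigma>\<in>cones \<Sigma> q. 0) \<otimes>\<^bsub>BM_cycles N \<Sigma> a q\<^esub> c = c"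
  using assms unfolding mem_BM_cycles_iff carrier_BM_chains mult_BM_cycles
  by (auto simp: fun_eq_iff PiE_def extensional_def)

lemma zero_in_BM_boundaries: "(\<lambda>\<sigma>\<in>cones \<Sigma> q. 0) \<in> BM_boundaries N \<Sigma> a q"
  unfolding BM_boundaries_def
proof (rule image_eqI)
  show "(\<lambda>\<sigma>\<in>cones \<Sigma> (q + 1). 0) \<in> carrier (BM_chains N \<Sigma> a (q + 1))"
    by (simp add: carrier_BM_chains F_lower_def)
  have "int_scale k 0 = 0" for k :: int by (simp add: int_scale_real_scale)
  then show "(\<lambda>\<sigma>\<in>cones \<Sigma> q. 0) = BM_boundary N \<Sigma> (q + 1) (\<lambda>\<sigma>\<in>cones \<Sigma> (q + 1). 0)"
    unfolding BM_boundary_def by (auto intro!: restrict_ext sum.neutral[symmetric])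
qed

text \<open>The zero chain is a boundary, so \<open>c\<close> lies in its own coset; triviality
  identifies that coset with the boundaries.\<close>

lemma BM_cycle_is_boundary:
  assumes "trivial_group (BM_homology N \<Sigma> a q)" "c \<in> carrier (BM_cycles N \<Sigma> a q)"
  shows "c \<in> BM_boundaries N \<Sigma> a q"
proof -
  let ?G = "BM_cycles N \<Sigma> a q" and ?H = "BM_boundaries N \<Sigma> a q"
  have "?H #>\<^bsub>?G\<^esub> c \<in> carrier (?G Mod ?H)"
    using assms(2) by (auto simp: FactGroup_def RCOSETS_def)
  then have "?H #>\<^bsub>?G\<^esub> c = ?H"
    using assms(1) by (auto simp: trivial_group_def BM_homology_def FactGroup_def)
  moreover have "c \<in> ?H #>\<^bsub>?G\<^esub> c"
    unfolding r_coset_def using zero_in_BM_boundaries[of \<Sigma> q N a] zero_mult_BM_cycles[OF assms(2)]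
    by force
  ultimately show ?thesis by simp
qed

context fan
begin

lemma finite_cones [simp]: "finite {\<sigma>. \<sigma> \<in> cones \<Sigma> q \<and> P \<sigma>}"
  by (rule finite_subset[OF _ finite_fan]) (auto simp: cones_def)

lemma cones_mem: "\<sigma> \<in> cones \<Sigma> q \<Longrightarrow> \<sigma> \<in> \<Sigma>" by (simp add: cones_def)

lemma codim_1_face:
  assumes "\<sigma> \<in> cones \<Sigma> q" "\<tau> \<in> cones \<Sigma> (q - 1)" "\<tau> \<subseteq> \<sigma>"
  shows "codim_1_face N \<tau> \<sigma>"
  by unfold_locales (use assms N rational subset_face in \<open>auto simp: cones_def\<close>)

lemma BM_boundary_eq:
  assumes "\<tau> \<in> cones \<Sigma> (q - 1)"
  shows "BM_boundary N \<Sigma> q c \<tau> =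
    (\<Sum>\<sigma> | \<sigma> \<in> cones \<Sigma> q \<and> \<tau> \<subseteq> \<sigma>. int_scale (face_sign N \<tau> \<sigma>) (c \<sigma>))"
proof -
  have "{\<sigma>. \<sigma> \<in> cones \<Sigma> q \<and> \<tau> face_of \<sigma>} = {\<sigma>. \<sigma> \<in> cones \<Sigma> q \<and> \<tau> \<subseteq> \<sigma>}"
    using subset_face face_of_imp_subset assms unfolding cones_def by blast
  then show ?thesis using assms by (simp add: BM_boundary_def)
qed

text \<open>Moves a balancing condition from the quotient to the lifts, where it can be wedged with
  \<open>orient N \<tau>\<close>.\<close>

lemma sum_ray_gen_eq_0_iff:
  assumes "\<tau> \<in> cones \<Sigma> (q - 1)"
  shows "(\<Sum>\<sigma> | \<sigma> \<in> cones \<Sigma> q \<and> \<tau> \<subseteq> \<sigma>. h \<sigma> *\<^sub>R ray_gen N \<tau> \<sigma>) = 0 \<longleftrightarrow>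
    (\<Sum>\<sigma> | \<sigma> \<in> cones \<Sigma> q \<and> \<tau> \<subseteq> \<sigma>. h \<sigma> *\<^sub>R ray_lift N \<tau> \<sigma>) \<in> span \<tau>"
proof -
  have lin: "linear (quot_map (span \<tau>))" by (simp add: linear_quot_map)
  have "quot_map (span \<tau>) (\<Sum>\<sigma> | \<sigma> \<in> cones \<Sigma> q \<and> \<tau> \<subseteq> \<sigma>. h \<sigma> *\<^sub>R ray_lift N \<tau> \<sigma>) =
     (\<Sum>\<sigma> | \<sigma> \<in> cones \<Sigma> q \<and> \<tau> \<subseteq> \<sigma>. h \<sigma> *\<^sub>R ray_gen N \<tau> \<sigma>)"
    unfolding linear_sum[OF lin]
    by (rule sum.cong) (auto simp: linear_scale[OF lin] codim_1_face.ray_lift(2)[OF codim_1_face] assms)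
  then show ?thesis unfolding quot_map_eq_0_iff[OF subspace_span, symmetric] by simp
qed

lemma int_scale_face_sign_orient:
  assumes "\<sigma> \<in> cones \<Sigma> q" "\<tau> \<in> cones \<Sigma> (q - 1)" "\<tau> \<subseteq> \<sigma>"
  shows "int_scale (face_sign N \<tau> \<sigma>) (orient N \<sigma>) = ext_mult (ray_lift N \<tau> \<sigma>) (orient N \<tau>)"
  using codim_1_face.face_sign(1)[OF codim_1_face[OF assms]] by simp

lemma orient_basis_props:
  assumes "\<sigma> \<in> \<Sigma>"
  shows "lattice_basis (sublattice N \<sigma>) (orient_basis N \<sigma>)"
    "distinct (orient_basis N \<sigma>)" "independent (set (orient_basis N \<sigma>))"
    "group_closure (set (orient_basis N \<sigma>)) = sublattice N \<sigma>" "set (orient_basis N \<sigma>) \<subseteq> sublattice N \<sigma>"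
    "span (set (orient_basis N \<sigma>)) = span \<sigma>" "length (orient_basis N \<sigma>) = dim \<sigma>" "orient N \<sigma> \<noteq> 0"
  using orient_basis[OF N rational[OF assms]] lattice_basisD[OF orient_basis(1)[OF N rational[OF assms]]] by auto

lemma ext_power_subset_F_lower: "\<sigma> \<in> \<Sigma> \<Longrightarrow> ext_power a (sublattice N \<sigma>) \<subseteq> F_lower N \<Sigma> a \<sigma>"
  unfolding F_lower_def by (auto intro!: group_closure.base)

lemma orient_in_F_lower:
  assumes "\<sigma> \<in> cones \<Sigma> (int a)"
  shows "int_scale k (orient N \<sigma>) \<in> F_lower N \<Sigma> a \<sigma>"
proof -
  have \<sigma>: "\<sigma> \<in> \<Sigma>" "dim \<sigma> = a" using assms by (auto simp: cones_def)
  have "orient N \<sigma> \<in> ext_power a (sublattice N \<sigma>)"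
    using wedge_in_ext_power[OF orient_basis_props(5)[OF \<sigma>(1)]] orient_basis_props(7)[OF \<sigma>(1)] \<sigma>(2)
    by (simp add: orient_def)
  then have "orient N \<sigma> \<in> F_lower N \<Sigma> a \<sigma>" using ext_power_subset_F_lower[OF \<sigma>(1)] by blast
  then show ?thesis unfolding F_lower_def by (rule int_scale_in_group_closure)
qed

text \<open>By the definition of the sign, the boundary at \<open>\<tau>\<close> is the weighted sum
  of the lifts wedged with \<open>orient N \<tau>\<close>; balancing places that sum in
  \<open>span \<tau>\<close>. With \<open>q = d\<close> this serves weights on maximal cones, with
  \<open>q = d - 1\<close> divisors.\<close>

lemma weight_cycle:
  assumes "q = int a"
    and "\<And>\<tau>. \<tau> \<in> cones \<Sigma> (q - 1) \<Longrightarrow>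
      (\<Sum>\<sigma> | \<sigma> \<in> cones \<Sigma> q \<and> \<tau> \<subseteq> \<sigma>. of_int (m \<sigma>) *\<^sub>R ray_gen N \<tau> \<sigma>) = 0"
  shows "(\<lambda>\<sigma>\<in>cones \<Sigma> q. int_scale (m \<sigma>) (orient N \<sigma>)) \<in> carrier (BM_cycles N \<Sigma> a q)"
  unfolding mem_BM_cycles_iff
proof
  show "(\<lambda>\<sigma>\<in>cones \<Sigma> q. int_scale (m \<sigma>) (orient N \<sigma>)) \<in> carrier (BM_chains N \<Sigma> a q)"
    using orient_in_F_lower by (simp add: carrier_BM_chains assms(1))
  show "\<forall>\<tau>\<in>cones \<Sigma> (q - 1). BM_boundary N \<Sigma> q (\<lambda>\<sigma>\<in>cones \<Sigma> q. int_scale (m \<sigma>) (orient N \<sigma>)) \<tau> = 0"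
  proof
    fix \<tau> assume \<tau>: "\<tau> \<in> cones \<Sigma> (q - 1)"
    have "BM_boundary N \<Sigma> q (\<lambda>\<sigma>\<in>cones \<Sigma> q. int_scale (m \<sigma>) (orient N \<sigma>)) \<tau> =
       (\<Sum>\<sigma> | \<sigma> \<in> cones \<Sigma> q \<and> \<tau> \<subseteq> \<sigma>. ext_mult (of_int (m \<sigma>) *\<^sub>R ray_lift N \<tau> \<sigma>) (orient N \<tau>))"
      unfolding BM_boundary_eq[OF \<tau>]
    proof (rule sum.cong[OF refl])
      fix \<sigma> assume \<sigma>: "\<sigma> \<in> {\<sigma>. \<sigma> \<in> cones \<Sigma> q \<and> \<tau> \<subseteq> \<sigma>}"
      have "int_scale (face_sign N \<tau> \<sigma>) (int_scale (m \<sigma>) (orient N \<sigma>)) =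
         real_scale (of_int (m \<sigma>)) (int_scale (face_sign N \<tau> \<sigma>) (orient N \<sigma>))"
        by (simp add: int_scale_real_scale mult.commute)
      also have "\<dots> = ext_mult (of_int (m \<sigma>) *\<^sub>R ray_lift N \<tau> \<sigma>) (orient N \<tau>)"
        using \<sigma> int_scale_face_sign_orient[OF _ \<tau>, of \<sigma>] by (simp add: ext_mult_linear)
      finally show "int_scale (face_sign N \<tau> \<sigma>) ((\<lambda>\<sigma>\<in>cones \<Sigma> q. int_scale (m \<sigma>) (orient N \<sigma>)) \<sigma>) =
          ext_mult (of_int (m \<sigma>) *\<^sub>R ray_lift N \<tau> \<sigma>) (orient N \<tau>)"
        using \<sigma> by simp
    qed
    also have "\<dots> = ext_mult (\<Sum>\<sigma> | \<sigma> \<in> cones \<Sigma> q \<and> \<tau> \<subseteq> \<sigma>. of_int (m \<sigma>) *\<^sub>R ray_lift N \<tau> \<sigma>) (orient N \<tau>)"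
      by (simp add: ext_mult_sum)
    also have "\<dots> = 0"
      unfolding orient_def
      by (rule ext_mult_wedge_span)
        (use sum_ray_gen_eq_0_iff[OF \<tau>] assms(2)[OF \<tau>] orient_basis_props(6)[OF cones_mem[OF \<tau>]] in simp)
    finally show "BM_boundary N \<Sigma> q (\<lambda>\<sigma>\<in>cones \<Sigma> q. int_scale (m \<sigma>) (orient N \<sigma>)) \<tau> = 0" .
  qed
qed

end

section \<open>Duality in the top degree\<close>

context tropical
begin

text \<open>There are no cones of dimension \<open>d + 1\<close>, so the only boundary is zero and
  an equality of classes is an equality of chains.\<close>

lemma cap_fundamental_surj:
  assumes "poincare_duality N d \<Sigma>" "a \<le> d" "c \<in> carrier (BM_cycles N \<Sigma> (d - a) (int d))"
  shows "\<exists>\<alpha>\<in>carrier (F_upper N \<Sigma> a {0}). \<forall>\<sigma>\<in>cones \<Sigma> (int d). c \<sigma> = contraction a \<alpha> (orient_basis N \<sigma>)"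
proof -
  let ?G = "BM_cycles N \<Sigma> (d - a) (int d)" and ?H = "BM_boundaries N \<Sigma> (d - a) (int d)"
  have "cones \<Sigma> (int d + 1) = {}"
    using dim_le unfolding cones_def by fastforce
  then have H: "?H = {\<lambda>\<sigma>\<in>cones \<Sigma> (int d). 0}"
    by (auto simp: BM_boundaries_def BM_boundary_def carrier_BM_chains)
  have "?H #>\<^bsub>?G\<^esub> c \<in> carrier (BM_homology N \<Sigma> (d - a) (int d))"
    using assms(3) by (auto simp: BM_homology_def FactGroup_def RCOSETS_def)
  moreover have "cap_fundamental N d \<Sigma> a ` carrier (F_upper N \<Sigma> a {0}) = carrier (BM_homology N \<Sigma> (d - a) (int d))"
    using assms(1,2) by (auto simp: poincare_duality_def iso_def bij_betw_def)
  ultimately have "?H #>\<^bsub>?G\<^esub> c \<in> cap_fundamental N d \<Sigma> a ` carrier (F_upper N \<Sigma> a {0})" by simp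
  then obtain \<alpha> where \<alpha>: "\<alpha> \<in> carrier (F_upper N \<Sigma> a {0})"
    "?H #>\<^bsub>?G\<^esub> c = cap_fundamental N d \<Sigma> a \<alpha>" by (rule imageE)
  have "c \<in> ?H #>\<^bsub>?G\<^esub> c" using zero_mult_BM_cycles[OF assms(3)] by (simp add: H r_coset_def)
  then have "c \<in> ?H #>\<^bsub>?G\<^esub> (\<lambda>\<sigma>\<in>cones \<Sigma> (int d). contraction a \<alpha> (orient_basis N \<sigma>))"
    by (simp only: \<alpha>(2) cap_fundamental_def)
  then have "c = (\<lambda>\<sigma>\<in>cones \<Sigma> (int d). 0) \<otimes>\<^bsub>?G\<^esub>
      (\<lambda>\<sigma>\<in>cones \<Sigma> (int d). contraction a \<alpha> (orient_basis N \<sigma>))"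
    unfolding H r_coset_def by simp
  then have "c \<sigma> = contraction a \<alpha> (orient_basis N \<sigma>)" if "\<sigma> \<in> cones \<Sigma> (int d)" for \<sigma>
    using that by (simp add: mult_BM_cycles)
  then show ?thesis using \<alpha>(1) by blast
qed

text \<open>For \<open>p = 0\<close> contraction multiplies every orientation by the same integer,
  the value of \<open>\<alpha>\<close> at the empty wedge.\<close>

lemma balanced_weight_constant:
  assumes "poincare_duality N d \<Sigma>"
    and "\<And>\<tau>. \<tau> \<in> cones \<Sigma> (int d - 1) \<Longrightarrow>
      (\<Sum>\<sigma> | \<sigma> \<in> cones \<Sigma> (int d) \<and> \<tau> \<subseteq> \<sigma>. of_int (m \<sigma>) *\<^sub>R ray_gen N \<tau> \<sigma>) = 0"
    and "\<sigma> \<in> cones \<Sigma> (int d)" "\<sigma>' \<in> cones \<Sigma> (int d)"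
  shows "m \<sigma> = m \<sigma>'"
proof -
  have "(\<lambda>\<sigma>\<in>cones \<Sigma> (int d). int_scale (m \<sigma>) (orient N \<sigma>)) \<in> carrier (BM_cycles N \<Sigma> (d - 0) (int d))"
    using weight_cycle[of "int d" d m] assms(2) by simp
  from cap_fundamental_surj[OF assms(1) _ this] obtain \<alpha> where
    \<alpha>: "\<And>\<sigma>. \<sigma> \<in> cones \<Sigma> (int d) \<Longrightarrow> int_scale (m \<sigma>) (orient N \<sigma>) = contraction 0 \<alpha> (orient_basis N \<sigma>)"
    by auto
  have "m \<sigma> = \<alpha> (wedge [])" if "\<sigma> \<in> cones \<Sigma> (int d)" for \<sigma>
  proof -
    have "real_scale (of_int (m \<sigma>) - of_int (\<alpha> (wedge []))) (orient N \<sigma>) = 0"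
      using \<alpha>[OF that] by (simp add: contraction_0 orient_def int_scale_real_scale real_scale_linear)
    then show ?thesis using orient_basis_props(8)[OF cones_mem[OF that]] by (simp add: real_scale_eq_0_iff)
  qed
  then show ?thesis using assms(3,4) by simp
qed

end

context tropical_star
begin

lemma balanced_weight_constant_star:
  assumes "smooth_fan N d \<Sigma>"
    and bal: "\<And>\<tau>. \<tau> \<in> cones \<Sigma> (int d - 1) \<Longrightarrow> \<eta> \<subseteq> \<tau> \<Longrightarrow>
      (\<Sum>\<sigma> | \<sigma> \<in> cones \<Sigma> (int d) \<and> \<tau> \<subseteq> \<sigma>. of_int (m \<sigma>) *\<^sub>R ray_gen N \<tau> \<sigma>) = 0"
    and \<sigma>: "\<sigma> \<in> cones \<Sigma> (int d)" "\<eta> \<subseteq> \<sigma>" and \<sigma>': "\<sigma>' \<in> cones \<Sigma> (int d)" "\<eta> \<subseteq> \<sigma>'"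
  shows "m \<sigma> = m \<sigma>'"
proof -
  \<comment> \<open>The weight is transported along the bijection between the cones containing
    \<open>\<eta>\<close> and the cones of the star.\<close>
  define m' where "m' s = m (inv_into {\<zeta> \<in> \<Sigma>. \<eta> \<subseteq> \<zeta>} ((`) p) s)" for s
  have inj: "inj_on ((`) p) {\<zeta> \<in> \<Sigma>. \<eta> \<subseteq> \<zeta>}" using p_image_inj by (auto simp: inj_on_def)
  have m': "m' (p ` \<zeta>) = m \<zeta>" if "\<zeta> \<in> \<Sigma>" "\<eta> \<subseteq> \<zeta>" for \<zeta>
    using that inv_into_f_f[OF inj, of \<zeta>] by (simp add: m'_def)
  have cones_d: "\<zeta> \<in> cones \<Sigma> (int d) \<Longrightarrow> \<eta> \<subseteq> \<zeta> \<Longrightarrow> p ` \<zeta> \<in> cones (star_fan \<Sigma> \<eta>) (int (d - dim \<eta>))" for \<zeta>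
    by (auto simp: cones_star int_dim_diff)
  have "poincare_duality (quot_lattice N \<eta>) (d - dim \<eta>) (star_fan \<Sigma> \<eta>)"
    using assms(1) \<eta> by (simp add: smooth_fan_def)
  moreover have "(\<Sum>\<sigma> | \<sigma> \<in> cones (star_fan \<Sigma> \<eta>) (int (d - dim \<eta>)) \<and> \<tau> \<subseteq> \<sigma>.
      of_int (m' \<sigma>) *\<^sub>R ray_gen (quot_lattice N \<eta>) \<tau> \<sigma>) = 0"
    if \<tau>: "\<tau> \<in> cones (star_fan \<Sigma> \<eta>) (int (d - dim \<eta>) - 1)" for \<tau>
  proof -
    have "int (d - dim \<eta>) - 1 + int (dim \<eta>) = int d - 1" by (simp add: int_dim_diff)
    then obtain \<theta> where \<theta>: "\<theta> \<in> cones \<Sigma> (int d - 1)" "\<eta> \<subseteq> \<theta>" "\<tau> = p ` \<theta>"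
      using \<tau> unfolding cones_star by auto
    have "\<theta> \<in> \<Sigma>" using \<theta>(1) by (simp add: cones_def)
    have "(\<Sum>\<sigma> | \<sigma> \<in> cones (star_fan \<Sigma> \<eta>) (int (d - dim \<eta>)) \<and> \<tau> \<subseteq> \<sigma>.
        of_int (m' \<sigma>) *\<^sub>R ray_gen (quot_lattice N \<eta>) \<tau> \<sigma>)
       = (\<Sum>\<sigma> | \<sigma> \<in> cones \<Sigma> (int d) \<and> \<theta> \<subseteq> \<sigma>. of_int (m \<sigma>) *\<^sub>R ray_gen N \<theta> \<sigma>)"
      unfolding \<theta>(3) sum_cones_star[OF \<open>\<theta> \<in> \<Sigma>\<close> \<theta>(2)]
    proof (rule sum.cong)
      fix \<sigma> assume "\<sigma> \<in> {\<sigma>. \<sigma> \<in> cones \<Sigma> (int d) \<and> \<theta> \<subseteq> \<sigma>}"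
      then have "\<sigma> \<in> \<Sigma>" "\<theta> \<subseteq> \<sigma>" "\<eta> \<subseteq> \<sigma>" using \<theta>(2) by (auto simp: cones_def)
      then show "of_int (m' (p ` \<sigma>)) *\<^sub>R ray_gen (quot_lattice N \<eta>) (p ` \<theta>) (p ` \<sigma>) =
          of_int (m \<sigma>) *\<^sub>R ray_gen N \<theta> \<sigma>"
        by (simp add: m' ray_gen_star[OF \<theta>(2)])
    qed (simp add: int_dim_diff)
    then show ?thesis using bal \<theta> by simp
  qed
  ultimately have "m' (p ` \<sigma>) = m' (p ` \<sigma>')"
    using cones_d \<sigma> \<sigma>' by (intro tropical.balanced_weight_constant[OF tropical_star]) auto
  then show ?thesis using m' \<sigma> \<sigma>' cones_mem by simp
qed

end

section \<open>Divisors of conewise linear functions\<close>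

context tropical
begin

text \<open>The sign turns the orientation of \<open>\<sigma>\<close> into the lift wedged with that
  of \<open>\<tau>\<close>, and the Leibniz rule applies. Nothing is assumed here about the
  agreement of the forms.\<close>

lemma boundary_interior_mult:
  assumes "\<tau> \<in> cones \<Sigma> (int d - 1)"
  shows "(\<Sum>\<sigma> | \<sigma> \<in> cones \<Sigma> (int d) \<and> \<tau> \<subseteq> \<sigma>. int_scale (face_sign N \<tau> \<sigma>) (interior_mult (u \<sigma>) (orient N \<sigma>))) =
    (\<Sum>\<sigma> | \<sigma> \<in> cones \<Sigma> (int d) \<and> \<tau> \<subseteq> \<sigma>. real_scale (u \<sigma> \<bullet> ray_lift N \<tau> \<sigma>) (orient N \<tau>)
       - ext_mult (ray_lift N \<tau> \<sigma>) (interior_mult (u \<sigma>) (orient N \<tau>)))"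
proof (rule sum.cong[OF refl])
  fix \<sigma> assume "\<sigma> \<in> {\<sigma>. \<sigma> \<in> cones \<Sigma> (int d) \<and> \<tau> \<subseteq> \<sigma>}"
  then have "int_scale (face_sign N \<tau> \<sigma>) (interior_mult (u \<sigma>) (orient N \<sigma>)) =
      interior_mult (u \<sigma>) (ext_mult (ray_lift N \<tau> \<sigma>) (orient N \<tau>))"
    using int_scale_face_sign_orient[of \<sigma> "int d" \<tau>] assms
    by (simp add: int_scale_real_scale interior_mult_linear[symmetric])
  then show "int_scale (face_sign N \<tau> \<sigma>) (interior_mult (u \<sigma>) (orient N \<sigma>)) =
      real_scale (u \<sigma> \<bullet> ray_lift N \<tau> \<sigma>) (orient N \<tau>)
       - ext_mult (ray_lift N \<tau> \<sigma>) (interior_mult (u \<sigma>) (orient N \<tau>))"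
    by (simp add: interior_mult_ext_mult)
qed

lemma sum_ray_lift_in_span:
  assumes "\<tau> \<in> cones \<Sigma> (int d - 1)"
  shows "(\<Sum>\<sigma> | \<sigma> \<in> cones \<Sigma> (int d) \<and> \<tau> \<subseteq> \<sigma>. ray_lift N \<tau> \<sigma>) \<in> span \<tau>"
  using sum_ray_gen_eq_0_iff[OF assms, of "\<lambda>_. 1"] balanced[OF assms] by simp

text \<open>Agreement on \<open>span \<tau>\<close> makes the contracted factor common to all
  summands, so that the lifts add up inside the wedge. By balancing their sum is in
  \<open>span \<tau>\<close>, which turns that term into a multiple of the orientation; the total
  factor is minus the order along \<open>\<tau>\<close>.\<close>

lemma boundary_interior_mult_agree:
  assumes \<tau>: "\<tau> \<in> cones \<Sigma> (int d - 1)"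
    and agree: "\<And>\<sigma> x. \<sigma> \<in> cones \<Sigma> (int d) \<Longrightarrow> \<tau> \<subseteq> \<sigma> \<Longrightarrow> x \<in> span \<tau> \<Longrightarrow> u \<sigma> \<bullet> x = u' \<bullet> x"
  shows "(\<Sum>\<sigma> | \<sigma> \<in> cones \<Sigma> (int d) \<and> \<tau> \<subseteq> \<sigma>. int_scale (face_sign N \<tau> \<sigma>) (interior_mult (u \<sigma>) (orient N \<sigma>))) =
    real_scale ((\<Sum>\<sigma> | \<sigma> \<in> cones \<Sigma> (int d) \<and> \<tau> \<subseteq> \<sigma>. u \<sigma> \<bullet> ray_lift N \<tau> \<sigma>)
      - u' \<bullet> (\<Sum>\<sigma> | \<sigma> \<in> cones \<Sigma> (int d) \<and> \<tau> \<subseteq> \<sigma>. ray_lift N \<tau> \<sigma>)) (orient N \<tau>)"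
proof -
  note B = orient_basis_props[OF cones_mem[OF \<tau>]]
  let ?S = "{\<sigma>. \<sigma> \<in> cones \<Sigma> (int d) \<and> \<tau> \<subseteq> \<sigma>}"
  have "interior_mult (u \<sigma>) (orient N \<tau>) = interior_mult u' (orient N \<tau>)" if "\<sigma> \<in> ?S" for \<sigma>
    unfolding orient_def
    by (rule interior_mult_wedge_cong) (use agree that B(6) span_base in blast)
  then have "(\<Sum>\<sigma>\<in>?S. ext_mult (ray_lift N \<tau> \<sigma>) (interior_mult (u \<sigma>) (orient N \<tau>))) =
     ext_mult (\<Sum>\<sigma>\<in>?S. ray_lift N \<tau> \<sigma>) (interior_mult u' (orient N \<tau>))"
    by (simp add: ext_mult_sum)
  also have "\<dots> = real_scale (u' \<bullet> (\<Sum>\<sigma>\<in>?S. ray_lift N \<tau> \<sigma>)) (orient N \<tau>)"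
    unfolding orient_def
    by (rule ext_mult_interior_mult_wedge) (use sum_ray_lift_in_span[OF \<tau>] B(6) in simp)
  finally show ?thesis
    unfolding boundary_interior_mult[OF \<tau>]
    by (simp add: sum_subtractf real_scale_sum[symmetric] real_scale_linear)
qed

lemma F_lower_top:
  assumes "\<sigma> \<in> cones \<Sigma> (int d)"
  shows "F_lower N \<Sigma> a \<sigma> = ext_power a (sublattice N \<sigma>)"
proof -
  have "{\<eta> \<in> \<Sigma>. \<sigma> \<subseteq> \<eta>} = {\<sigma>}"
    using top_cone_maximal assms unfolding cones_def by auto
  then show ?thesis unfolding F_lower_def by (simp add: ext_power_def group_closure_idem)
qed

text \<open>Wedging the boundary equation with \<open>v \<in> N\<^sub>\<tau>\<close> leaves \<open>(\<Sum> u\<^sub>\<sigma>(v) n\<^sub>\<sigma>) \<and> \<nu>\<^sub>\<tau> = 0\<close>, so that \<open>\<sigma> \<mapsto> u\<^sub>\<sigma>(v)\<close> is a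
  balanced weight on the star of \<open>\<tau>\<close>.\<close>

lemma integral_form_agree:
  assumes smooth: "smooth_fan N d \<Sigma>"
    and int: "\<And>\<sigma> x. \<sigma> \<in> cones \<Sigma> (int d) \<Longrightarrow> x \<in> sublattice N \<sigma> \<Longrightarrow> u \<sigma> \<bullet> x \<in> \<int>"
    and \<tau>: "\<tau> \<in> cones \<Sigma> (int d - 1)"
    and bdry: "(\<Sum>\<sigma> | \<sigma> \<in> cones \<Sigma> (int d) \<and> \<tau> \<subseteq> \<sigma>. int_scale (face_sign N \<tau> \<sigma>) (interior_mult (u \<sigma>) (orient N \<sigma>))) =
      int_scale k (orient N \<tau>)"
    and \<sigma>: "\<sigma> \<in> cones \<Sigma> (int d)" "\<tau> \<subseteq> \<sigma>" and \<sigma>': "\<sigma>' \<in> cones \<Sigma> (int d)" "\<tau> \<subseteq> \<sigma>'"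
    and x: "x \<in> span \<tau>"
  shows "u \<sigma> \<bullet> x = u \<sigma>' \<bullet> x"
proof -
  note B = orient_basis_props[OF cones_mem[OF \<tau>]]
  let ?S = "{\<sigma>. \<sigma> \<in> cones \<Sigma> (int d) \<and> \<tau> \<subseteq> \<sigma>}"
  have eq: "u \<sigma> \<bullet> v = u \<sigma>' \<bullet> v" if v: "v \<in> set (orient_basis N \<tau>)" for v
  proof -
    have v\<tau>: "v \<in> span (set (orient_basis N \<tau>))" using v by (rule span_base)
    have ev: "ext_mult v (orient N \<tau>) = 0" unfolding orient_def by (rule ext_mult_wedge_span[OF v\<tau>])
    \<comment> \<open>Weights are integer valued by definition; around \<open>\<tau>\<close> the
      floor is exact because \<open>v\<close> lies in \<open>N\<^sub>\<sigma>\<close>.\<close>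
    define m where "m \<sigma> = \<lfloor>u \<sigma> \<bullet> v\<rfloor>" for \<sigma>
    have m: "of_int (m \<sigma>) = u \<sigma> \<bullet> v" if "\<sigma> \<in> ?S" for \<sigma>
    proof -
      have "v \<in> sublattice N \<sigma>" using B(5) v that span_mono[of \<tau> \<sigma>] by (auto simp: sublattice_def)
      then show ?thesis using int[of \<sigma> v] that by (auto simp: m_def elim: Ints_cases)
    qed
    \<comment> \<open>The scalar part dies because \<open>v\<close> is in
      \<open>span \<tau>\<close>. In the other part \<open>v\<close> passes \<open>n\<close>, and
      its sign cancels the minus sign.\<close>
    have "ext_mult v (real_scale r (orient N \<tau>) - ext_mult n (interior_mult w (orient N \<tau>))) =
       ext_mult ((w \<bullet> v) *\<^sub>R n) (orient N \<tau>)" for n w r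
    proof -
      have "ext_mult v (ext_mult n (interior_mult w (orient N \<tau>))) =
          - ext_mult n (ext_mult v (interior_mult w (orient N \<tau>)))" by (rule ext_mult_anticommute)
      also have "ext_mult v (interior_mult w (orient N \<tau>)) = real_scale (w \<bullet> v) (orient N \<tau>)"
        unfolding orient_def by (rule ext_mult_interior_mult_wedge[OF v\<tau>])
      finally show ?thesis by (simp add: ext_mult_linear ev)
    qed
    then have "ext_mult v (\<Sum>\<sigma>\<in>?S. int_scale (face_sign N \<tau> \<sigma>) (interior_mult (u \<sigma>) (orient N \<sigma>))) =
        ext_mult (\<Sum>\<sigma>\<in>?S. (u \<sigma> \<bullet> v) *\<^sub>R ray_lift N \<tau> \<sigma>) (orient N \<tau>)"
      unfolding boundary_interior_mult[OF \<tau>] ext_mult_sum by simp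
    moreover have "ext_mult v (int_scale k (orient N \<tau>)) = 0"
      by (simp add: int_scale_real_scale ext_mult_linear ev)
    ultimately have "ext_mult (\<Sum>\<sigma>\<in>?S. (u \<sigma> \<bullet> v) *\<^sub>R ray_lift N \<tau> \<sigma>) (orient N \<tau>) = 0"
      unfolding bdry by simp
    then have "(\<Sum>\<sigma>\<in>?S. (u \<sigma> \<bullet> v) *\<^sub>R ray_lift N \<tau> \<sigma>) \<in> span \<tau>"
      unfolding orient_def ext_mult_wedge_eq_0_iff[OF B(2,3)] B(6) .
    then have "(\<Sum>\<sigma>\<in>?S. (u \<sigma> \<bullet> v) *\<^sub>R ray_gen N \<tau> \<sigma>) = 0"
      using sum_ray_gen_eq_0_iff[OF \<tau>, of "\<lambda>\<sigma>. u \<sigma> \<bullet> v"] by simp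
    then have bal: "(\<Sum>\<sigma>\<in>?S. of_int (m \<sigma>) *\<^sub>R ray_gen N \<tau> \<sigma>) = 0" by (simp add: m)
    interpret tropical_star N \<Sigma> d \<tau> by unfold_locales (rule cones_mem[OF \<tau>])
    have "m \<sigma> = m \<sigma>'"
    proof (rule balanced_weight_constant_star[OF smooth _ \<sigma> \<sigma>'])
      \<comment> \<open>The star of \<open>\<tau>\<close> is one-dimensional: \<open>\<tau>\<close>
        is its only cone of codimension one.\<close>
      fix \<tau>' assume \<tau>': "\<tau>' \<in> cones \<Sigma> (int d - 1)" "\<tau> \<subseteq> \<tau>'"
      then have "\<tau>' = \<tau>" using dim_eq_imp_eq[of \<tau>' \<tau>] \<tau> by (simp add: cones_def)
      then show "(\<Sum>\<sigma> | \<sigma> \<in> cones \<Sigma> (int d) \<and> \<tau>' \<subseteq> \<sigma>. of_int (m \<sigma>) *\<^sub>R ray_gen N \<tau>' \<sigma>) = 0" using bal by simp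
    qed
    then show ?thesis using m \<sigma> \<sigma>' by (metis (mono_tags, lifting) mem_Collect_eq)
  qed
  have "(u \<sigma> - u \<sigma>') \<bullet> x = 0"
  proof -
    have "x \<in> span (set (orient_basis N \<tau>))" using x B(6) by simp
    then show ?thesis
      by (induction rule: span_induct) (auto simp: subspace_def inner_add_right eq inner_diff_left)
  qed
  then show ?thesis by (simp add: inner_diff_left)
qed

text \<open>The indicator function of the \<open>\<zeta>\<close> with \<open>u\<^sub>\<zeta>(x) = u\<^sub>\<sigma>(x)\<close> is a balanced weight on the star of
  \<open>\<sigma> \<inter> \<sigma>'\<close>; this takes the place of connectedness in codimension one.\<close>

lemma forms_glue:
  assumes smooth: "smooth_fan N d \<Sigma>"
    and agree: "\<And>\<tau> \<sigma> \<sigma>' x. \<tau> \<in> cones \<Sigma> (int d - 1) \<Longrightarrow> \<sigma> \<in> cones \<Sigma> (int d) \<Longrightarrow> \<sigma>' \<in> cones \<Sigma> (int d) \<Longrightarrow>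
      \<tau> \<subseteq> \<sigma> \<Longrightarrow> \<tau> \<subseteq> \<sigma>' \<Longrightarrow> x \<in> span \<tau> \<Longrightarrow> u \<sigma> \<bullet> x = u \<sigma>' \<bullet> x"
    and \<sigma>: "\<sigma> \<in> cones \<Sigma> (int d)" "\<sigma>' \<in> cones \<Sigma> (int d)" and x: "x \<in> \<sigma> \<inter> \<sigma>'"
  shows "u \<sigma> \<bullet> x = u \<sigma>' \<bullet> x"
proof -
  define m :: "'a set \<Rightarrow> int" where "m \<zeta> = (if u \<zeta> \<bullet> x = u \<sigma> \<bullet> x then 1 else 0)" for \<zeta>
  interpret tropical_star N \<Sigma> d "\<sigma> \<inter> \<sigma>'" by unfold_locales (use Int_mem cones_mem \<sigma> in blast)
  have "m \<sigma> = m \<sigma>'"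
  proof (rule balanced_weight_constant_star[OF smooth])
    fix \<tau> assume \<tau>: "\<tau> \<in> cones \<Sigma> (int d - 1)" "\<sigma> \<inter> \<sigma>' \<subseteq> \<tau>"
    let ?S = "{\<sigma>. \<sigma> \<in> cones \<Sigma> (int d) \<and> \<tau> \<subseteq> \<sigma>}"
    \<comment> \<open>All forms around \<open>\<tau>\<close> have the same value at
      \<open>x\<close>, so the weight is constant there and balanced because the fan is.\<close>
    have "x \<in> span \<tau>" using x \<tau>(2) by (auto intro: span_base)
    have eq: "m \<zeta> = m \<zeta>'" if "\<zeta> \<in> ?S" "\<zeta>' \<in> ?S" for \<zeta> \<zeta>'
    proof -
      have "u \<zeta> \<bullet> x = u \<zeta>' \<bullet> x" using agree[OF \<tau>(1), of \<zeta> \<zeta>' x] that \<open>x \<in> span \<tau>\<close> by blast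
      then show ?thesis by (simp only: m_def)
    qed
    have "\<exists>k. \<forall>\<zeta>\<in>?S. m \<zeta> = k"
    proof (cases "?S = {}")
      case False
      then obtain \<zeta>0 where "\<zeta>0 \<in> ?S" by blast
      then show ?thesis using eq by blast
    qed blast
    then obtain k where "\<And>\<zeta>. \<zeta> \<in> ?S \<Longrightarrow> m \<zeta> = k" by blast
    then have "(\<Sum>\<zeta>\<in>?S. of_int (m \<zeta>) *\<^sub>R ray_gen N \<tau> \<zeta>) = (\<Sum>\<zeta>\<in>?S. of_int k *\<^sub>R ray_gen N \<tau> \<zeta>)"
      by (intro sum.cong) auto
    also have "\<dots> = 0" using balanced[OF \<tau>(1)] by (simp add: scaleR_sum_right[symmetric])
    finally show "(\<Sum>\<zeta>\<in>?S. of_int (m \<zeta>) *\<^sub>R ray_gen N \<tau> \<zeta>) = 0" .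
  qed (use \<sigma> in auto)
  then show ?thesis by (auto simp: m_def split: if_splits)
qed

section \<open>Principality and div-faithfulness of the fan itself\<close>

lemma cone_form_represents:
  assumes "conewise_integral_linear N \<Sigma> f" "\<sigma> \<in> \<Sigma>"
  shows "represents_on N \<sigma> f (cone_form N f \<sigma>)"
  using assms unfolding conewise_integral_linear_def cone_form_def by (metis someI_ex)

lemma principal_divisorI:
  assumes pd: "poincare_duality N d \<Sigma>" and smooth: "smooth_fan N d \<Sigma>" and w: "divisor N d \<Sigma> w"
  shows "principal_divisor N d \<Sigma> w"
proof (cases "d = 0")
  case True
  \<comment> \<open>In dimension zero there are no cones of codimension one, so the divisor
    condition is vacuous; the degree \<open>d - 1\<close> used below presupposes positive
    \<open>d\<close>.\<close>
  have "conewise_integral_linear N \<Sigma> (\<lambda>_. 0)"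
    by (auto simp: conewise_integral_linear_def represents_on_def intro!: exI[of _ "\<lambda>_. 0"] linear_zero)
  moreover have "is_div N d \<Sigma> (\<lambda>_. 0) w" using True by (simp add: is_div_def cones_def)
  ultimately show ?thesis by (auto simp: principal_divisor_def)
next
  case False
  then have d1: "int d - 1 = int (d - 1)" by simp
  \<comment> \<open>The sign matches the boundary of a family of forms, which is minus its order
    along \<open>\<tau>\<close>.\<close>
  define c where "c = (\<lambda>\<tau>\<in>cones \<Sigma> (int d - 1). int_scale (- w \<tau>) (orient N \<tau>))"
  have "c \<in> carrier (BM_cycles N \<Sigma> (d - 1) (int d - 1))"
    unfolding c_def
  proof (rule weight_cycle[OF d1])
    fix \<eta> assume "\<eta> \<in> cones \<Sigma> (int d - 1 - 1)"
    then have "(\<Sum>\<tau> | \<tau> \<in> cones \<Sigma> (int d - 1) \<and> \<eta> \<subseteq> \<tau>. of_int (w \<tau>) *\<^sub>R ray_gen N \<eta> \<tau>) = 0"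
      using w by (simp add: divisor_def)
    then show "(\<Sum>\<tau> | \<tau> \<in> cones \<Sigma> (int d - 1) \<and> \<eta> \<subseteq> \<tau>. of_int (- w \<tau>) *\<^sub>R ray_gen N \<eta> \<tau>) = 0"
      by (simp add: sum_negf)
  qed
  moreover have "trivial_group (BM_homology N \<Sigma> (d - 1) (int d - 1))"
    using pd by (simp add: poincare_duality_def)
  ultimately have "c \<in> BM_boundaries N \<Sigma> (d - 1) (int d - 1)" by (rule BM_cycle_is_boundary[rotated])
  then obtain c' where c': "c' \<in> carrier (BM_chains N \<Sigma> (d - 1) (int d))" "c = BM_boundary N \<Sigma> (int d) c'"
    by (auto simp: BM_boundaries_def)
  \<comment> \<open>No other cone contains a maximal one, so \<open>c' \<sigma>\<close> lies in an
    exterior power of \<open>N\<^sub>\<sigma>\<close> alone, of corank one, where all elements are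
    contractions.\<close>
  have "\<exists>u. (\<forall>v\<in>set (orient_basis N \<sigma>). u \<bullet> v \<in> \<int>) \<and> c' \<sigma> = interior_mult u (orient N \<sigma>)"
    if \<sigma>: "\<sigma> \<in> cones \<Sigma> (int d)" for \<sigma>
  proof -
    note B = orient_basis_props[OF cones_mem[OF \<sigma>]]
    have "c' \<sigma> \<in> ext_power (d - 1) (sublattice N \<sigma>)"
      using c'(1) \<sigma> F_lower_top[OF \<sigma>] by (auto simp: carrier_BM_chains)
    then have "c' \<sigma> \<in> lattice_ext (orient_basis N \<sigma>) (d - 1)"
      using ext_power_subset_lattice_ext[of "d - 1" "orient_basis N \<sigma>"] B(4) by auto
    moreover have "length (orient_basis N \<sigma>) = Suc (d - 1)" using B(7) \<sigma> False by (simp add: cones_def)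
    ultimately show ?thesis unfolding orient_def using lattice_ext_corank_1[OF B(2,3)] by blast
  qed
  then obtain u where u: "\<And>\<sigma> v. \<sigma> \<in> cones \<Sigma> (int d) \<Longrightarrow> v \<in> set (orient_basis N \<sigma>) \<Longrightarrow> u \<sigma> \<bullet> v \<in> \<int>"
    "\<And>\<sigma>. \<sigma> \<in> cones \<Sigma> (int d) \<Longrightarrow> c' \<sigma> = interior_mult (u \<sigma>) (orient N \<sigma>)"
    by metis
  have int: "u \<sigma> \<bullet> x \<in> \<int>" if \<sigma>: "\<sigma> \<in> cones \<Sigma> (int d)" and x: "x \<in> sublattice N \<sigma>" for \<sigma> x
  proof -
    have "x \<in> group_closure (set (orient_basis N \<sigma>))"
      using x orient_basis_props(4)[OF cones_mem[OF \<sigma>]] by simp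
    then show ?thesis by induction (use u(1)[OF \<sigma>] in \<open>auto simp: inner_diff_right\<close>)
  qed
  have bdry: "(\<Sum>\<sigma> | \<sigma> \<in> cones \<Sigma> (int d) \<and> \<tau> \<subseteq> \<sigma>. int_scale (face_sign N \<tau> \<sigma>) (interior_mult (u \<sigma>) (orient N \<sigma>))) =
      int_scale (- w \<tau>) (orient N \<tau>)" if \<tau>: "\<tau> \<in> cones \<Sigma> (int d - 1)" for \<tau>
  proof -
    have "int_scale (- w \<tau>) (orient N \<tau>) = BM_boundary N \<Sigma> (int d) c' \<tau>"
      using \<tau> by (simp add: c'(2)[symmetric] c_def)
    also have "\<dots> = (\<Sum>\<sigma> | \<sigma> \<in> cones \<Sigma> (int d) \<and> \<tau> \<subseteq> \<sigma>. int_scale (face_sign N \<tau> \<sigma>) (interior_mult (u \<sigma>) (orient N \<sigma>)))"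
      unfolding BM_boundary_eq[OF \<tau>] by (rule sum.cong) (auto simp: u(2))
    finally show ?thesis by simp
  qed
  have agree: "u \<sigma> \<bullet> x = u \<sigma>' \<bullet> x"
    if "\<tau> \<in> cones \<Sigma> (int d - 1)" "\<sigma> \<in> cones \<Sigma> (int d)" "\<sigma>' \<in> cones \<Sigma> (int d)" "\<tau> \<subseteq> \<sigma>" "\<tau> \<subseteq> \<sigma>'" "x \<in> span \<tau>"
    for \<tau> \<sigma> \<sigma>' x
    by (rule integral_form_agree[OF smooth _ that(1) bdry[OF that(1)] that(2,4,3,5,6)]) (rule int)
  have glue: "u \<sigma> \<bullet> x = u \<sigma>' \<bullet> x"
    if "\<sigma> \<in> cones \<Sigma> (int d)" "\<sigma>' \<in> cones \<Sigma> (int d)" "x \<in> \<sigma> \<inter> \<sigma>'" for \<sigma> \<sigma>' x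
    by (rule forms_glue[OF smooth _ that]) (rule agree)
  \<comment> \<open>By \<open>glue\<close> every maximal cone through \<open>x\<close> gives the
    same value.\<close>
  define f where "f x = u (SOME \<sigma>. \<sigma> \<in> cones \<Sigma> (int d) \<and> x \<in> \<sigma>) \<bullet> x" for x
  have f: "f x = u \<sigma> \<bullet> x" if "\<sigma> \<in> cones \<Sigma> (int d)" "x \<in> \<sigma>" for \<sigma> x
  proof -
    let ?\<zeta> = "SOME \<sigma>. \<sigma> \<in> cones \<Sigma> (int d) \<and> x \<in> \<sigma>"
    have "?\<zeta> \<in> cones \<Sigma> (int d) \<and> x \<in> ?\<zeta>" by (rule someI[of _ \<sigma>]) (use that in simp)
    then have "?\<zeta> \<in> cones \<Sigma> (int d)" "x \<in> ?\<zeta> \<inter> \<sigma>" using that(2) by simp_all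
    then show ?thesis unfolding f_def by (intro glue that(1))
  qed
  have top: "\<exists>\<sigma>\<in>cones \<Sigma> (int d). \<zeta> \<subseteq> \<sigma>" if "\<zeta> \<in> \<Sigma>" for \<zeta>
    using exists_top_cone[OF that] by (auto simp: cones_def)
  have rep: "represents_on N \<zeta> f (\<lambda>x. u \<sigma> \<bullet> x)" if "\<sigma> \<in> cones \<Sigma> (int d)" "\<zeta> \<subseteq> \<sigma>" for \<zeta> \<sigma>
    unfolding represents_on_def
  proof (intro conjI ballI)
    show "linear (\<lambda>x. u \<sigma> \<bullet> x)" by (rule bounded_linear.linear[OF bounded_linear_inner_right])
    have "sublattice N \<zeta> \<subseteq> sublattice N \<sigma>" using span_mono[OF that(2)] by (auto simp: sublattice_def)
    then show "(\<lambda>x. u \<sigma> \<bullet> x) ` sublattice N \<zeta> \<subseteq> \<int>" using int[OF that(1)] by blast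
    show "f x = u \<sigma> \<bullet> x" if "x \<in> \<zeta>" for x using f \<open>\<sigma> \<in> cones \<Sigma> (int d)\<close> \<open>\<zeta> \<subseteq> \<sigma>\<close> that by blast
  qed
  have "continuous_on (\<Union>\<sigma>\<in>cones \<Sigma> (int d). \<sigma>) f"
  proof (rule continuous_on_closed_Union)
    show "finite (cones \<Sigma> (int d))" using finite_cones[of "int d" "\<lambda>_. True"] by simp
    show "closed \<sigma>" if "\<sigma> \<in> cones \<Sigma> (int d)" for \<sigma> using cone(3)[OF cones_mem[OF that]] .
    show "continuous_on \<sigma> f" if "\<sigma> \<in> cones \<Sigma> (int d)" for \<sigma>
      by (subst continuous_on_cong[OF refl f[OF that]]) (auto intro: continuous_intros)
  qed
  moreover have "(\<Union>\<sigma>\<in>cones \<Sigma> (int d). \<sigma>) = \<Union>\<Sigma>"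
    using top unfolding cones_def by blast
  ultimately have cil: "conewise_integral_linear N \<Sigma> f"
    unfolding conewise_integral_linear_def using top rep by metis
  \<comment> \<open>\<open>cone_form\<close> chooses a form on the ambient space that
    \<open>f\<close> determines only on \<open>span \<zeta>\<close>, so the comparison is restricted
    to that span.\<close>
  have form: "cone_form N f \<zeta> x = u \<sigma> \<bullet> x"
    if "\<sigma> \<in> cones \<Sigma> (int d)" "\<zeta> \<in> \<Sigma>" "\<zeta> \<subseteq> \<sigma>" "x \<in> span \<zeta>" for \<sigma> \<zeta> x
    using linear_eq_on_span[of "cone_form N f \<zeta>" "\<lambda>x. u \<sigma> \<bullet> x" \<zeta> x] that
      cone_form_represents[OF cil that(2)] rep[OF that(1,3)] by (auto simp: represents_on_def)
  have "is_div N d \<Sigma> f w" unfolding is_div_def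
  proof
    fix \<tau> assume \<tau>: "\<tau> \<in> cones \<Sigma> (int d - 1)"
    let ?S = "{\<sigma>. \<sigma> \<in> cones \<Sigma> (int d) \<and> \<tau> \<subseteq> \<sigma>}"
    \<comment> \<open>The family \<open>u\<close> is controlled on maximal cones only; the form of
      any of them around \<open>\<tau>\<close> represents \<open>f\<close> on
      \<open>\<tau>\<close>.\<close>
    obtain \<sigma>0 where \<sigma>0: "\<sigma>0 \<in> cones \<Sigma> (int d)" "\<tau> \<subseteq> \<sigma>0" using top[OF cones_mem[OF \<tau>]] by blast
    let ?r = "(\<Sum>\<sigma>\<in>?S. u \<sigma> \<bullet> ray_lift N \<tau> \<sigma>) - u \<sigma>0 \<bullet> (\<Sum>\<sigma>\<in>?S. ray_lift N \<tau> \<sigma>)"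
    have "real_scale ?r (orient N \<tau>) = int_scale (- w \<tau>) (orient N \<tau>)"
      unfolding bdry[OF \<tau>, symmetric]
      by (rule boundary_interior_mult_agree[OF \<tau>, symmetric]) (use agree[OF \<tau> _ \<sigma>0(1) _ \<sigma>0(2)] in blast)
    then have "real_scale (?r + of_int (w \<tau>)) (orient N \<tau>) = 0"
      by (simp add: int_scale_real_scale real_scale_linear)
    then have "of_int (w \<tau>) = - ?r"
      using orient_basis_props(8)[OF cones_mem[OF \<tau>]] by (simp add: real_scale_eq_0_iff)
    moreover have "(\<Sum>\<sigma>\<in>?S. cone_form N f \<sigma> (ray_lift N \<tau> \<sigma>)) = (\<Sum>\<sigma>\<in>?S. u \<sigma> \<bullet> ray_lift N \<tau> \<sigma>)"
    proof (rule sum.cong[OF refl])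
      fix \<sigma> assume "\<sigma> \<in> ?S"
      then show "cone_form N f \<sigma> (ray_lift N \<tau> \<sigma>) = u \<sigma> \<bullet> ray_lift N \<tau> \<sigma>"
        using codim_1_face.ray_lift(1)[OF codim_1_face[of \<sigma> "int d" \<tau>]] \<tau>
        by (intro form) (auto simp: sublattice_def cones_mem)
    qed
    ultimately show "of_int (w \<tau>) = ord_along N d \<Sigma> f \<tau>"
      unfolding ord_along_def
      using form[OF \<sigma>0(1) cones_mem[OF \<tau>] \<sigma>0(2) sum_ray_lift_in_span[OF \<tau>]] by simp
  qed
  then show ?thesis using cil by (auto simp: principal_divisor_def)
qed

text \<open>In degree one \<open>F_lower\<close> at the origin comes from the group \<open>M\<close>
  generated by all \<open>N\<^sub>\<sigma>\<close>, which may be smaller than \<open>N\<close>. The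
  form is therefore prescribed on a basis of \<open>M\<close>, and additivity extends it to all of
  \<open>M\<close>.\<close>

lemma exists_linear_form_of_dual:
  assumes \<alpha>: "\<alpha> \<in> carrier (F_upper N \<Sigma> 1 {0})"
  shows "\<exists>u. \<forall>\<sigma>\<in>\<Sigma>. \<forall>v\<in>sublattice N \<sigma>. of_int (\<alpha> (wedge [v])) = u \<bullet> v"
proof -
  define M where "M = group_closure (\<Union>\<sigma>\<in>\<Sigma>. sublattice N \<sigma>)"
  have "M \<subseteq> group_closure N" unfolding M_def by (rule group_closure_mono) (auto simp: sublattice_def)
  then have "zlattice M"
    by (intro zlattice_subgroup[OF N]) (auto simp: zlattice_group_closure[OF N] M_def group_closure_idem)
  then obtain bs where bs: "lattice_basis M bs" by (auto simp: zlattice_def)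
  obtain u where u: "\<And>b. b \<in> set bs \<Longrightarrow> u \<bullet> b = of_int (\<alpha> (wedge [b]))"
    using exists_prescribed_inner[OF lattice_basisD(2)[OF bs], of "\<lambda>b. of_int (\<alpha> (wedge [b]))"] by blast
  have hom: "\<alpha> (x + y) = \<alpha> x + \<alpha> y" if "x \<in> F_lower N \<Sigma> 1 {0}" "y \<in> F_lower N \<Sigma> 1 {0}" for x y
    using \<alpha> that by (auto simp: F_upper_def dual_group_def additive_group_def hom_def integer_group_def)
  have wd: "wedge [x - y] = wedge [x] - wedge [y]" for x y :: 'a
    using ext_mult_linear(5)[of "x - y" y "wedge []"] by simp
  have F: "wedge [v] \<in> F_lower N \<Sigma> 1 {0}" if "v \<in> M" for v
    using that unfolding M_def
  proof induction
    case (base v)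
    then show ?case
    proof
      assume "v = 0"
      then show ?thesis by (simp add: F_lower_def)
    next
      assume "v \<in> (\<Union>\<sigma>\<in>\<Sigma>. sublattice N \<sigma>)"
      then obtain \<sigma> where \<sigma>: "\<sigma> \<in> \<Sigma>" "v \<in> sublattice N \<sigma>" by blast
      then have "wedge [v] \<in> ext_power 1 (sublattice N \<sigma>)" using wedge_in_ext_power[of "[v]"] by simp
      then show ?thesis using \<sigma>(1) cone(4) unfolding F_lower_def by (intro group_closure.base) auto
    qed
  next
    case (diff x y)
    then show ?case unfolding wd F_lower_def by (intro group_closure.diff)
  qed
  \<comment> \<open>Membership in \<open>M\<close> is carried along because \<open>\<alpha>\<close>
    is additive only on \<open>F_lower\<close>.\<close>
  have "v \<in> M \<and> of_int (\<alpha> (wedge [v])) = u \<bullet> v" if "v \<in> group_closure (set bs)" for v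
    using that
  proof induction
    case (base v)
    have "0 \<in> M" by (simp add: M_def)
    have "\<alpha> 0 = 0" using hom[of 0 0] by (simp add: F_lower_def)
    then show ?case using base u lattice_basisD(4)[OF bs] \<open>0 \<in> M\<close> by auto
  next
    case (diff x y)
    have "x - y \<in> M" using diff.IH unfolding M_def by (auto intro: group_closure.diff)
    have "wedge [x] = wedge [x - y] + wedge [y]" unfolding wd by simp
    then have "\<alpha> (wedge [x]) = \<alpha> (wedge [x - y]) + \<alpha> (wedge [y])"
      using hom[OF F[OF \<open>x - y \<in> M\<close>] F] diff.IH by simp
    then show ?case using diff.IH \<open>x - y \<in> M\<close> by (simp add: inner_diff_right)
  qed
  moreover have "v \<in> group_closure (set bs)" if "\<sigma> \<in> \<Sigma>" "v \<in> sublattice N \<sigma>" for v \<sigma>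
    using lattice_basisD(3)[OF bs] that unfolding M_def by (auto intro: group_closure.base)
  ultimately show ?thesis by blast
qed

lemma linear_on_fanI:
  assumes pd: "poincare_duality N d \<Sigma>" and f: "conewise_integral_linear N \<Sigma> f"
    and div: "is_div N d \<Sigma> f (\<lambda>_. 0)"
  shows "linear_on_fan \<Sigma> f"
proof -
  define u where "u \<sigma> = adjoint (cone_form N f \<sigma>) 1" for \<sigma>
  note rep = cone_form_represents[OF f]
  have u: "u \<sigma> \<bullet> x = cone_form N f \<sigma> x" if "\<sigma> \<in> \<Sigma>" for \<sigma> x
    using adjoint_clauses(2)[of "cone_form N f \<sigma>" 1 x] rep[OF that] by (simp add: u_def represents_on_def)
  have uf: "u \<sigma> \<bullet> x = f x" if "\<sigma> \<in> \<Sigma>" "x \<in> \<sigma>" for \<sigma> x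
    using u[OF that(1)] rep[OF that(1)] that(2) by (simp add: represents_on_def)
  show ?thesis
  \<comment> \<open>Duality is stated for \<open>p\<close> at most \<open>d\<close>, so
    \<open>p = 1\<close> needs positive \<open>d\<close>; in dimension zero the support is the
    origin.\<close>
  proof (cases "d = 0")
    case True
    have "f x = 0" if x: "x \<in> \<Union>\<Sigma>" for x
    proof -
      obtain \<sigma> where \<sigma>: "\<sigma> \<in> \<Sigma>" "x \<in> \<sigma>" using x by blast
      then have "dim \<sigma> = 0" using dim_le True by force
      then have "x = 0" using \<sigma>(2) by (auto simp: dim_eq_0)
      then show ?thesis using uf[OF \<sigma>] by simp
    qed
    then show ?thesis unfolding linear_on_fan_def by (intro exI[of _ "\<lambda>_. 0"]) (simp add: linear_zero)
  next
    case False
    have int: "u \<sigma> \<bullet> v \<in> \<int>" if "\<sigma> \<in> \<Sigma>" "v \<in> set (orient_basis N \<sigma>)" for \<sigma> v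
      using u[OF that(1), of v] rep[OF that(1)] orient_basis_props(5)[OF that(1)] that(2)
      by (auto simp: represents_on_def)
    have agree: "u \<sigma> \<bullet> x = u \<tau> \<bullet> x" if "\<sigma> \<in> \<Sigma>" "\<tau> \<in> \<Sigma>" "\<tau> \<subseteq> \<sigma>" "x \<in> span \<tau>" for \<sigma> \<tau> x
    proof -
      have "linear (\<lambda>x. u \<sigma> \<bullet> x)" "linear (\<lambda>x. u \<tau> \<bullet> x)"
        by (rule bounded_linear.linear[OF bounded_linear_inner_right])+
      then show ?thesis by (rule linear_eq_on_span[OF _ _ _ that(4)]) (use uf that in force)
    qed
    define c where "c = (\<lambda>\<sigma>\<in>cones \<Sigma> (int d). interior_mult (u \<sigma>) (orient N \<sigma>))"
    have "c \<in> carrier (BM_cycles N \<Sigma> (d - 1) (int d))"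
      unfolding mem_BM_cycles_iff
    proof
      have "interior_mult (u \<sigma>) (orient N \<sigma>) \<in> F_lower N \<Sigma> (d - 1) \<sigma>" if \<sigma>: "\<sigma> \<in> cones \<Sigma> (int d)" for \<sigma>
      proof -
        have "interior_mult (u \<sigma>) (orient N \<sigma>) \<in> ext_power (length (orient_basis N \<sigma>) - 1) (sublattice N \<sigma>)"
          unfolding orient_def using int[OF cones_mem[OF \<sigma>]]
          by (intro interior_mult_wedge_in_ext_power orient_basis_props(5)[OF cones_mem[OF \<sigma>]])
        then show ?thesis
          using orient_basis_props(7)[OF cones_mem[OF \<sigma>]] \<sigma> unfolding F_lower_top[OF \<sigma>] by (simp add: cones_def)
      qed
      then show "c \<in> carrier (BM_chains N \<Sigma> (d - 1) (int d))" by (simp add: c_def carrier_BM_chains)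
      show "\<forall>\<tau>\<in>cones \<Sigma> (int d - 1). BM_boundary N \<Sigma> (int d) c \<tau> = 0"
      proof
        fix \<tau> assume \<tau>: "\<tau> \<in> cones \<Sigma> (int d - 1)"
        let ?S = "{\<sigma>. \<sigma> \<in> cones \<Sigma> (int d) \<and> \<tau> \<subseteq> \<sigma>}"
        have "BM_boundary N \<Sigma> (int d) c \<tau> =
            (\<Sum>\<sigma>\<in>?S. int_scale (face_sign N \<tau> \<sigma>) (interior_mult (u \<sigma>) (orient N \<sigma>)))"
          unfolding BM_boundary_eq[OF \<tau>] by (rule sum.cong) (auto simp: c_def)
        also have "\<dots> = real_scale ((\<Sum>\<sigma>\<in>?S. u \<sigma> \<bullet> ray_lift N \<tau> \<sigma>) - u \<tau> \<bullet> (\<Sum>\<sigma>\<in>?S. ray_lift N \<tau> \<sigma>)) (orient N \<tau>)"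
          by (rule boundary_interior_mult_agree[OF \<tau>]) (use agree cones_mem \<tau> in blast)
        also have "(\<Sum>\<sigma>\<in>?S. u \<sigma> \<bullet> ray_lift N \<tau> \<sigma>) - u \<tau> \<bullet> (\<Sum>\<sigma>\<in>?S. ray_lift N \<tau> \<sigma>) = - ord_along N d \<Sigma> f \<tau>"
        proof -
          have "(\<Sum>\<sigma>\<in>?S. u \<sigma> \<bullet> ray_lift N \<tau> \<sigma>) = (\<Sum>\<sigma>\<in>?S. cone_form N f \<sigma> (ray_lift N \<tau> \<sigma>))"
            by (rule sum.cong) (auto simp: u cones_def)
          then show ?thesis unfolding ord_along_def using u[OF cones_mem[OF \<tau>]] by simp
        qed
        also have "ord_along N d \<Sigma> f \<tau> = 0" using div \<tau> by (simp add: is_div_def)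
        finally show "BM_boundary N \<Sigma> (int d) c \<tau> = 0" by simp
      qed
    qed
    then obtain \<alpha> where \<alpha>: "\<alpha> \<in> carrier (F_upper N \<Sigma> 1 {0})"
      "\<And>\<sigma>. \<sigma> \<in> cones \<Sigma> (int d) \<Longrightarrow> c \<sigma> = contraction 1 \<alpha> (orient_basis N \<sigma>)"
      using cap_fundamental_surj[OF pd, of 1 c] False by auto
    obtain u' where u': "\<And>\<sigma> v. \<sigma> \<in> \<Sigma> \<Longrightarrow> v \<in> sublattice N \<sigma> \<Longrightarrow> of_int (\<alpha> (wedge [v])) = u' \<bullet> v"
      using exists_linear_form_of_dual[OF \<alpha>(1)] by blast
    have "f x = u' \<bullet> x" if x: "x \<in> \<Union>\<Sigma>" for x
    proof -
      obtain \<zeta> where "\<zeta> \<in> \<Sigma>" "x \<in> \<zeta>" using x by blast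
      then obtain \<sigma> where \<sigma>: "\<sigma> \<in> \<Sigma>" "dim \<sigma> = d" "x \<in> \<sigma>" using exists_top_cone by blast
      note B = orient_basis_props[OF \<sigma>(1)]
      have \<sigma>d: "\<sigma> \<in> cones \<Sigma> (int d)" using \<sigma> by (simp add: cones_def)
      have "interior_mult (u \<sigma>) (orient N \<sigma>) = contraction 1 \<alpha> (orient_basis N \<sigma>)"
        using \<alpha>(2)[OF \<sigma>d] \<sigma>d by (simp add: c_def)
      also have "\<dots> = interior_mult u' (wedge (orient_basis N \<sigma>))"
        by (rule contraction_1) (use u'[OF \<sigma>(1)] B(5) in blast)
      \<comment> \<open>Equal contractions of the orientation force the two forms to agree on
        \<open>span \<sigma>\<close>.\<close>
      finally have "u \<sigma> \<bullet> x = u' \<bullet> x"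
        unfolding orient_def
        by (rule interior_mult_wedge_inject[OF B(2,3)]) (use \<sigma>(3) B(6) in \<open>simp add: span_base\<close>)
      then show ?thesis using uf[OF \<sigma>(1,3)] by simp
    qed
    then show ?thesis unfolding linear_on_fan_def
      by (intro exI[of _ "\<lambda>x. u' \<bullet> x"]) (simp add: bounded_linear.linear[OF bounded_linear_inner_right])
  qed
qed

end

theorem theorem4p11:
  fixes N :: "'v::euclidean_space set" and \<Sigma> :: "'v set set" and d :: nat
  assumes "zlattice N" and "tropical_fan N d \<Sigma>" and "smooth_fan N d \<Sigma>"
  shows "principal_fan N d \<Sigma> \<and> div_faithful_fan N d \<Sigma>"
proof -
  interpret tropical N \<Sigma> d
    by unfold_locales (use assms(1,2) in \<open>auto simp: tropical_fan_def\<close>)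
  have star: "tropical_star N \<Sigma> d \<eta>" if "\<eta> \<in> \<Sigma>" for \<eta> by unfold_locales (rule that)
  have pd: "poincare_duality (quot_lattice N \<eta>) (d - dim \<eta>) (star_fan \<Sigma> \<eta>)" if "\<eta> \<in> \<Sigma>" for \<eta>
    using assms(3) that by (simp add: smooth_fan_def)
  show ?thesis unfolding principal_fan_def div_faithful_fan_def
    using tropical.principal_divisorI[OF tropical_star.tropical_star[OF star] pd
        tropical_star.smooth_fan_star[OF star assms(3)]]
      tropical.linear_on_fanI[OF tropical_star.tropical_star[OF star] pd] by blast
qed

end
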